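(* Let $\Omega,T,u_{\rm ini},f,q^I,q^P,\vec v$ satisfy the data assumptions listed in the context. Then there exists at most one weak solution $\bar u\in L^2(\Omega\times(0,T))$ of the linear advection problem.
   Context: **Data assumptions.** $\Omega$ is an open bounded connected polyhedral subset of $\mathbb R^d$, $d\ge 1$, $T>0$; $u_{\rm ini}\in L^2(\Omega)$, $f\in L^2(\Omega\times(0,T))$; $q^I,q^P\in L^\infty(\Omega\times(0,T))$ with $q^I\ge0$ and $q^P\ge 0$ a.e.; $\vec v\in W^{1,\infty}(\Omega\times(0,T))^d$ satisfies $\vec v\cdot\boldsymbol n=0$ on $\partial\Omega\times(0,T)$ ($\boldsymbol n$ the outer normal to $\partial\Omega$) and $\operatorname{div}\vec v=q^I-q^P$ a.e. in $\Omega\times(0,T)$ (divergence in space). **Weak solution.** $C^\infty_c(\mathbb R^d\times[0,T))$ is the set of restrictions to $\mathbb R^d\times[0,T)$ of functions of $C^\infty_c(\mathbb R^d\times(-\infty,T))$. A weak solution of the linear advection problem ($\partial_t\bar u+\operatorname{div}(\bar u\vec v)+\bar uq^P=fq^I$, $\bar u(\cdot,0)=u_{\rm ini}$) is a function $\bar u\in L^2(\Omega\times(0,T))$ such that for all $\varphi\in C^\infty_c(\mathbb R^d\times[0,T))$ $$-\int_0^T\!\!\int_\Omega\bar u\,\partial_t\varphi\,dx\,dt-\int_\Omega u_{\rm ini}\varphi(\cdot,0)\,dx+\int_0^T\!\!\int_\Omega(-\bar u\,\vec v\cdot\nabla\varphi+\bar u\,q^P\varphi)\,dx\,dt=\int_0^T\!\!\int_\Omega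 f\,q^I\varphi\,dx\,dt.$$ Uniqueness is understood in $L^2(\Omega\times(0,T))$, i.e. up to equality a.e. *)

theory Defs
  imports "HOL-Analysis.Analysis"
begin

subsection \<open>Domains\<close>

text \<open>A polyhedral open set is the interior of a polyhedron, i.e. of a finite union of convex
  polytopes. Such a set is not required to be convex or Lipschitz, but it lies on one side of
  each of its facets, so that the outer normal makes sense.\<close>

definition polyhedral :: "'a::euclidean_space set \<Rightarrow> bool" where
  "polyhedral \<Omega> \<longleftrightarrow> (\<exists>P. finite P \<and> (\<forall>p\<in>P. polytope p) \<and> \<Omega> = interior (\<Union>P))"

text \<open>The boundary points of a polyhedral set that possess an outer normal are those in the
  relative interior of a facet, where the set locally coincides with an open half-space. The
  remaining boundary points form a null set for the surface measure.\<close>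

definition outer_normal :: "'a::euclidean_space set \<Rightarrow> 'a \<Rightarrow> 'a \<Rightarrow> bool" where
  "outer_normal \<Omega> x n \<longleftrightarrow> norm n = 1 \<and>
     (\<exists>r>0. \<Omega> \<inter> ball x r = {y \<in> ball x r. (y - x) \<bullet> n < 0})"

subsection \<open>Lebesgue spaces\<close>

definition L2 :: "'a::euclidean_space set \<Rightarrow> ('a \<Rightarrow> real) set" where
  "L2 U = {g \<in> borel_measurable (lebesgue_on U). integrable (lebesgue_on U) (\<lambda>z. (g z)\<^sup>2)}"

definition Linf :: "'a::euclidean_space set \<Rightarrow> ('a \<Rightarrow> real) set" where
  "Linf U = {g \<in> borel_measurable (lebesgue_on U). \<exists>C. AE z in lebesgue_on U. \<bar>g z\<bar> \<le> C}"

definition locally_integrable :: "'a::euclidean_space set \<Rightarrow> ('a \<Rightarrow> real) \<Rightarrow> bool" where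
  "locally_integrable U g \<longleftrightarrow> (\<forall>K. compact K \<longrightarrow> K \<subseteq> U \<longrightarrow> integrable (lebesgue_on K) g)"

subsection \<open>Smooth functions with compact support\<close>

definition partial_deriv :: "'a::euclidean_space \<Rightarrow> ('a \<Rightarrow> real) \<Rightarrow> 'a \<Rightarrow> real" where
  "partial_deriv e \<phi> z = frechet_derivative \<phi> (at z) e"

text \<open>A function is of class \<open>C\<^sup>\<infinity>\<close> iff all its iterated partial derivatives, of any order and
  including the function itself, are differentiable everywhere.\<close>

definition smooth :: "('a::euclidean_space \<Rightarrow> real) \<Rightarrow> bool" where
  "smooth \<phi> \<longleftrightarrow> (\<forall>es. set es \<subseteq> Basis \<longrightarrow> (\<forall>z. foldr partial_deriv es \<phi> differentiable at z))"

text \<open>For open \<open>U\<close>, a function in \<open>C\<^sub>c\<^sup>\<infinity>(U)\<close> is identified with its extension by zero to the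
  whole space.\<close>

definition Cc_inf :: "'a::euclidean_space set \<Rightarrow> ('a \<Rightarrow> real) set" where
  "Cc_inf U = {\<phi>. smooth \<phi> \<and> compact (closure {z. \<phi> z \<noteq> 0}) \<and> closure {z. \<phi> z \<noteq> 0} \<subseteq> U}"

subsection \<open>Weak derivatives\<close>

definition has_weak_partial ::
    "'a::euclidean_space set \<Rightarrow> 'a \<Rightarrow> ('a \<Rightarrow> real) \<Rightarrow> ('a \<Rightarrow> real) \<Rightarrow> bool" where
  "has_weak_partial U e g h \<longleftrightarrow> locally_integrable U g \<and> locally_integrable U h \<and>
     (\<forall>\<phi>\<in>Cc_inf U. (\<integral>z. g z * partial_deriv e \<phi> z \<partial>lebesgue_on U)
                    = - (\<integral>z. h z * \<phi> z \<partial>lebesgue_on U))"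

definition W1inf :: "'a::euclidean_space set \<Rightarrow> ('a \<Rightarrow> real) set" where
  "W1inf U = {g \<in> Linf U. \<forall>e\<in>Basis. \<exists>h\<in>Linf U. has_weak_partial U e g h}"

subsection \<open>Vector fields on a space-time cylinder\<close>

definition cylinder :: "'a::euclidean_space set \<Rightarrow> real \<Rightarrow> ('a \<times> real) set" where
  "cylinder \<Omega> T = \<Omega> \<times> {0<..<T}"

definition W1inf_field :: "('a::euclidean_space \<times> real) set \<Rightarrow> ('a \<times> real \<Rightarrow> 'a) set" where
  "W1inf_field Q = {v. \<forall>b\<in>Basis. (\<lambda>z. v z \<bullet> b) \<in> W1inf Q}"

definition has_weak_space_div ::
    "('a::euclidean_space \<times> real) set \<Rightarrow> ('a \<times> real \<Rightarrow> 'a) \<Rightarrow> ('a \<times> real \<Rightarrow> real) \<Rightarrow> bool" where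
  "has_weak_space_div Q v q \<longleftrightarrow>
     (\<exists>D. (\<forall>b\<in>Basis. has_weak_partial Q (b, 0) (\<lambda>z. v z \<bullet> b) (D b)) \<and>
          (AE z in lebesgue_on Q. (\<Sum>b\<in>Basis. D b z) = q z))"

text \<open>The boundary values of a \<open>W\<^sup>1\<^sup>,\<^sup>\<infinity>\<close> field are those of its continuous representative, which
  is Lipschitz near the relative interior of each facet and hence extends continuously to it.\<close>

definition zero_normal_trace ::
    "'a::euclidean_space set \<Rightarrow> real \<Rightarrow> ('a \<times> real \<Rightarrow> 'a) \<Rightarrow> bool" where
  "zero_normal_trace \<Omega> T v \<longleftrightarrow>
     (\<exists>w. continuous_on (cylinder \<Omega> T) w \<and>
          (AE z in lebesgue_on (cylinder \<Omega> T). w z = v z) \<and>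
          (\<forall>x n. outer_normal \<Omega> x n \<longrightarrow>
             (\<forall>t\<in>{0<..<T}. ((\<lambda>z. w z \<bullet> n) \<longlongrightarrow> 0) (at (x, t) within cylinder \<Omega> T))))"

subsection \<open>Weak solutions of the linear advection problem\<close>

definition time_deriv :: "('a::euclidean_space \<times> real \<Rightarrow> real) \<Rightarrow> 'a \<times> real \<Rightarrow> real" where
  "time_deriv \<phi> z = partial_deriv (0, 1) \<phi> z"

definition space_grad :: "('a::euclidean_space \<times> real \<Rightarrow> real) \<Rightarrow> 'a \<times> real \<Rightarrow> 'a" where
  "space_grad \<phi> z = (\<Sum>b\<in>Basis. partial_deriv (b, 0) \<phi> z *\<^sub>R b)"

text \<open>The test functions are restrictions to \<open>t \<ge> 0\<close> of functions in \<open>Cc_inf (UNIV \<times> {..<T})\<close>;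
  the restriction is left implicit, as only values and derivatives there enter. The iterated
  integrals over \<open>(0,T)\<close> and \<open>\<Omega>\<close> are written as integrals over the cylinder.\<close>

definition weak_solution ::
    "'a::euclidean_space set \<Rightarrow> real \<Rightarrow> ('a \<Rightarrow> real) \<Rightarrow> ('a \<times> real \<Rightarrow> real) \<Rightarrow>
     ('a \<times> real \<Rightarrow> real) \<Rightarrow> ('a \<times> real \<Rightarrow> real) \<Rightarrow> ('a \<times> real \<Rightarrow> 'a) \<Rightarrow>
     ('a \<times> real \<Rightarrow> real) \<Rightarrow> bool" where
  "weak_solution \<Omega> T u_ini f qI qP v u \<longleftrightarrow>
     u \<in> L2 (cylinder \<Omega> T) \<and>
     (\<forall>\<phi> \<in> Cc_inf (UNIV \<times> {..<T}).
        - (\<integral>z. u z * time_deriv \<phi> z \<partial>lebesgue_on (cylinder \<Omega> T))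
        - (\<integral>x. u_ini x * \<phi> (x, 0) \<partial>lebesgue_on \<Omega>)
        + (\<integral>z. - u z * (v z \<bullet> space_grad \<phi> z) + u z * qP z * \<phi> z \<partial>lebesgue_on (cylinder \<Omega> T))
        = (\<integral>z. f z * qI z * \<phi> z \<partial>lebesgue_on (cylinder \<Omega> T)))"

end

theory Submission
  imports Defs
begin

text \<open>
  The difference \<open>u\<close> of two solutions, extended by zero, satisfies
  \<open>\<partial>\<^sub>t u + div (u v) + u q\<^sup>P = 0\<close> against test functions that do not vanish on the boundary. Hence
  the equation holds on the whole space for any extension of \<open>v\<close>, and the boundary plays no
  role where \<open>v\<close> has a Lipschitz extension, i.e. away from the pairwise intersections of the
  hyperplanes bounding the polyhedron: near any other point the domain is convex.
  The equation is mollified; since \<open>v\<close> is Lipschitz, the commutator at \<open>z\<close> is bounded by the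
  average of \<open>|u|\<close> over a small ball around \<open>z\<close>, that is by \<open>|u z|\<close> up to the mean
  oscillation of \<open>u\<close>, whose integral tends to 0. Testing with a renormalisation
  \<open>\<beta>(u)\<close>, \<open>\<beta> s = s\<^sup>2 / (1 + s\<^sup>2)\<close>, times an exponential weight in time gives \<open>\<beta>(u) = 0\<close>.
  Boundedness of \<open>\<beta>\<close> is what makes the cut-off around the singular set harmless: its gradient is
  \<open>O(1/\<delta>)\<close> on a set of measure \<open>O(\<delta>\<^sup>2)\<close>.
\<close>

subsection \<open>Smooth bump functions\<close>

text \<open>The velocity has the Lipschitz constant \<open>L\<close> only along segments inside the
  cylinder, and extending it across the boundary costs a constant \<open>K\<close> that may blow up
  as \<delta> tends to 0. The bookkeeping keeps \<open>K\<close> out of the growth rate of the time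
  weight, which is fixed before \<delta>. At a point of the cylinder the commutator sees
  \<open>L\<close> alone. At a point outside, where \<open>K\<close> enters, the zero extension
  turns \<open>renorm\<close> of the mollified solution into a mere mollification error, so
  \<open>K\<close> only ever multiplies a mean oscillation. Hence the order of the choices:
  \<delta>, then the extension, then \<epsilon>.

  The commutator has to be bounded, not small: a bound by |u| becomes one by \<beta>(u), because |s
  \<beta>'(s)| \<le> 2 \<beta>(s), and the exponential weight absorbs it.

  Test functions are free at t = 0 and the data cancel in the difference, so the zero extension
  solves the equation for negative times too. Only t = T has to be avoided; the weight does so by
  vanishing from some T' < T on.\<close>

definition flat :: "nat \<Rightarrow> real \<Rightarrow> real" where
  "flat k s = (if s > 0 then exp (- 1 / s) / s ^ k else 0)"

lemma flat_nonneg: "0 \<le> flat k s"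
  by (simp add: flat_def)

text \<open>One term of the series of \<open>exp (1/s)\<close> is at most its sum. The bound is
  uniform in \<open>s\<close>, so the bump and its gradient get explicit constants, from
  \<open>fact 0\<close> and \<open>fact 2\<close>.\<close>

lemma flat_le: "flat k s \<le> fact k"
proof (cases "s > 0")
  case True
  have "(1/s) ^ k / fact k \<le> exp (1/s)"
  proof -
    have "(\<lambda>n. (1/s) ^ n /\<^sub>R fact n) sums exp (1/s)" by (rule exp_converges)
    then have s: "(\<lambda>n. (1/s) ^ n / fact n) sums exp (1/s)" by (simp add: divide_inverse mult.commute)
    have "sum (\<lambda>n. (1/s) ^ n / fact n) {k} \<le> suminf (\<lambda>n. (1/s) ^ n / fact n)"
      by (rule sum_le_suminf) (use s True in \<open>auto simp: sums_iff\<close>)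
    then show ?thesis using s by (simp add: sums_iff)
  qed
  then show ?thesis
    using True by (simp add: flat_def exp_minus field_simps)
qed (simp add: flat_def)

lemma flat_0_pos: "s > 0 \<Longrightarrow> flat 0 s > 0"
  by (simp add: flat_def)

lemma flat_tendsto_0: "((\<lambda>h. flat k h) \<longlongrightarrow> 0) (at 0)"
proof -
  have "((\<lambda>h. flat k h) \<longlongrightarrow> 0) (at_right 0)"
  proof -
    have "((\<lambda>x::real. x ^ k / exp x) \<longlongrightarrow> 0) at_top"
      by (rule tendsto_power_div_exp_0)
    then have "((\<lambda>h::real. inverse h ^ k / exp (inverse h)) \<longlongrightarrow> 0) (at_right 0)"
      by (rule filterlim_compose) (rule filterlim_inverse_at_top_right)
    then show ?thesis
      by (rule Lim_transform_eventually)
        (auto simp: flat_def exp_minus field_simps eventually_at_filter)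
  qed
  moreover have "((\<lambda>h. flat k h) \<longlongrightarrow> 0) (at_left 0)"
    by (rule Lim_transform_eventually[OF tendsto_const])
      (auto simp: flat_def eventually_at_filter)
  ultimately show ?thesis by (simp add: filterlim_split_at)
qed

text \<open>The index \<open>k\<close> exists for this closure: differentiating exp(-1/s) only
  creates further powers of 1/s. At 0 the difference quotient is itself in the family, namely
  \<open>flat (Suc k)\<close>, and tends to 0.\<close>

lemma flat_has_derivative:
  "(flat k has_real_derivative (flat (k + 2) s - real k * flat (k + 1) s)) (at s)"
proof -
  consider "s > 0" | "s < 0" | "s = 0" by linarith
  then show ?thesis
  proof cases
    case 1
    let ?i = "inverse s"
    have "((\<lambda>s. exp (- inverse s) * inverse s ^ k) has_real_derivative
        exp (- ?i) * (- (- (?i * 1 * ?i))) * ?i ^ k + (real k * ((- (?i * 1 * ?i)) * ?i ^ (k - Suc 0))) * exp (- ?i)) (at s)"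
      by (intro DERIV_mult DERIV_power DERIV_fun_exp DERIV_minus DERIV_inverse' DERIV_ident)
        (use 1 in auto)
    moreover have "exp (- ?i) * (- (- (?i * 1 * ?i))) * ?i ^ k + (real k * ((- (?i * 1 * ?i)) * ?i ^ (k - Suc 0))) * exp (- ?i)
        = flat (k + 2) s - real k * flat (k + 1) s"
      using 1 by (cases k) (auto simp: flat_def divide_inverse power_inverse algebra_simps)
    ultimately have "((\<lambda>s. exp (- 1 / s) / s ^ k) has_real_derivative
        (flat (k + 2) s - real k * flat (k + 1) s)) (at s)"
      by (simp add: divide_inverse power_inverse)
    then show ?thesis
      by (rule has_field_derivative_transform_within_open[of _ _ _ "{0<..}"])
        (use 1 in \<open>auto simp: flat_def\<close>)
  next
    case 2
    have "((\<lambda>s. 0) has_real_derivative (flat (k + 2) s - real k * flat (k + 1) s)) (at s)"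
      using 2 by (simp add: flat_def)
    then show ?thesis
      by (rule has_field_derivative_transform_within_open[of _ _ _ "{..<0}"])
        (use 2 in \<open>auto simp: flat_def\<close>)
  next
    case 3
    have "((\<lambda>h. flat k h / h) \<longlongrightarrow> 0) (at 0)"
      by (rule Lim_transform_eventually[OF flat_tendsto_0[of "Suc k"]])
        (auto simp: flat_def eventually_at_filter)
    then show ?thesis
      using 3 by (simp add: has_field_derivative_iff flat_def)
  qed
qed

lemma isCont_flat: "isCont (flat k) s"
  using flat_has_derivative by (rule DERIV_isCont)

lemma continuous_on_flat [continuous_intros]:
  "continuous_on A f \<Longrightarrow> continuous_on A (\<lambda>x. flat k (f x))"
  by (rule continuous_on_compose2[of UNIV "flat k"])
    (auto intro: continuous_at_imp_continuous_on isCont_flat)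

section \<open>The radial bump and an algebra of smooth functions containing it\<close>

definition bump :: "real \<Rightarrow> 'b::euclidean_space \<Rightarrow> real" where
  "bump \<epsilon> y = flat 0 (1 - (y \<bullet> y) / \<epsilon>\<^sup>2)"

text \<open>The derivative of \<open>bump \<epsilon>\<close> at \<open>y\<close> in direction
  \<open>e\<close>. Only \<open>flat 2\<close> survives in the chain rule, since the second term in
  the derivative of \<open>flat k\<close> carries the factor \<open>k\<close>, here 0.\<close>

definition bump_deriv :: "real \<Rightarrow> 'b::euclidean_space \<Rightarrow> 'b \<Rightarrow> real" where
  "bump_deriv \<epsilon> e y = - (2 * (y \<bullet> e) / \<epsilon>\<^sup>2) * flat 2 (1 - (y \<bullet> y) / \<epsilon>\<^sup>2)"

text \<open>This algebra is closed under partial derivatives, so all its members are smooth.\<close>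

inductive_set bump_algebra :: "real \<Rightarrow> 'b::euclidean_space \<Rightarrow> ('b \<Rightarrow> real) set"
  for \<epsilon> c where
  const: "(\<lambda>z. a) \<in> bump_algebra \<epsilon> c"
| linear: "(\<lambda>z. z \<bullet> b) \<in> bump_algebra \<epsilon> c"
| flat: "(\<lambda>z. flat k (1 - ((z - c) \<bullet> (z - c)) / \<epsilon>\<^sup>2)) \<in> bump_algebra \<epsilon> c"
| add: "f \<in> bump_algebra \<epsilon> c \<Longrightarrow> g \<in> bump_algebra \<epsilon> c \<Longrightarrow> (\<lambda>z. f z + g z) \<in> bump_algebra \<epsilon> c"
| mult: "f \<in> bump_algebra \<epsilon> c \<Longrightarrow> g \<in> bump_algebra \<epsilon> c \<Longrightarrow> (\<lambda>z. f z * g z) \<in> bump_algebra \<epsilon> c"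

lemma flat_quadratic_has_derivative:
  fixes c :: "'b::euclidean_space"
  shows "((\<lambda>z. flat k (1 - ((z - c) \<bullet> (z - c)) / \<epsilon>\<^sup>2)) has_derivative
   (\<lambda>e. - (2 * ((z - c) \<bullet> e) / \<epsilon>\<^sup>2) * (flat (k + 2) (1 - ((z - c) \<bullet> (z - c)) / \<epsilon>\<^sup>2)
       - real k * flat (k + 1) (1 - ((z - c) \<bullet> (z - c)) / \<epsilon>\<^sup>2)))) (at z)"
proof -
  let ?q = "\<lambda>z. 1 - ((z - c) \<bullet> (z - c)) / \<epsilon>\<^sup>2"
  have q: "(?q has_derivative (\<lambda>e. - (2 * ((z - c) \<bullet> e) / \<epsilon>\<^sup>2))) (at z)"
    unfolding divide_inverse
    by (auto intro!: derivative_eq_intros simp: inner_commute)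
  have "(flat k has_derivative (*) (flat (k + 2) (?q z) - real k * flat (k + 1) (?q z))) (at (?q z))"
    using flat_has_derivative has_field_derivative_def by blast
  from has_derivative_compose[OF q this] show ?thesis
    by (simp add: mult.commute)
qed

text \<open>The inner derivative of the quadratic is affine in \<open>z\<close>; this is why
  constants and linear functions are generators next to the \<open>flat\<close> terms.\<close>

lemma bump_algebra_derivative:
  assumes "f \<in> bump_algebra \<epsilon> c"
  shows "\<exists>f'. (\<forall>z. (f has_derivative f' z) (at z)) \<and> (\<forall>e. (\<lambda>z. f' z e) \<in> bump_algebra \<epsilon> c)"
  using assms
proof induction
  case (const a)
  show ?case by (rule exI[of _ "\<lambda>z e. 0"]) (auto intro: bump_algebra.const)
next
  case (linear b)
  show ?case
    by (rule exI[of _ "\<lambda>z e. e \<bullet> b"])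
      (auto intro: bump_algebra.const derivative_eq_intros)
next
  case (flat k)
  let ?F = "\<lambda>k z. flat k (1 - ((z - c) \<bullet> (z - c)) / \<epsilon>\<^sup>2)"
  have "(\<lambda>z. - (2 * ((z - c) \<bullet> e) / \<epsilon>\<^sup>2) * (?F (k + 2) z - real k * ?F (k + 1) z))
      \<in> bump_algebra \<epsilon> c" for e
  proof -
    have "(\<lambda>z. (((-2 / \<epsilon>\<^sup>2) * (z \<bullet> e)) + 2 * (c \<bullet> e) / \<epsilon>\<^sup>2) * (?F (k + 2) z + (- real k) * ?F (k + 1) z))
      \<in> bump_algebra \<epsilon> c"
      by (intro bump_algebra.intros)
    moreover have "- (2 * ((z - c) \<bullet> e) / \<epsilon>\<^sup>2) = ((-2 / \<epsilon>\<^sup>2) * (z \<bullet> e)) + 2 * (c \<bullet> e) / \<epsilon>\<^sup>2" for z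
      by (simp add: inner_diff_left algebra_simps diff_divide_distrib)
    ultimately show ?thesis by simp
  qed
  then show ?case using flat_quadratic_has_derivative[of k c \<epsilon>]
    by (intro exI[of _ "\<lambda>z e. - (2 * ((z - c) \<bullet> e) / \<epsilon>\<^sup>2) * (?F (k + 2) z - real k * ?F (k + 1) z)"])
       blast
next
  case (add f g)
  then obtain f' g' where *: "\<forall>z. (f has_derivative f' z) (at z)" "\<forall>e. (\<lambda>z. f' z e) \<in> bump_algebra \<epsilon> c"
    "\<forall>z. (g has_derivative g' z) (at z)" "\<forall>e. (\<lambda>z. g' z e) \<in> bump_algebra \<epsilon> c" by blast
  show ?case
    by (rule exI[of _ "\<lambda>z e. f' z e + g' z e"])
      (use * in \<open>auto intro: bump_algebra.add has_derivative_add\<close>)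
next
  case (mult f g)
  then obtain f' g' where *: "\<forall>z. (f has_derivative f' z) (at z)" "\<forall>e. (\<lambda>z. f' z e) \<in> bump_algebra \<epsilon> c"
    "\<forall>z. (g has_derivative g' z) (at z)" "\<forall>e. (\<lambda>z. g' z e) \<in> bump_algebra \<epsilon> c" by blast
  show ?case
    by (rule exI[of _ "\<lambda>z e. f z * g' z e + f' z e * g z"])
      (use * mult.hyps in \<open>auto intro!: bump_algebra.add bump_algebra.mult has_derivative_mult\<close>)
qed

lemma bump_algebra_smooth:
  assumes "f \<in> bump_algebra \<epsilon> c"
  shows "smooth f"
proof -
  have "foldr partial_deriv es f \<in> bump_algebra \<epsilon> c" for es
  proof (induction es)
    case Nil
    then show ?case using assms by simp
  next
    case (Cons e es)
    then obtain f' where f': "\<forall>z. (foldr partial_deriv es f has_derivative f' z) (at z)"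
      "\<forall>e. (\<lambda>z. f' z e) \<in> bump_algebra \<epsilon> c"
      using bump_algebra_derivative by blast
    have "partial_deriv e (foldr partial_deriv es f) = (\<lambda>z. f' z e)"
      using frechet_derivative_at[OF f'(1)[rule_format]] by (simp add: partial_deriv_def fun_eq_iff)
    then show ?case using f'(2) by simp
  qed
  then show ?thesis
    unfolding smooth_def using bump_algebra_derivative differentiable_def by blast
qed

section \<open>Size, support and regularity of the bump\<close>

lemma bump_nonneg: "0 \<le> bump \<epsilon> y" and bump_le_1: "bump \<epsilon> y \<le> 1"
  using flat_le[of 0] by (auto simp: bump_def flat_nonneg)

lemma bump_minus: "bump \<epsilon> (- y) = bump \<epsilon> y"
  by (simp add: bump_def)

lemma bump_commute: "bump \<epsilon> (x - y) = bump \<epsilon> (y - x)"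
  using bump_minus[of \<epsilon> "y - x"] by simp

text \<open>The gradient of an even function is odd. This sign converts the derivative of a test
  function in the integration variable into the derivative of a mollification at its centre.\<close>

lemma bump_deriv_commute: "bump_deriv \<epsilon> e (x - y) = - bump_deriv \<epsilon> e (y - x)"
proof -
  have "(x - y) \<bullet> (x - y) = (y - x) \<bullet> (y - x)" by (simp add: inner_diff_left inner_diff_right algebra_simps)
  moreover have "(x - y) \<bullet> e = - ((y - x) \<bullet> e)" by (simp add: inner_diff_left)
  ultimately show ?thesis by (simp add: bump_deriv_def)
qed

lemma one_minus_inner_nonpos:
  assumes "\<epsilon> > 0" "norm y \<ge> \<epsilon>"
  shows "1 - (y \<bullet> y) / \<epsilon>\<^sup>2 \<le> 0"
proof -
  have "\<epsilon>\<^sup>2 \<le> (norm y)\<^sup>2" using assms by (intro power_mono) auto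
  then show ?thesis using assms by (simp add: power2_norm_eq_inner field_simps)
qed

lemma bump_eq_0: "\<epsilon> > 0 \<Longrightarrow> norm y \<ge> \<epsilon> \<Longrightarrow> bump \<epsilon> y = 0"
  using one_minus_inner_nonpos[of \<epsilon> y] by (simp add: bump_def flat_def)

lemma bump_deriv_eq_0: "\<epsilon> > 0 \<Longrightarrow> norm y \<ge> \<epsilon> \<Longrightarrow> bump_deriv \<epsilon> e y = 0"
  using one_minus_inner_nonpos[of \<epsilon> y] by (simp add: bump_deriv_def flat_def)

text \<open>On the support \<open>norm y < \<epsilon>\<close>, so the quadratic contributes at most
  2 / \<epsilon>, and \<open>flat 2\<close> is at most \<open>fact 2\<close>. The resulting 4 is the
  one in \<open>rate\<close>.\<close>

lemma bump_deriv_bound: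
  assumes "\<epsilon> > 0"
  shows "\<bar>bump_deriv \<epsilon> e y\<bar> \<le> 4 / \<epsilon> * norm e"
proof (cases "norm y \<ge> \<epsilon>")
  case True
  then show ?thesis using bump_deriv_eq_0[OF assms True] assms by simp
next
  case False
  have "\<bar>y \<bullet> e\<bar> \<le> \<epsilon> * norm e"
    using Cauchy_Schwarz_ineq2[of y e] False mult_right_mono[of "norm y" \<epsilon> "norm e"] by force
  then have a: "\<bar>2 * (y \<bullet> e) / \<epsilon>\<^sup>2\<bar> \<le> 2 * norm e / \<epsilon>"
    using assms by (simp add: abs_mult power2_eq_square field_simps)
  have b: "\<bar>flat 2 (1 - (y \<bullet> y) / \<epsilon>\<^sup>2)\<bar> \<le> 2"
    using flat_le[of 2 "1 - (y \<bullet> y) / \<epsilon>\<^sup>2"] flat_nonneg[of 2 "1 - (y \<bullet> y) / \<epsilon>\<^sup>2"]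
    by (simp add: fact_numeral)
  have "\<bar>bump_deriv \<epsilon> e y\<bar> = \<bar>2 * (y \<bullet> e) / \<epsilon>\<^sup>2\<bar> * \<bar>flat 2 (1 - (y \<bullet> y) / \<epsilon>\<^sup>2)\<bar>"
    by (simp add: bump_deriv_def abs_mult)
  also have "\<dots> \<le> (2 * norm e / \<epsilon>) * 2"
    by (rule mult_mono[OF a b]) (use assms in auto)
  finally show ?thesis by simp
qed

lemma bump_deriv_sum:
  "bump_deriv \<epsilon> (\<Sum>i\<in>I. c i *\<^sub>R e i) y = (\<Sum>i\<in>I. c i * bump_deriv \<epsilon> (e i) y)"
  by (simp add: bump_deriv_def inner_sum_right sum_distrib_left sum_distrib_right sum_divide_distrib sum_negf mult_ac)

lemma bump_continuous_on [continuous_intros]: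
  "continuous_on A f \<Longrightarrow> continuous_on A (\<lambda>x. bump \<epsilon> (f x))"
  unfolding bump_def divide_inverse by (intro continuous_intros)

lemma bump_deriv_continuous_on [continuous_intros]:
  "continuous_on A f \<Longrightarrow> continuous_on A (\<lambda>x. bump_deriv \<epsilon> e (f x))"
  unfolding bump_deriv_def divide_inverse by (intro continuous_intros)

lemma bump_measurable [measurable]: "bump \<epsilon> \<in> borel_measurable borel"
  by (intro borel_measurable_continuous_onI continuous_intros)

lemma bump_deriv_measurable [measurable]: "bump_deriv \<epsilon> e \<in> borel_measurable borel"
  by (intro borel_measurable_continuous_onI continuous_intros)

lemma bump_has_derivative: "(bump \<epsilon> has_derivative (\<lambda>e. bump_deriv \<epsilon> e y)) (at y)"
  using flat_quadratic_has_derivative[of 0 0 \<epsilon> y]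
  unfolding bump_def bump_deriv_def by (simp add: numeral_2_eq_2)

lemma bump_line_derivative:
  "((\<lambda>s. bump \<epsilon> (y + s *\<^sub>R e)) has_real_derivative bump_deriv \<epsilon> e (y + s *\<^sub>R e)) (at s)"
proof -
  have "((\<lambda>s. y + s *\<^sub>R e) has_derivative (\<lambda>h. h *\<^sub>R e)) (at s)"
    by (auto intro!: derivative_eq_intros)
  from has_derivative_compose[OF this bump_has_derivative]
  have "((\<lambda>s. bump \<epsilon> (y + s *\<^sub>R e)) has_derivative (\<lambda>h. bump_deriv \<epsilon> (h *\<^sub>R e) (y + s *\<^sub>R e))) (at s)" .
  then show ?thesis
    by (rule has_derivative_imp_has_field_derivative) (simp add: bump_deriv_def)
qed

lemma bump_lipschitz:
  assumes "\<epsilon> > 0"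
  shows "\<bar>bump \<epsilon> (y + h *\<^sub>R e) - bump \<epsilon> y\<bar> \<le> 4 / \<epsilon> * norm e * \<bar>h\<bar>"
proof -
  have "norm (bump \<epsilon> (y + h *\<^sub>R e) - bump \<epsilon> (y + 0 *\<^sub>R e)) \<le> 4 / \<epsilon> * norm e * norm (h - 0)"
    by (rule field_differentiable_bound[of UNIV "\<lambda>s. bump \<epsilon> (y + s *\<^sub>R e)" "\<lambda>s. bump_deriv \<epsilon> e (y + s *\<^sub>R e)"])
      (use bump_line_derivative[of \<epsilon> y e] bump_deriv_bound[OF assms] in auto)
  then show ?thesis by simp
qed

lemma partial_deriv_bump: "partial_deriv e (\<lambda>z. bump \<epsilon> (z - c)) z = bump_deriv \<epsilon> e (z - c)"
proof -
  have "((\<lambda>z. z - c) has_derivative (\<lambda>h. h)) (at z)"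
    by (auto intro!: derivative_eq_intros)
  from has_derivative_compose[OF this bump_has_derivative]
  have "((\<lambda>z. bump \<epsilon> (z - c)) has_derivative (\<lambda>e. bump_deriv \<epsilon> e (z - c))) (at z)" .
  from frechet_derivative_at[OF this, symmetric] show ?thesis
    by (simp add: partial_deriv_def)
qed

lemma bump_in_Cc_inf:
  assumes "\<epsilon> > 0" "cball c \<epsilon> \<subseteq> U"
  shows "(\<lambda>z. bump \<epsilon> (z - c)) \<in> Cc_inf U"
proof -
  have "(\<lambda>z. bump \<epsilon> (z - c)) \<in> bump_algebra \<epsilon> c"
    unfolding bump_def by (rule bump_algebra.flat)
  then have "smooth (\<lambda>z. bump \<epsilon> (z - c))" by (rule bump_algebra_smooth)
  moreover have "{z. bump \<epsilon> (z - c) \<noteq> 0} \<subseteq> cball c \<epsilon>"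
  proof
    fix z assume "z \<in> {z. bump \<epsilon> (z - c) \<noteq> 0}"
    then have "\<not> norm (z - c) \<ge> \<epsilon>" using bump_eq_0[OF assms(1), of "z - c"] by auto
    then show "z \<in> cball c \<epsilon>" by (simp add: dist_norm norm_minus_commute)
  qed
  then have cl: "closure {z. bump \<epsilon> (z - c) \<noteq> 0} \<subseteq> cball c \<epsilon>"
    by (rule closure_minimal) simp
  moreover have "bounded (closure {z. bump \<epsilon> (z - c) \<noteq> 0})"
    using cl bounded_cball bounded_subset by blast
  ultimately show ?thesis
    using assms(2) by (auto simp: Cc_inf_def compact_eq_bounded_closed)
qed

subsection \<open>Mean oscillation of integrable functions\<close>

lemma integrable_lborel_bounded_support:
  fixes f :: "'b::euclidean_space \<Rightarrow> real"
  assumes [measurable]: "f \<in> borel_measurable borel"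
    and "\<And>z. \<bar>f z\<bar> \<le> C" and "\<And>z. norm z > R \<Longrightarrow> f z = 0"
  shows "integrable lborel f"
proof (rule Bochner_Integration.integrable_bound[of lborel "\<lambda>z. C * indicator (cball 0 R) z"])
  have "emeasure lborel (cball (0::'b) R) < \<infinity>" by (rule emeasure_bounded_finite) simp
  then show "integrable lborel (\<lambda>z. C * indicator (cball (0::'b) R) z)" by simp
  show "AE z in lborel. norm (f z) \<le> norm (C * indicator (cball 0 R) z)"
  proof (rule AE_I2)
    fix z
    show "norm (f z) \<le> norm (C * indicator (cball 0 R) z)"
      using assms(2)[of z] assms(3)[of z] by (cases "norm z \<le> R") (auto simp: indicator_def)
  qed
qed simp

text \<open>Density of compactly supported continuous functions. Truncating \<open>f\<close> in
  space and in value first gives a bounded \<open>F m\<close>; continuous functions converging to it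
  almost everywhere, truncated alike, then have a common dominating function.\<close>

lemma L1_approx_continuous:
  fixes f :: "'b::euclidean_space \<Rightarrow> real"
  assumes int: "integrable lborel f" and "e > 0"
  obtains g R where "continuous_on UNIV g" "\<And>z. norm z > R \<Longrightarrow> g z = 0"
    "integrable lborel g" "(\<integral>z. \<bar>f z - g z\<bar> \<partial>lborel) < e"
proof -
  have [measurable]: "f \<in> borel_measurable borel" using int by auto
  define F where "F m z = indicator (cball 0 (real m)) z * max (- real m) (min (real m) (f z))" for m z
  have Fm [measurable]: "F m \<in> borel_measurable borel" for m unfolding F_def
    by (intro borel_measurable_times borel_measurable_indicator borel_measurable_max borel_measurable_min) auto
  have Fint: "integrable lborel (F m)" for m
    by (rule integrable_lborel_bounded_support[of _ "real m" "real m"])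
       (auto simp: F_def indicator_def)
  have "(\<lambda>m. \<integral>z. \<bar>f z - F m z\<bar> \<partial>lborel) \<longlonglongrightarrow> (\<integral>z. 0 \<partial>(lborel :: 'b measure))"
  proof (rule integral_dominated_convergence[where w="\<lambda>z. \<bar>f z\<bar>"])
    show "AE z in lborel. (\<lambda>m. \<bar>f z - F m z\<bar>) \<longlonglongrightarrow> 0"
    proof (rule AE_I2, rule tendsto_eventually)
      fix z
      obtain k where k: "real k \<ge> max (norm z) \<bar>f z\<bar>" using real_arch_simple by blast
      show "\<forall>\<^sub>F m in sequentially. \<bar>f z - F m z\<bar> = 0"
        unfolding eventually_sequentially
      proof (intro exI[of _ k] allI impI)
        fix m assume "k \<le> m"
        then have "real k \<le> real m" by simp
        then show "\<bar>f z - F m z\<bar> = 0" using k by (auto simp: F_def indicator_def)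
      qed
    qed
    show "AE z in lborel. norm \<bar>f z - F m z\<bar> \<le> \<bar>f z\<bar>" for m
      by (rule AE_I2) (auto simp: F_def indicator_def)
  qed (use int in auto)
  then have "\<forall>\<^sub>F m in sequentially. (\<integral>z. \<bar>f z - F m z\<bar> \<partial>lborel) < e / 2"
    using assms(2) by (intro order_tendstoD(2)) auto
  then obtain m where m: "(\<integral>z. \<bar>f z - F m z\<bar> \<partial>lborel) < e / 2"
    by (auto simp: eventually_sequentially)
  have "F m \<in> borel_measurable lebesgue"
    using Fm[of m] by (simp add: measurable_completion)
  then have "F m measurable_on UNIV"
    by (simp add: lebesgue_measurable_imp_measurable_on)
  then obtain N g where N: "negligible N" and g: "\<And>n. continuous_on UNIV (g n)"
    and lim: "\<And>x. x \<notin> N \<Longrightarrow> (\<lambda>n. g n x) \<longlonglongrightarrow> F m x"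
    by (auto simp: measurable_on_def)
  \<comment> \<open>The tent factor is 1 on the ball carrying \<open>F m\<close> and 0 beyond radius
    m + 1, and \<open>F m\<close> already takes values in [-m, m]; so the truncation leaves the
    limit unchanged.\<close>
  define G where "G n z = max 0 (min 1 (real m + 1 - norm z)) * max (- real m) (min (real m) (g n z))" for n z
  have Gc: "continuous_on UNIV (G n)" for n
    unfolding G_def by (intro continuous_intros g)
  then have Gm [measurable]: "G n \<in> borel_measurable borel" for n
    by (rule borel_measurable_continuous_onI)
  have Gb: "\<bar>G n z\<bar> \<le> real m" for n z
  proof -
    have "\<bar>G n z\<bar> = \<bar>max 0 (min 1 (real m + 1 - norm z))\<bar> * \<bar>max (- real m) (min (real m) (g n z))\<bar>"
      by (simp add: G_def abs_mult)
    also have "\<dots> \<le> 1 * real m" by (rule mult_mono) auto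
    finally show ?thesis by simp
  qed
  have G0: "norm z > real m + 1 \<Longrightarrow> G n z = 0" for n z by (simp add: G_def)
  have Gint: "integrable lborel (G n)" for n
    by (rule integrable_lborel_bounded_support[of _ "real m" "real m + 1"]) (use Gb G0 in auto)
  have Fb: "\<bar>F m z\<bar> \<le> real m" for z by (auto simp: F_def indicator_def)
  have "(\<lambda>n. \<integral>z. \<bar>F m z - G n z\<bar> \<partial>lborel) \<longlonglongrightarrow> (\<integral>z. 0 \<partial>(lborel :: 'b measure))"
  proof (rule integral_dominated_convergence[where w="\<lambda>z. 2 * real m * indicator (cball 0 (real m + 1)) z"])
    have "AE z in lebesgue. z \<notin> N"
      using N by (simp add: AE_not_in negligible_iff_null_sets)
    then have "AE z in lborel. z \<notin> N" by (simp add: AE_completion_iff)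
    then show "AE z in lborel. (\<lambda>n. \<bar>F m z - G n z\<bar>) \<longlonglongrightarrow> 0"
    proof (rule AE_mp, intro AE_I2 impI)
      fix z assume "z \<notin> N"
      then have "(\<lambda>n. G n z) \<longlonglongrightarrow> max 0 (min 1 (real m + 1 - norm z)) * max (- real m) (min (real m) (F m z))"
        unfolding G_def by (intro tendsto_intros lim)
      moreover have "max 0 (min 1 (real m + 1 - norm z)) * max (- real m) (min (real m) (F m z)) = F m z"
        by (cases "norm z \<le> real m") (auto simp: F_def indicator_def)
      ultimately have "(\<lambda>n. G n z) \<longlonglongrightarrow> F m z" by simp
      then have "(\<lambda>n. \<bar>F m z - G n z\<bar>) \<longlonglongrightarrow> \<bar>F m z - F m z\<bar>" by (intro tendsto_intros)
      then show "(\<lambda>n. \<bar>F m z - G n z\<bar>) \<longlonglongrightarrow> 0" by simp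
    qed
    have "emeasure lborel (cball (0::'b) (real m + 1)) < \<infinity>" by (rule emeasure_bounded_finite) simp
    then show "integrable lborel (\<lambda>z. 2 * real m * indicator (cball (0::'b) (real m + 1)) z)"
      by simp
    show "AE z in lborel. norm \<bar>F m z - G n z\<bar> \<le> 2 * real m * indicator (cball 0 (real m + 1)) z" for n
    proof (rule AE_I2)
      fix z
      show "norm \<bar>F m z - G n z\<bar> \<le> 2 * real m * indicator (cball 0 (real m + 1)) z"
        using Fb[of z] Gb[of n z] G0[of z n]
        by (cases "norm z \<le> real m + 1") (auto simp: F_def)
    qed
  qed auto
  then have "\<forall>\<^sub>F n in sequentially. (\<integral>z. \<bar>F m z - G n z\<bar> \<partial>lborel) < e / 2"
    using assms(2) by (intro order_tendstoD(2)) auto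
  then obtain n where n: "(\<integral>z. \<bar>F m z - G n z\<bar> \<partial>lborel) < e / 2"
    by (auto simp: eventually_sequentially)
  have "(\<integral>z. \<bar>f z - G n z\<bar> \<partial>lborel) \<le> (\<integral>z. \<bar>f z - F m z\<bar> + \<bar>F m z - G n z\<bar> \<partial>lborel)"
    using int Fint Gint by (intro integral_mono) auto
  also have "\<dots> < e"
    using m n int Fint[of m] Gint[of n] by (subst Bochner_Integration.integral_add) auto
  finally show thesis
    using that[OF Gc G0 Gint] by blast
qed

text \<open>Centred at the value \<open>f z\<close> and not at the average over the ball, so that it
  bounds the mollification error at \<open>z\<close> directly. The division by a volume is left to
  each use.\<close>

definition oscillation :: "real \<Rightarrow> ('b::euclidean_space \<Rightarrow> real) \<Rightarrow> 'b \<Rightarrow> real" where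
  "oscillation \<epsilon> f z = (\<integral>z'. indicator (ball z \<epsilon>) z' * \<bar>f z' - f z\<bar> \<partial>lborel)"

lemma integrable_indicator_ball_mult:
  fixes f :: "'b::euclidean_space \<Rightarrow> real"
  assumes "integrable lborel f"
  shows "integrable lborel (\<lambda>z'. indicator (ball z \<epsilon>) z' * \<bar>f z'\<bar>)"
    and "integrable lborel (\<lambda>z'. indicator (ball z \<epsilon>) z' * \<bar>f z' - c\<bar>)"
    and "integrable lborel (\<lambda>z'. indicator (ball z \<epsilon>) z' * c)"
proof -
  have "emeasure lborel (ball z \<epsilon>) < \<infinity>" by (rule emeasure_bounded_finite) simp
  then have c: "integrable lborel (\<lambda>z'. indicator (ball z \<epsilon>) z' * c)" for c :: real by simp
  show "integrable lborel (\<lambda>z'. indicator (ball z \<epsilon>) z' * c)" by (rule c)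
  show f: "integrable lborel (\<lambda>z'. indicator (ball z \<epsilon>) z' * \<bar>f z'\<bar>)"
    using integrable_real_mult_indicator[OF _ integrable_abs[OF assms], of "ball z \<epsilon>"]
    by (simp add: mult.commute)
  show "integrable lborel (\<lambda>z'. indicator (ball z \<epsilon>) z' * \<bar>f z' - c\<bar>)"
    by (rule Bochner_Integration.integrable_bound[OF Bochner_Integration.integrable_add[OF f c[of "\<bar>c\<bar>"]]])
      (use assms in \<open>auto simp: indicator_def\<close>)
qed

text \<open>Each term of \<open>\<bar>f z'\<bar> + \<bar>f z\<bar>\<close> contributes one ball
  volume times the norm, by Tonelli and the symmetry of \<open>dist z z' < \<epsilon>\<close>.
  Nonnegative integrals come first because finiteness here is what makes the oscillation
  integrable.\<close>

lemma nn_integral_oscillation_le: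
  fixes f :: "'b::euclidean_space \<Rightarrow> real"
  assumes f: "integrable lborel f"
  shows "(\<integral>\<^sup>+z. \<integral>\<^sup>+z'. indicator (ball z \<epsilon>) z' * ennreal \<bar>f z' - f z\<bar> \<partial>lborel \<partial>lborel)
    \<le> 2 * emeasure lborel (ball (0::'b) \<epsilon>) * ennreal (\<integral>z. \<bar>f z\<bar> \<partial>lborel)"
proof -
  have [measurable]: "f \<in> borel_measurable borel" using f by auto
  have sets: "{p \<in> space (borel \<Otimes>\<^sub>M borel). snd p \<in> ball (fst p :: 'b) \<epsilon>} \<in> sets (borel \<Otimes>\<^sub>M borel)"
    unfolding mem_ball by measurable
  have ind [measurable]: "(\<lambda>p::'b\<times>'b. indicator (ball (fst p) \<epsilon>) (snd p) :: ennreal) \<in> borel_measurable (borel \<Otimes>\<^sub>M borel)"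
    using borel_measurable_indicator'[OF sets] .
  have indz [measurable]: "(indicator (ball x \<epsilon>) :: 'b \<Rightarrow> ennreal) \<in> borel_measurable borel" for x
    by (rule borel_measurable_indicator) simp
  define V0 where "V0 = emeasure lborel (ball (0::'b) \<epsilon>)"
  let ?I = "ennreal (\<integral>z. \<bar>f z\<bar> \<partial>lborel)"
  have V: "emeasure lborel (ball z \<epsilon>) = V0" for z :: 'b
  proof -
    have "measure lborel (ball z \<epsilon>) = measure lborel (ball (0::'b) \<epsilon>)"
      using content_ball_conv_unit_ball[of \<epsilon> z] content_ball_conv_unit_ball[of \<epsilon> "0::'b"]
      by (cases "\<epsilon> \<ge> 0") (auto simp: ball_empty)
    moreover have "emeasure lborel (ball z \<epsilon>) = ennreal (measure lborel (ball z \<epsilon>))" for z :: 'b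
      using emeasure_bounded_finite[OF bounded_ball, of z \<epsilon>] by (intro emeasure_eq_ennreal_measure) auto
    ultimately show ?thesis by (simp add: V0_def)
  qed
  have I: "(\<integral>\<^sup>+z. ennreal \<bar>f z\<bar> \<partial>lborel) = ?I"
    using f by (intro nn_integral_eq_integral) auto
  have "(\<integral>\<^sup>+z. \<integral>\<^sup>+z'. indicator (ball z \<epsilon>) z' * ennreal \<bar>f z' - f z\<bar> \<partial>lborel \<partial>lborel)
    \<le> (\<integral>\<^sup>+z. \<integral>\<^sup>+z'. (indicator (ball z \<epsilon>) z' * ennreal \<bar>f z'\<bar> + indicator (ball z \<epsilon>) z' * ennreal \<bar>f z\<bar>) \<partial>lborel \<partial>lborel)"
    by (intro nn_integral_mono) (auto simp: indicator_def ennreal_plus[symmetric] intro!: ennreal_leI simp del: ennreal_plus)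
  also have "\<dots> = (\<integral>\<^sup>+z. ((\<integral>\<^sup>+z'. indicator (ball z \<epsilon>) z' * ennreal \<bar>f z'\<bar> \<partial>lborel) + V0 * ennreal \<bar>f z\<bar>) \<partial>lborel)"
    by (intro nn_integral_cong) (subst nn_integral_add, auto simp: nn_integral_multc V)
  also have "\<dots> = (\<integral>\<^sup>+z. (\<integral>\<^sup>+z'. indicator (ball z \<epsilon>) z' * ennreal \<bar>f z'\<bar> \<partial>lborel) \<partial>lborel) + V0 * ?I"
    by (subst nn_integral_add) (auto simp: nn_integral_cmult I)
  also have "(\<integral>\<^sup>+z. (\<integral>\<^sup>+z'. indicator (ball z \<epsilon>) z' * ennreal \<bar>f z'\<bar> \<partial>lborel) \<partial>lborel)
     = (\<integral>\<^sup>+z'. (\<integral>\<^sup>+z. indicator (ball z \<epsilon>) z' * ennreal \<bar>f z'\<bar> \<partial>lborel) \<partial>lborel)"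
    by (rule lborel_pair.Fubini'[symmetric]) simp
  also have "\<dots> = (\<integral>\<^sup>+z'. (\<integral>\<^sup>+z. indicator (ball z' \<epsilon>) z * ennreal \<bar>f z'\<bar> \<partial>lborel) \<partial>lborel)"
    by (intro nn_integral_cong) (auto simp: indicator_def dist_commute)
  also have "\<dots> = V0 * ?I"
    by (simp add: nn_integral_multc V nn_integral_cmult I)
  finally show ?thesis by (simp add: mult_2 distrib_right V0_def)
qed

lemma oscillation_integrable:
  fixes f :: "'b::euclidean_space \<Rightarrow> real"
  assumes f: "integrable lborel f"
  shows "integrable lborel (oscillation \<epsilon> f)"
    and "ennreal (\<integral>z. oscillation \<epsilon> f z \<partial>lborel)
      = (\<integral>\<^sup>+z. \<integral>\<^sup>+z'. indicator (ball z \<epsilon>) z' * ennreal \<bar>f z' - f z\<bar> \<partial>lborel \<partial>lborel)"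
proof -
  have [measurable]: "f \<in> borel_measurable borel" using f by auto
  have sets: "{p \<in> space (borel \<Otimes>\<^sub>M borel). snd p \<in> ball (fst p :: 'b) \<epsilon>} \<in> sets (borel \<Otimes>\<^sub>M borel)"
    unfolding mem_ball by measurable
  have ind [measurable]: "(\<lambda>p::'b\<times>'b. indicator (ball (fst p) \<epsilon>) (snd p) :: real) \<in> borel_measurable (borel \<Otimes>\<^sub>M borel)"
    using borel_measurable_indicator'[OF sets] .
  have m: "oscillation \<epsilon> f \<in> borel_measurable lborel"
    unfolding oscillation_def[abs_def] by (rule lborel.borel_measurable_lebesgue_integral) simp
  have nn: "0 \<le> oscillation \<epsilon> f z" for z
    unfolding oscillation_def by (rule integral_nonneg_AE) auto
  have "ennreal (oscillation \<epsilon> f z) = (\<integral>\<^sup>+z'. indicator (ball z \<epsilon>) z' * ennreal \<bar>f z' - f z\<bar> \<partial>lborel)" for z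
  proof -
    have "ennreal (oscillation \<epsilon> f z) = (\<integral>\<^sup>+z'. ennreal (indicator (ball z \<epsilon>) z' * \<bar>f z' - f z\<bar>) \<partial>lborel)"
      unfolding oscillation_def
      by (rule nn_integral_eq_integral[symmetric]) (auto simp: integrable_indicator_ball_mult[OF f])
    also have "\<dots> = (\<integral>\<^sup>+z'. indicator (ball z \<epsilon>) z' * ennreal \<bar>f z' - f z\<bar> \<partial>lborel)"
      by (intro nn_integral_cong) (auto simp: indicator_def)
    finally show ?thesis .
  qed
  then have eq: "(\<integral>\<^sup>+z. ennreal (oscillation \<epsilon> f z) \<partial>lborel)
    = (\<integral>\<^sup>+z. \<integral>\<^sup>+z'. indicator (ball z \<epsilon>) z' * ennreal \<bar>f z' - f z\<bar> \<partial>lborel \<partial>lborel)" by simp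
  have "2 * emeasure lborel (ball (0::'b) \<epsilon>) * ennreal (\<integral>z. \<bar>f z\<bar> \<partial>lborel) < \<infinity>"
    using emeasure_bounded_finite[OF bounded_ball, of "0::'b" \<epsilon>] by (simp add: ennreal_mult_less_top)
  with nn_integral_oscillation_le[OF f, of \<epsilon>] have "(\<integral>\<^sup>+z. ennreal (oscillation \<epsilon> f z) \<partial>lborel) < \<infinity>"
    unfolding eq by (rule le_less_trans)
  then show i: "integrable lborel (oscillation \<epsilon> f)"
    using m nn by (intro integrableI_nonneg) auto
  show "ennreal (\<integral>z. oscillation \<epsilon> f z \<partial>lborel)
      = (\<integral>\<^sup>+z. \<integral>\<^sup>+z'. indicator (ball z \<epsilon>) z' * ennreal \<bar>f z' - f z\<bar> \<partial>lborel \<partial>lborel)"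
    using nn by (subst eq[symmetric], subst nn_integral_eq_integral[OF i]) auto
qed

lemma integral_oscillation_le:
  fixes f :: "'b::euclidean_space \<Rightarrow> real"
  assumes f: "integrable lborel f"
  shows "(\<integral>z. oscillation \<epsilon> f z \<partial>lborel) \<le> 2 * measure lborel (ball (0::'b) \<epsilon>) * (\<integral>z. \<bar>f z\<bar> \<partial>lborel)"
proof -
  have "ennreal (\<integral>z. oscillation \<epsilon> f z \<partial>lborel) \<le> 2 * emeasure lborel (ball (0::'b) \<epsilon>) * ennreal (\<integral>z. \<bar>f z\<bar> \<partial>lborel)"
    unfolding oscillation_integrable(2)[OF f] by (rule nn_integral_oscillation_le[OF f])
  also have "\<dots> = ennreal (2 * measure lborel (ball (0::'b) \<epsilon>) * (\<integral>z. \<bar>f z\<bar> \<partial>lborel))"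
  proof -
    have "emeasure lborel (ball (0::'b) \<epsilon>) = ennreal (measure lborel (ball (0::'b) \<epsilon>))"
      using emeasure_bounded_finite[OF bounded_ball, of "0::'b" \<epsilon>] by (intro emeasure_eq_ennreal_measure) auto
    then show ?thesis by (simp add: ennreal_mult)
  qed
  finally show ?thesis by (subst (asm) ennreal_le_iff) auto
qed

lemma oscillation_triangle:
  fixes f g :: "'b::euclidean_space \<Rightarrow> real"
  assumes f: "integrable lborel f" and g: "integrable lborel g"
  shows "oscillation \<epsilon> f z \<le> oscillation \<epsilon> g z + oscillation \<epsilon> (\<lambda>z. f z - g z) z"
proof -
  have "oscillation \<epsilon> f z \<le> (\<integral>z'. indicator (ball z \<epsilon>) z' * \<bar>g z' - g z\<bar>
      + indicator (ball z \<epsilon>) z' * \<bar>(f z' - g z') - (f z - g z)\<bar> \<partial>lborel)"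
    unfolding oscillation_def
    using f g by (intro integral_mono Bochner_Integration.integrable_add integrable_indicator_ball_mult)
      (auto simp: indicator_def)
  also have "\<dots> = oscillation \<epsilon> g z + oscillation \<epsilon> (\<lambda>z. f z - g z) z"
    unfolding oscillation_def
    using f g by (intro Bochner_Integration.integral_add integrable_indicator_ball_mult) auto
  finally show ?thesis .
qed

text \<open>The oscillation is small relative to the volume of the ball, that is, after
  normalisation. Half of \<open>e\<close> comes from the uniform continuity of a compactly supported
  approximation \<open>g\<close>, half from the norm bound applied to the remainder.\<close>

lemma oscillation_small:
  fixes f :: "'b::euclidean_space \<Rightarrow> real"
  assumes f: "integrable lborel f" and "e > 0"
  obtains \<epsilon>0 where "\<epsilon>0 > 0"
    "\<And>\<epsilon>. 0 < \<epsilon> \<Longrightarrow> \<epsilon> < \<epsilon>0 \<Longrightarrow> (\<integral>z. oscillation \<epsilon> f z \<partial>lborel) \<le> e * measure lborel (ball (0::'b) \<epsilon>)"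
proof -
  obtain g R where g: "continuous_on UNIV g" "\<And>z. norm z > R \<Longrightarrow> g z = 0"
    and gi: "integrable lborel g" and fg: "(\<integral>z. \<bar>f z - g z\<bar> \<partial>lborel) < e / 4"
    using L1_approx_continuous[OF f, of "e / 4"] assms(2) by (metis divide_pos_pos zero_less_numeral)
  define R' where "R' = max R 0"
  let ?K = "cball (0::'b) (R' + 2)"
  define A where "A = measure lborel ?K + 1"
  have A: "A > 0" by (simp add: A_def add_nonneg_pos)
  have "uniformly_continuous_on ?K g"
    by (intro compact_uniformly_continuous continuous_on_subset[OF g(1)]) auto
  then obtain d where d: "d > 0" "\<And>x y. x \<in> ?K \<Longrightarrow> y \<in> ?K \<Longrightarrow> dist y x < d \<Longrightarrow> dist (g y) (g x) < e / (2 * A)"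
    unfolding uniformly_continuous_on_def using assms(2) A
    by (elim allE[of _ "e / (2 * A)"]) auto
  show thesis
  proof (rule that)
    show "min d 1 > 0" using d by simp
    fix \<epsilon> :: real assume \<epsilon>: "0 < \<epsilon>" "\<epsilon> < min d 1"
    let ?V = "measure lborel (ball (0::'b) \<epsilon>)"
    have V: "measure lborel (ball z \<epsilon>) = ?V" for z :: 'b
      using \<epsilon> content_ball_conv_unit_ball[of \<epsilon> z] content_ball_conv_unit_ball[of \<epsilon> "0::'b"] by simp
    have osc: "oscillation \<epsilon> g z \<le> indicator ?K z * (e / (2 * A) * ?V)" for z
    proof -
      have pt: "indicator (ball z \<epsilon>) z' * \<bar>g z' - g z\<bar> \<le> indicator (ball z \<epsilon>) z' * (indicator ?K z * (e / (2 * A)))" for z'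
      proof (cases "dist z z' < \<epsilon>")
        case True
        have nz: "norm z' \<le> norm z + 1" "norm z \<le> norm z' + 1"
          using True \<epsilon> norm_triangle_ineq2[of z' z] norm_triangle_ineq2[of z z']
          by (auto simp: dist_norm norm_minus_commute)
        show ?thesis
        proof (cases "norm z \<le> R' + 1")
          case 1: True
          have "dist (g z') (g z) < e / (2 * A)"
            using True \<epsilon> nz 1 by (intro d(2)) (auto simp: dist_commute)
          then show ?thesis using 1 True by (simp add: dist_real_def)
        next
          case False
          then have "norm z > R" "norm z' > R" using nz by (auto simp: R'_def)
          then show ?thesis using g(2) A assms(2) by (simp add: indicator_def)
        qed
      next
        case False
        then show ?thesis by (simp add: indicator_def)
      qed
      have "oscillation \<epsilon> g z \<le> (\<integral>z'. indicator (ball z \<epsilon>) z' * (indicator ?K z * (e / (2 * A))) \<partial>lborel)"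
        unfolding oscillation_def
        by (intro integral_mono integrable_indicator_ball_mult(2,3)[OF gi] pt)
      also have "\<dots> = indicator ?K z * (e / (2 * A) * ?V)"
        using V[of z] by simp
      finally show ?thesis .
    qed
    have ff: "integrable lborel (\<lambda>z. f z - g z)" using f gi by simp
    have "emeasure lborel ?K < \<infinity>" by (rule emeasure_bounded_finite) simp
    then have Ki: "integrable lborel (\<lambda>z. indicator ?K z * (e / (2 * A) * ?V))" by simp
    have "(\<integral>z. oscillation \<epsilon> f z \<partial>lborel) \<le>
        (\<integral>z. indicator ?K z * (e / (2 * A) * ?V) + oscillation \<epsilon> (\<lambda>z. f z - g z) z \<partial>lborel)"
    proof (intro integral_mono Bochner_Integration.integrable_add oscillation_integrable f ff Ki)
      show "oscillation \<epsilon> f z \<le> indicator ?K z * (e / (2 * A) * ?V) + oscillation \<epsilon> (\<lambda>z. f z - g z) z" for z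
        using oscillation_triangle[OF f gi, of \<epsilon> z] osc[of z] by linarith
    qed
    also have "\<dots> = (\<integral>z. indicator ?K z * (e / (2 * A) * ?V) \<partial>lborel) + (\<integral>z. oscillation \<epsilon> (\<lambda>z. f z - g z) z \<partial>lborel)"
      by (intro Bochner_Integration.integral_add oscillation_integrable ff Ki)
    also have "\<dots> \<le> e / 2 * ?V + 2 * ?V * (e / 4)"
    proof (rule add_mono)
      have "(\<integral>z. indicator ?K z * (e / (2 * A) * ?V) \<partial>lborel) = (measure lborel ?K / A) * (e / 2 * ?V)"
        by simp
      also have "\<dots> \<le> 1 * (e / 2 * ?V)"
        using A assms(2) by (intro mult_right_mono) (auto simp: A_def)
      finally show "(\<integral>z. indicator ?K z * (e / (2 * A) * ?V) \<partial>lborel) \<le> e / 2 * ?V" by simp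
      show "(\<integral>z. oscillation \<epsilon> (\<lambda>z. f z - g z) z \<partial>lborel) \<le> 2 * ?V * (e / 4)"
        using fg by (intro order_trans[OF integral_oscillation_le[OF ff]] mult_left_mono) auto
    qed
    also have "\<dots> = e * ?V" by simp
    finally show "(\<integral>z. oscillation \<epsilon> f z \<partial>lborel) \<le> e * ?V" .
  qed
qed

subsection \<open>Mollification\<close>

lemma lborel_integral_translate:
  fixes f :: "'b::euclidean_space \<Rightarrow> real"
  assumes [measurable]: "f \<in> borel_measurable borel"
  shows "(\<integral>z. f (c + z) \<partial>lborel) = (\<integral>z. f z \<partial>lborel)"
proof -
  have "(\<integral>z. f z \<partial>lborel) = (\<integral>z. f z \<partial>distr lborel borel ((+) c))"
    by (simp add: lborel_distr_plus)
  also have "\<dots> = (\<integral>z. f (c + z) \<partial>lborel)"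
    by (rule integral_distr) auto
  finally show ?thesis by simp
qed

text \<open>The type argument carries the dimension. The bump stays unnormalised, with values in
  [0, 1], and is divided by its mass at each use.\<close>

definition bump_mass :: "'b::euclidean_space itself \<Rightarrow> real \<Rightarrow> real" where
  "bump_mass _ \<epsilon> = (\<integral>y. bump \<epsilon> (y::'b) \<partial>lborel)"

lemma bump_integrable:
  fixes z :: "'b::euclidean_space"
  assumes "\<epsilon> > 0"
  shows "integrable lborel (\<lambda>z'. bump \<epsilon> (z - z'))"
proof (rule integrable_lborel_bounded_support[of _ 1 "norm z + \<epsilon>"])
  show "\<bar>bump \<epsilon> (z - z')\<bar> \<le> 1" for z' using bump_nonneg bump_le_1 by (metis abs_of_nonneg)
  show "bump \<epsilon> (z - z') = 0" if "norm z' > norm z + \<epsilon>" for z'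
    using that norm_triangle_ineq2[of z' z] assms by (intro bump_eq_0) (auto simp: norm_minus_commute)
qed simp

lemma integral_bump:
  fixes z :: "'b::euclidean_space"
  shows "(\<integral>z'. bump \<epsilon> (z - z') \<partial>lborel) = bump_mass TYPE('b) \<epsilon>"
  using lborel_integral_translate[of "bump \<epsilon>" "- z"] unfolding bump_mass_def
  by (subst bump_commute) simp

text \<open>On the ball of half the radius the argument of \<open>flat 0\<close> is at least 3/4,
  and that ball has 1 / 2^d of the volume. Hence averages over balls and mollifications are
  comparable with a constant independent of \<epsilon>.\<close>

lemma bump_mass_ge:
  fixes z :: "'b::euclidean_space"
  assumes "\<epsilon> > 0"
  shows "flat 0 (3/4) / 2 ^ DIM('b) * measure lborel (ball z \<epsilon>) \<le> bump_mass TYPE('b) \<epsilon>"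
proof -
  have "emeasure lborel (ball (0::'b) (\<epsilon> / 2)) < \<infinity>" by (rule emeasure_bounded_finite) simp
  then have i: "integrable lborel (\<lambda>y. flat 0 (3/4) * indicator (ball (0::'b) (\<epsilon> / 2)) y)" by simp
  have pt: "flat 0 (3/4) * indicator (ball (0::'b) (\<epsilon> / 2)) y \<le> bump \<epsilon> y" for y :: 'b
  proof (cases "norm y < \<epsilon> / 2")
    case True
    then have "(norm y)\<^sup>2 \<le> (\<epsilon> / 2)\<^sup>2" by (intro power_mono) auto
    then have "y \<bullet> y \<le> \<epsilon>\<^sup>2 / 4" by (simp add: power2_norm_eq_inner power_divide)
    then have a: "(y \<bullet> y) / \<epsilon>\<^sup>2 \<le> 1/4" using assms by (simp add: field_simps)
    have "flat 0 (3/4) \<le> flat 0 (1 - q)" if "q \<le> 1/4" for q :: real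
    proof -
      have "1 / (1 - q) \<le> 1 / (3/4)"
        using that by (intro divide_left_mono mult_pos_pos) auto
      then show ?thesis using that by (simp add: flat_def)
    qed
    from this[OF a] have "flat 0 (3/4) \<le> bump \<epsilon> y" by (simp add: bump_def)
    then show ?thesis using True by simp
  next
    case False
    then show ?thesis by (simp add: bump_nonneg)
  qed
  have "flat 0 (3/4) * measure lborel (ball (0::'b) (\<epsilon> / 2)) = (\<integral>y. flat 0 (3/4) * indicator (ball (0::'b) (\<epsilon> / 2)) y \<partial>lborel)"
    by simp
  also have "\<dots> \<le> bump_mass TYPE('b) \<epsilon>"
    unfolding bump_mass_def
    using bump_integrable[OF assms, of "0::'b"]
    by (intro integral_mono i pt) (simp add: bump_minus)
  finally show ?thesis
    using content_ball_conv_unit_ball[of "\<epsilon> / 2" "0::'b"] content_ball_conv_unit_ball[of \<epsilon> z] assms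
    by (simp add: power_divide)
qed

lemma bump_mass_pos:
  assumes "\<epsilon> > 0"
  shows "bump_mass TYPE('b::euclidean_space) \<epsilon> > 0"
proof -
  have "0 < flat 0 (3/4) / 2 ^ DIM('b) * measure lborel (ball (0::'b) \<epsilon>)"
    using content_ball_pos[OF assms, of "0::'b"] flat_0_pos[of "3/4"] by simp
  then show ?thesis using bump_mass_ge[OF assms, of "0::'b"] by linarith
qed

definition mollify :: "real \<Rightarrow> ('b::euclidean_space \<Rightarrow> real) \<Rightarrow> 'b \<Rightarrow> real" where
  "mollify \<epsilon> f z = (\<integral>z'. f z' * bump \<epsilon> (z - z') \<partial>lborel) / bump_mass TYPE('b) \<epsilon>"

definition mollify_deriv :: "real \<Rightarrow> 'b::euclidean_space \<Rightarrow> ('b \<Rightarrow> real) \<Rightarrow> 'b \<Rightarrow> real" where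
  "mollify_deriv \<epsilon> e f z = (\<integral>z'. f z' * bump_deriv \<epsilon> e (z - z') \<partial>lborel) / bump_mass TYPE('b) \<epsilon>"

lemma integrable_mult_bounded:
  fixes f g :: "'b::euclidean_space \<Rightarrow> real"
  assumes "integrable lborel f" and [measurable]: "g \<in> borel_measurable borel" and "\<And>z. \<bar>g z\<bar> \<le> C"
  shows "integrable lborel (\<lambda>z. f z * g z)"
proof (rule Bochner_Integration.integrable_bound[of _ "\<lambda>z. C * f z"])
  have [measurable]: "f \<in> borel_measurable borel" using assms(1) by auto
  show "integrable lborel (\<lambda>z. C * f z)" using assms(1) by simp
  show "AE z in lborel. norm (f z * g z) \<le> norm (C * f z)"
  proof (rule AE_I2)
    fix z
    have "\<bar>g z\<bar> \<le> \<bar>C\<bar>" using assms(3)[of z] by linarith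
    then show "norm (f z * g z) \<le> norm (C * f z)"
      using mult_left_mono[of "\<bar>g z\<bar>" "\<bar>C\<bar>" "\<bar>f z\<bar>"] by (simp add: abs_mult mult.commute)
  qed
qed (use assms in measurable)

lemma mollify_integrands:
  fixes f :: "'b::euclidean_space \<Rightarrow> real"
  assumes "integrable lborel f" "\<epsilon> > 0"
  shows "integrable lborel (\<lambda>z'. f z' * bump \<epsilon> (z - z'))"
    and "integrable lborel (\<lambda>z'. f z' * bump_deriv \<epsilon> e (z - z'))"
proof -
  have "\<bar>bump \<epsilon> y\<bar> \<le> 1" for y :: 'b using bump_nonneg bump_le_1 by (metis abs_of_nonneg)
  then show "integrable lborel (\<lambda>z'. f z' * bump \<epsilon> (z - z'))"
    by (intro integrable_mult_bounded[OF assms(1), where C=1]) auto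
  show "integrable lborel (\<lambda>z'. f z' * bump_deriv \<epsilon> e (z - z'))"
    using bump_deriv_bound[OF assms(2)] by (intro integrable_mult_bounded[OF assms(1)]) auto
qed

text \<open>Differentiation under the integral: the Lipschitz bound of the bump dominates its
  difference quotients. The form along a line is the one needed for mean value estimates and the
  chain rule.\<close>

lemma mollify_line_derivative:
  fixes f :: "'b::euclidean_space \<Rightarrow> real"
  assumes f: "integrable lborel f" and \<epsilon>: "\<epsilon> > 0"
  shows "((\<lambda>s. mollify \<epsilon> f (z + s *\<^sub>R e)) has_real_derivative mollify_deriv \<epsilon> e f (z + s *\<^sub>R e)) (at s)"
proof -
  have [measurable]: "f \<in> borel_measurable borel" using f by auto
  define w where "w = z + s *\<^sub>R e"
  let ?I = "\<lambda>x. \<integral>z'. f z' * bump \<epsilon> (x - z') \<partial>lborel"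
  have "((\<lambda>h. (?I (w + h *\<^sub>R e) - ?I w) / h) \<longlongrightarrow> (\<integral>z'. f z' * bump_deriv \<epsilon> e (w - z') \<partial>lborel)) (at 0)"
    unfolding tendsto_at_iff_sequentially comp_def
  proof (intro allI impI)
    fix X :: "nat \<Rightarrow> real" assume X: "\<forall>i. X i \<in> UNIV - {0}" "X \<longlonglongrightarrow> 0"
    have eq: "(?I (w + X n *\<^sub>R e) - ?I w) / X n =
       (\<integral>z'. f z' * ((bump \<epsilon> (w + X n *\<^sub>R e - z') - bump \<epsilon> (w - z')) / X n) \<partial>lborel)" for n
    proof -
      have "?I (w + X n *\<^sub>R e) - ?I w = (\<integral>z'. f z' * bump \<epsilon> (w + X n *\<^sub>R e - z') - f z' * bump \<epsilon> (w - z') \<partial>lborel)"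
        by (rule Bochner_Integration.integral_diff[symmetric]) (rule mollify_integrands[OF assms])+
      then have "(?I (w + X n *\<^sub>R e) - ?I w) / X n
          = (\<integral>z'. (f z' * bump \<epsilon> (w + X n *\<^sub>R e - z') - f z' * bump \<epsilon> (w - z')) / X n \<partial>lborel)"
        by simp
      then show ?thesis by (simp only: right_diff_distrib[symmetric] times_divide_eq_right)
    qed
    show "(\<lambda>n. (?I (w + X n *\<^sub>R e) - ?I w) / X n) \<longlonglongrightarrow> (\<integral>z'. f z' * bump_deriv \<epsilon> e (w - z') \<partial>lborel)"
      unfolding eq
    proof (rule integral_dominated_convergence[where w="\<lambda>z'. (4 / \<epsilon> * norm e) * \<bar>f z'\<bar>"])
      show "integrable lborel (\<lambda>z'. (4 / \<epsilon> * norm e) * \<bar>f z'\<bar>)" using f by simp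
      show "AE z' in lborel. (\<lambda>n. f z' * ((bump \<epsilon> (w + X n *\<^sub>R e - z') - bump \<epsilon> (w - z')) / X n))
        \<longlonglongrightarrow> f z' * bump_deriv \<epsilon> e (w - z')"
      proof (rule AE_I2)
        fix z'
        have "((\<lambda>s. bump \<epsilon> ((w - z') + s *\<^sub>R e)) has_real_derivative bump_deriv \<epsilon> e (w - z')) (at 0)"
          using bump_line_derivative[of \<epsilon> "w - z'" e 0] by simp
        then have "((\<lambda>h. (bump \<epsilon> ((w - z') + h *\<^sub>R e) - bump \<epsilon> (w - z')) / h) \<longlongrightarrow> bump_deriv \<epsilon> e (w - z')) (at 0)"
          by (simp add: has_field_derivative_iff)
        then have "(\<lambda>n. (bump \<epsilon> ((w - z') + X n *\<^sub>R e) - bump \<epsilon> (w - z')) / X n) \<longlonglongrightarrow> bump_deriv \<epsilon> e (w - z')"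
          using X unfolding tendsto_at_iff_sequentially comp_def by blast
        moreover have "(w - z') + t *\<^sub>R e = w + t *\<^sub>R e - z'" for t by (simp add: algebra_simps)
        ultimately show "(\<lambda>n. f z' * ((bump \<epsilon> (w + X n *\<^sub>R e - z') - bump \<epsilon> (w - z')) / X n))
          \<longlonglongrightarrow> f z' * bump_deriv \<epsilon> e (w - z')"
          by (intro tendsto_mult_left) simp
      qed
      show "AE z' in lborel. norm (f z' * ((bump \<epsilon> (w + X n *\<^sub>R e - z') - bump \<epsilon> (w - z')) / X n))
          \<le> (4 / \<epsilon> * norm e) * \<bar>f z'\<bar>" for n
      proof (rule AE_I2)
        fix z'
        have "X n \<noteq> 0" using X by auto
        have eq': "w + X n *\<^sub>R e - z' = (w - z') + X n *\<^sub>R e" by (simp add: algebra_simps)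
        have "\<bar>(bump \<epsilon> (w + X n *\<^sub>R e - z') - bump \<epsilon> (w - z')) / X n\<bar> \<le> 4 / \<epsilon> * norm e"
          unfolding eq' using bump_lipschitz[OF \<epsilon>, of "w - z'" "X n" e] \<open>X n \<noteq> 0\<close>
          by (simp add: divide_le_eq)
        from mult_right_mono[OF this abs_ge_zero[of "f z'"]]
        show "norm (f z' * ((bump \<epsilon> (w + X n *\<^sub>R e - z') - bump \<epsilon> (w - z')) / X n)) \<le> (4 / \<epsilon> * norm e) * \<bar>f z'\<bar>"
          by (simp only: real_norm_def abs_mult mult.commute)
      qed
    qed auto
  qed
  then have "((\<lambda>h. ((?I (w + h *\<^sub>R e) - ?I w) / h) / bump_mass TYPE('b) \<epsilon>) \<longlongrightarrow> mollify_deriv \<epsilon> e f w) (at 0)"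
    unfolding mollify_deriv_def by (rule tendsto_divide) (use bump_mass_pos[OF \<epsilon>, where ?'b = 'b] in auto)
  moreover have "((?I (w + h *\<^sub>R e) - ?I w) / h) / bump_mass TYPE('b) \<epsilon>
    = (mollify \<epsilon> f (z + (s + h) *\<^sub>R e) - mollify \<epsilon> f (z + s *\<^sub>R e)) / h" for h
    by (simp add: mollify_def w_def diff_divide_distrib algebra_simps)
  ultimately show ?thesis by (simp add: DERIV_def w_def)
qed

lemma mollify_lipschitz:
  fixes f :: "'b::euclidean_space \<Rightarrow> real"
  assumes f: "integrable lborel f" and \<epsilon>: "\<epsilon> > 0"
  shows "\<bar>mollify \<epsilon> f z - mollify \<epsilon> f w\<bar> \<le> (4 / \<epsilon> * (\<integral>z. \<bar>f z\<bar> \<partial>lborel) / bump_mass TYPE('b) \<epsilon>) * norm (z - w)"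
proof -
  note m = mollify_integrands(1)[OF assms]
  have "\<bar>(\<integral>z'. f z' * bump \<epsilon> (z - z') \<partial>lborel) - (\<integral>z'. f z' * bump \<epsilon> (w - z') \<partial>lborel)\<bar>
    = \<bar>\<integral>z'. f z' * bump \<epsilon> (z - z') - f z' * bump \<epsilon> (w - z') \<partial>lborel\<bar>"
    by (subst Bochner_Integration.integral_diff) (auto intro: m)
  also have "\<dots> \<le> (\<integral>z'. \<bar>f z' * bump \<epsilon> (z - z') - f z' * bump \<epsilon> (w - z')\<bar> \<partial>lborel)"
    by (rule integral_abs_bound)
  also have "\<dots> \<le> (\<integral>z'. (4 / \<epsilon> * norm (z - w)) * \<bar>f z'\<bar> \<partial>lborel)"
  proof (rule integral_mono)
    fix z'
    have "\<bar>bump \<epsilon> (z - z') - bump \<epsilon> (w - z')\<bar> \<le> 4 / \<epsilon> * norm (z - w)"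
      using bump_lipschitz[OF \<epsilon>, of "w - z'" 1 "z - w"] by simp
    from mult_right_mono[OF this abs_ge_zero[of "f z'"]]
    show "\<bar>f z' * bump \<epsilon> (z - z') - f z' * bump \<epsilon> (w - z')\<bar> \<le> (4 / \<epsilon> * norm (z - w)) * \<bar>f z'\<bar>"
      by (simp only: right_diff_distrib[symmetric] abs_mult mult.commute)
  qed (use f m in auto)
  finally have "\<bar>(\<integral>z'. f z' * bump \<epsilon> (z - z') \<partial>lborel) - (\<integral>z'. f z' * bump \<epsilon> (w - z') \<partial>lborel)\<bar>
    \<le> (4 / \<epsilon> * norm (z - w)) * (\<integral>z. \<bar>f z\<bar> \<partial>lborel)" by simp
  from divide_right_mono[OF this order.strict_implies_order[OF bump_mass_pos[OF \<epsilon>, where ?'b = 'b]]]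
  show ?thesis
    using bump_mass_pos[OF \<epsilon>, where ?'b = 'b]
    by (simp add: mollify_def diff_divide_distrib[symmetric] abs_divide mult_ac)
qed

lemma mollify_continuous_on:
  fixes f :: "'b::euclidean_space \<Rightarrow> real"
  assumes f: "integrable lborel f" and \<epsilon>: "\<epsilon> > 0"
  shows "continuous_on UNIV (mollify \<epsilon> f)"
proof (rule lipschitz_on_continuous_on)
  show "(4 / \<epsilon> * (\<integral>z. \<bar>f z\<bar> \<partial>lborel) / bump_mass TYPE('b) \<epsilon>)-lipschitz_on UNIV (mollify \<epsilon> f)"
    using mollify_lipschitz[OF assms] bump_mass_pos[OF \<epsilon>, where ?'b = 'b] \<epsilon>
    by (intro lipschitz_onI) (auto simp: dist_norm)
qed

text \<open>The normalised kernel has mass one, so \<open>f z\<close> can be moved under the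
  integral; what remains is weighted by a bump that is at most 1 and lives on the ball.\<close>

lemma mollify_diff_le:
  fixes f :: "'b::euclidean_space \<Rightarrow> real"
  assumes f: "integrable lborel f" and \<epsilon>: "\<epsilon> > 0"
  shows "\<bar>mollify \<epsilon> f z - f z\<bar> \<le> oscillation \<epsilon> f z / bump_mass TYPE('b) \<epsilon>"
proof -
  let ?N = "bump_mass TYPE('b) \<epsilon>"
  note N = bump_mass_pos[OF \<epsilon>, where ?'b = 'b]
  have c: "integrable lborel (\<lambda>z'. f z * bump \<epsilon> (z - z'))"
    using bump_integrable[OF \<epsilon>, of z] by simp
  have "(\<integral>z'. f z * bump \<epsilon> (z - z') \<partial>lborel) = f z * ?N"
    by (subst integral_mult_right_zero) (simp add: integral_bump)
  then have "mollify \<epsilon> f z - f z = ((\<integral>z'. f z' * bump \<epsilon> (z - z') \<partial>lborel) - (\<integral>z'. f z * bump \<epsilon> (z - z') \<partial>lborel)) / ?N"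
    using N by (simp only: mollify_def diff_divide_distrib) simp
  also have "\<dots> = (\<integral>z'. (f z' - f z) * bump \<epsilon> (z - z') \<partial>lborel) / ?N"
    by (simp only: left_diff_distrib Bochner_Integration.integral_diff[OF mollify_integrands(1)[OF assms] c])
  finally have eq: "mollify \<epsilon> f z - f z = (\<integral>z'. (f z' - f z) * bump \<epsilon> (z - z') \<partial>lborel) / ?N" .
  have "\<bar>\<integral>z'. (f z' - f z) * bump \<epsilon> (z - z') \<partial>lborel\<bar> \<le> oscillation \<epsilon> f z"
    unfolding oscillation_def
  proof (rule integral_abs_bound_integral)
    show "integrable lborel (\<lambda>z'. (f z' - f z) * bump \<epsilon> (z - z'))"
      unfolding left_diff_distrib by (intro Bochner_Integration.integrable_diff c mollify_integrands[OF assms])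
    fix z'
    show "\<bar>(f z' - f z) * bump \<epsilon> (z - z')\<bar> \<le> indicator (ball z \<epsilon>) z' * \<bar>f z' - f z\<bar>"
    proof (cases "dist z z' < \<epsilon>")
      case True
      have "\<bar>bump \<epsilon> (z - z')\<bar> \<le> 1" using bump_nonneg[of \<epsilon> "z - z'"] bump_le_1[of \<epsilon> "z - z'"] by simp
      then have "\<bar>f z' - f z\<bar> * \<bar>bump \<epsilon> (z - z')\<bar> \<le> \<bar>f z' - f z\<bar>" by (intro mult_left_le) auto
      then show ?thesis using True by (simp add: abs_mult)
    next
      case False
      then show ?thesis using bump_eq_0[OF \<epsilon>, of "z - z'"] by (simp add: dist_norm)
    qed
  qed (rule integrable_indicator_ball_mult[OF f])
  then show ?thesis unfolding eq using N by (simp add: abs_divide divide_right_mono)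
qed

lemma mollify_eq_0:
  fixes f :: "'b::euclidean_space \<Rightarrow> real"
  assumes "\<epsilon> > 0" "\<And>z. norm z > R \<Longrightarrow> f z = 0" "norm z > R + \<epsilon>"
  shows "mollify \<epsilon> f z = 0"
proof -
  have z0: "f z' * bump \<epsilon> (z - z') = 0" for z'
  proof (cases "norm z' > R")
    case False
    then have "norm (z - z') \<ge> \<epsilon>" using assms(3) norm_triangle_ineq2[of z z'] by linarith
    then show ?thesis using bump_eq_0[OF assms(1), of "z - z'"] by simp
  qed (use assms in simp)
  show ?thesis unfolding mollify_def z0 by simp
qed

text \<open>Integration by parts as a limit of difference quotients; the weight \<open>W\<close> need not be
  differentiable, only one-sided bounds on its difference quotients enter.\<close>

lemma integral_weight_deriv_ge:
  fixes B W B' \<Lambda> :: "'b::euclidean_space \<Rightarrow> real" and e :: 'b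
  assumes B: "continuous_on UNIV B" "\<And>z. 0 \<le> B z" "\<And>z. norm z > R \<Longrightarrow> B z = 0"
    and Blip: "\<And>z h. \<bar>B (z + h *\<^sub>R e) - B z\<bar> \<le> K * \<bar>h\<bar>"
    and der: "\<And>z. ((\<lambda>s. B (z + s *\<^sub>R e)) has_real_derivative B' z) (at 0)"
    and W: "continuous_on UNIV W"
    and Wlip: "\<And>z h. norm z \<le> R \<Longrightarrow> 0 < h \<Longrightarrow> h \<le> 1 \<Longrightarrow> \<bar>W (z - h *\<^sub>R e) - W z\<bar> \<le> C * h"
    and L [measurable]: "\<Lambda> \<in> borel_measurable borel" and Lb: "\<And>z. norm z \<le> R \<Longrightarrow> \<bar>\<Lambda> z\<bar> \<le> C'"
    and ev: "\<And>z. B z \<noteq> 0 \<Longrightarrow> \<forall>\<^sub>F h in at_right 0. W (z - h *\<^sub>R e) - W z \<ge> h * \<Lambda> z"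
  shows "integrable lborel (\<lambda>z. W z * B' z)" "(\<integral>z. B z * \<Lambda> z \<partial>lborel) \<le> (\<integral>z. W z * B' z \<partial>lborel)"
    "integrable lborel (\<lambda>z. B z * \<Lambda> z)"
proof -
  have Bm [measurable]: "B \<in> borel_measurable borel" and Wm [measurable]: "W \<in> borel_measurable borel"
    using B(1) W by (auto intro: borel_measurable_continuous_onI)
  \<comment> \<open>Enlarged so that beyond radius \<open>r\<close> neither \<open>z\<close> nor its
    translate by at most \<open>norm e\<close> meets the support of \<open>B\<close>.\<close>
  define r where "r = \<bar>R\<bar> + norm e"
  have rR: "r \<ge> R" "r \<ge> 0" by (auto simp: r_def add_increasing2)
  have "compact (W ` cball 0 r)" "compact (B ` cball 0 r)"
    by (intro compact_continuous_image continuous_on_subset[OF W] continuous_on_subset[OF B(1)] compact_cball subset_UNIV)+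
  then obtain M1 M2 where "\<forall>z\<in>cball 0 r. \<bar>W z\<bar> \<le> M1" "\<forall>z\<in>cball 0 r. \<bar>B z\<bar> \<le> M2"
    by (auto dest!: compact_imp_bounded simp: bounded_iff)
  then have M1: "\<bar>W z\<bar> \<le> M1" and M2': "\<bar>B z\<bar> \<le> M2" if "norm z \<le> r" for z using that by auto
  have M2: "\<bar>B z\<bar> \<le> M2" for z
    using M2'[of z] M2'[of 0] B(3)[of z] rR by (cases "norm z \<le> r") auto
  have M1p: "M1 \<ge> 0" using M1[of 0] rR by simp
  have M2p: "M2 \<ge> 0" using M2[of 0] by linarith
  have K: "K \<ge> 0" using Blip[of 0 1] by simp
  define hh where "hh n = 1 / real (Suc n)" for n
  have h: "0 < hh n" "hh n \<le> 1" for n by (auto simp: hh_def)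
  have h0: "hh \<longlonglongrightarrow> 0" unfolding hh_def by (rule LIMSEQ_Suc[OF lim_1_over_n])
  \<comment> \<open>\<open>q n\<close> carries the difference quotient of \<open>B\<close>,
    \<open>p n\<close> that of \<open>W\<close> with the shift reversed. Translation by
    \<open>hh n *\<^sub>R e\<close> makes their integrals equal: a discrete integration by
    parts.\<close>
  define q where "q n z = W z * ((B (z + hh n *\<^sub>R e) - B z) / hh n)" for n z
  define p where "p n z = B z * ((W (z - hh n *\<^sub>R e) - W z) / hh n)" for n z
  have far: "norm (z + hh n *\<^sub>R e) > R" if "norm z > r" for z n
  proof -
    have "norm (hh n *\<^sub>R e) \<le> norm e" using h[of n] by (simp add: mult_left_le_one_le)
    then show ?thesis using that norm_diff_ineq[of z "hh n *\<^sub>R e"] by (simp add: r_def)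
  qed
  have W_B_int: "integrable lborel (\<lambda>z. W z * B z)"
  proof (rule integrable_lborel_bounded_support[of _ "M1 * M2" r])
    show "W z * B z = 0" if "norm z > r" for z using that rR B(3)[of z] by auto
    show "\<bar>W z * B z\<bar> \<le> M1 * M2" for z
    proof (cases "norm z \<le> r")
      case True
      then show ?thesis using M1[OF True] M2[of z] M1p by (simp add: abs_mult mult_mono)
    next
      case False
      then show ?thesis using rR B(3)[of z] M1p M2p by auto
    qed
  qed simp
  have W_Bh_int: "integrable lborel (\<lambda>z. W z * B (z + hh n *\<^sub>R e))" for n
  proof (rule integrable_lborel_bounded_support[of _ "M1 * M2" r])
    show "W z * B (z + hh n *\<^sub>R e) = 0" if "norm z > r" for z using B(3)[OF far[OF that]] by auto
    show "\<bar>W z * B (z + hh n *\<^sub>R e)\<bar> \<le> M1 * M2" for z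
    proof (cases "norm z \<le> r")
      case True
      then show ?thesis using M1[OF True] M2[of "z + hh n *\<^sub>R e"] M1p by (simp add: abs_mult mult_mono)
    next
      case False
      then have "B (z + hh n *\<^sub>R e) = 0" by (intro B(3) far) simp
      then show ?thesis using M1p M2p by auto
    qed
  qed simp
  have pb: "\<bar>p n z\<bar> \<le> M2 * \<bar>C\<bar>" for n z
  proof (cases "norm z \<le> R")
    case True
    have "\<bar>W (z - hh n *\<^sub>R e) - W z\<bar> \<le> \<bar>C\<bar> * hh n"
      using Wlip[OF True h[of n]] h(1)[of n] mult_right_mono[of C "\<bar>C\<bar>" "hh n"] by linarith
    then have "\<bar>(W (z - hh n *\<^sub>R e) - W z) / hh n\<bar> \<le> \<bar>C\<bar>" using h(1)[of n] by (simp add: abs_divide divide_le_eq)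
    then show ?thesis unfolding p_def abs_mult using M2[of z] M2p by (intro mult_mono) auto
  next
    case False
    then show ?thesis using B(3)[of z] M2p by (simp add: p_def)
  qed
  have pm: "p n \<in> borel_measurable borel" for n unfolding p_def by measurable
  have p_int: "integrable lborel (p n)" for n
    by (rule integrable_lborel_bounded_support[OF pm pb]) (use B(3) in \<open>auto simp: p_def\<close>)
  have pq: "(\<integral>z. q n z \<partial>lborel) = (\<integral>z. p n z \<partial>lborel)" for n
  proof -
    have "(\<integral>z. q n z \<partial>lborel) = ((\<integral>z. W z * B (z + hh n *\<^sub>R e) \<partial>lborel) - (\<integral>z. W z * B z \<partial>lborel)) / hh n"
      unfolding q_def
      by (subst Bochner_Integration.integral_diff[symmetric, OF W_Bh_int W_B_int])
         (simp add: right_diff_distrib[symmetric] integral_divide_zero[symmetric] del: integral_divide_zero)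
    also have "(\<integral>z. W z * B (z + hh n *\<^sub>R e) \<partial>lborel) = (\<integral>z. B z * W (z - hh n *\<^sub>R e) \<partial>lborel)"
      using lborel_integral_translate[of "\<lambda>z. B z * W (z - hh n *\<^sub>R e)" "hh n *\<^sub>R e"]
      by (simp add: mult.commute add.commute)
    also have "(\<integral>z. B z * W (z - hh n *\<^sub>R e) \<partial>lborel) = (\<integral>z. hh n * p n z + W z * B z \<partial>lborel)"
      using h(1)[of n] by (intro Bochner_Integration.integral_cong) (auto simp: p_def field_simps)
    also have "\<dots> = hh n * (\<integral>z. p n z \<partial>lborel) + (\<integral>z. W z * B z \<partial>lborel)"
      using p_int[of n] W_B_int by (subst Bochner_Integration.integral_add) auto
    finally show ?thesis using h(1)[of n] by simp
  qed
  have qlim: "(\<lambda>n. q n z) \<longlonglongrightarrow> W z * B' z" for z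
  proof -
    have "((\<lambda>h. (B (z + h *\<^sub>R e) - B z) / h) \<longlongrightarrow> B' z) (at 0)"
      using der[of z] by (simp add: has_field_derivative_iff)
    moreover have "filterlim hh (at 0) sequentially"
      by (rule filterlim_atI[OF h0]) (simp add: hh_def)
    ultimately have "(\<lambda>n. (B (z + hh n *\<^sub>R e) - B z) / hh n) \<longlonglongrightarrow> B' z"
      by (rule filterlim_compose)
    then show ?thesis unfolding q_def by (intro tendsto_mult_left)
  qed
  have qm: "q n \<in> borel_measurable lborel" for n unfolding q_def by measurable
  have [measurable]: "(\<lambda>z. W z * B' z) \<in> borel_measurable lborel"
    by (rule borel_measurable_LIMSEQ_real[OF _ qm]) (use qlim in auto)
  have qb: "norm (q n z) \<le> M1 * K * indicator (cball 0 r) z" for n z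
  proof (cases "norm z \<le> r")
    case True
    have "\<bar>(B (z + hh n *\<^sub>R e) - B z) / hh n\<bar> \<le> K"
      using Blip[of z "hh n"] h(1)[of n] by (simp add: abs_divide divide_le_eq)
    then have "\<bar>W z\<bar> * \<bar>(B (z + hh n *\<^sub>R e) - B z) / hh n\<bar> \<le> M1 * K"
      using M1[OF True] M1p by (intro mult_mono) auto
    then show ?thesis using True by (simp add: q_def abs_mult)
  next
    case False
    then have "B (z + hh n *\<^sub>R e) = 0" "B z = 0" using rR by (auto intro!: B(3) far)
    then show ?thesis by (simp add: q_def M1p K)
  qed
  have "emeasure lborel (cball (0::'b) r) < \<infinity>" by (rule emeasure_bounded_finite) simp
  then have di: "integrable lborel (\<lambda>z. M1 * K * indicator (cball (0::'b) r) z)" by simp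
  show "integrable lborel (\<lambda>z. W z * B' z)"
    by (rule integrable_dominated_convergence[OF _ _ di, of _ q]) (use qm qlim qb in auto)
  have "(\<lambda>n. \<integral>z. q n z \<partial>lborel) \<longlonglongrightarrow> (\<integral>z. W z * B' z \<partial>lborel)"
    by (rule integral_dominated_convergence[OF _ _ di]) (use qm qlim qb in auto)
  then have plim: "(\<lambda>n. \<integral>z. p n z \<partial>lborel) \<longlonglongrightarrow> (\<integral>z. W z * B' z \<partial>lborel)" by (simp add: pq)
  have lb: "\<bar>B z * \<Lambda> z\<bar> \<le> M2 * \<bar>C'\<bar>" for z
  proof (cases "norm z \<le> R")
    case True
    have "\<bar>\<Lambda> z\<bar> \<le> \<bar>C'\<bar>" using Lb[OF True] by linarith
    then show ?thesis unfolding abs_mult using M2[of z] M2p by (intro mult_mono) auto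
  next
    case False
    then show ?thesis using B(3)[of z] M2p by simp
  qed
  show L_int: "integrable lborel (\<lambda>z. B z * \<Lambda> z)"
    by (rule integrable_lborel_bounded_support[of _ "M2 * \<bar>C'\<bar>" R]) (use lb B(3) in auto)
  let ?D = "M2 * \<bar>C\<bar> + M2 * \<bar>C'\<bar>"
  have "emeasure lborel (cball (0::'b) R) < \<infinity>" by (rule emeasure_bounded_finite) simp
  then have di': "integrable lborel (\<lambda>z. ?D * indicator (cball (0::'b) R) z)" by simp
  \<comment> \<open>Only an eventual lower bound on \<open>p n z\<close> is known, not a limit. The
    minimum with that bound is dominated and converges to it, so the bound passes to the limit of
    the integrals.\<close>
  have "(\<lambda>n. \<integral>z. min (p n z) (B z * \<Lambda> z) \<partial>lborel) \<longlonglongrightarrow> (\<integral>z. B z * \<Lambda> z \<partial>lborel)"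
  proof (rule integral_dominated_convergence[OF _ _ di'])
    show "AE z in lborel. (\<lambda>n. min (p n z) (B z * \<Lambda> z)) \<longlonglongrightarrow> B z * \<Lambda> z"
    proof (rule AE_I2, rule tendsto_eventually)
      fix z
      show "\<forall>\<^sub>F n in sequentially. min (p n z) (B z * \<Lambda> z) = B z * \<Lambda> z"
      proof (cases "B z = 0")
        case False
        have "filterlim hh (at_right 0) sequentially"
          using h0 h(1) by (intro tendsto_imp_filterlim_at_right) auto
        from eventually_compose_filterlim[OF ev[OF False] this]
        show ?thesis
        proof eventually_elim
          case (elim n)
          then have "\<Lambda> z \<le> (W (z - hh n *\<^sub>R e) - W z) / hh n"
            using h(1)[of n] by (simp add: le_divide_eq mult.commute)
          then have "B z * \<Lambda> z \<le> p n z" unfolding p_def using B(2)[of z] by (intro mult_left_mono)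
          then show ?case by simp
        qed
      qed (simp add: p_def)
    qed
    show "AE z in lborel. norm (min (p n z) (B z * \<Lambda> z)) \<le> ?D * indicator (cball 0 R) z" for n
    proof (rule AE_I2)
      fix z
      show "norm (min (p n z) (B z * \<Lambda> z)) \<le> ?D * indicator (cball 0 R) z"
      proof (cases "norm z \<le> R")
        case True
        have "0 \<le> M2 * \<bar>C\<bar>" "0 \<le> M2 * \<bar>C'\<bar>" using M2p by auto
        then show ?thesis using True pb[of n z] lb[of z] by (simp add: min_def)
      next
        case False
        then show ?thesis using B(3)[of z] by (simp add: p_def)
      qed
    qed
  qed (use pm in auto)
  then show "(\<integral>z. B z * \<Lambda> z \<partial>lborel) \<le> (\<integral>z. W z * B' z \<partial>lborel)"
  proof (rule LIMSEQ_le[OF _ plim], intro exI[of _ 0] allI impI)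
    show "(\<integral>z. min (p n z) (B z * \<Lambda> z) \<partial>lborel) \<le> (\<integral>z. p n z \<partial>lborel)" for n
      using p_int[of n] L_int by (intro integral_mono) auto
  qed
qed

subsection \<open>Bounded weak derivatives\<close>

lemma integral_lebesgue_on_eq_lborel:
  fixes F :: "'b::euclidean_space \<Rightarrow> real"
  assumes Q: "Q \<in> sets borel" and F: "(\<lambda>z. indicator Q z * F z) \<in> borel_measurable borel"
  shows "(\<integral>z. F z \<partial>lebesgue_on Q) = (\<integral>z. indicator Q z * F z \<partial>lborel)"
proof -
  have "Q \<inter> space lebesgue \<in> sets lebesgue" using Q by simp
  from integral_restrict_space[OF this, of F]
  have "(\<integral>z. F z \<partial>lebesgue_on Q) = (\<integral>z. indicator Q z * F z \<partial>lebesgue)" by simp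
  also have "\<dots> = (\<integral>z. indicator Q z * F z \<partial>lborel)"
    using F by (intro integral_completion) simp
  finally show ?thesis .
qed

lemma AE_lebesgue_on_iff_lborel:
  fixes Q :: "'b::euclidean_space set"
  assumes "Q \<in> sets borel"
  shows "(AE z in lebesgue_on Q. P z) \<longleftrightarrow> (AE z in lborel. z \<in> Q \<longrightarrow> P z)"
proof -
  have "Q \<inter> space lebesgue \<in> sets lebesgue" using assms by simp
  then show ?thesis by (simp add: AE_restrict_space_iff AE_completion_iff)
qed

lemma borel_imp_measurable_lebesgue_on:
  fixes F :: "'b::euclidean_space \<Rightarrow> real"
  assumes "F \<in> borel_measurable borel"
  shows "F \<in> borel_measurable (lebesgue_on Q)"
  using assms by (intro measurable_restrict_space1 measurable_completion) simp

lemma mollify_deriv_Basis: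
  fixes f :: "'b::euclidean_space \<Rightarrow> real"
  assumes f: "integrable lborel f" and \<epsilon>: "\<epsilon> > 0"
  shows "mollify_deriv \<epsilon> d f z = (\<Sum>e\<in>Basis. (d \<bullet> e) * mollify_deriv \<epsilon> e f z)"
proof -
  have "bump_deriv \<epsilon> d y = (\<Sum>e\<in>Basis. (d \<bullet> e) * bump_deriv \<epsilon> e y)" for y
    using bump_deriv_sum[of \<epsilon> "\<lambda>e. d \<bullet> e" "\<lambda>e. e" Basis y] by (simp add: euclidean_representation)
  then have "(\<integral>z'. f z' * bump_deriv \<epsilon> d (z - z') \<partial>lborel)
    = (\<integral>z'. (\<Sum>e\<in>Basis. (d \<bullet> e) * (f z' * bump_deriv \<epsilon> e (z - z'))) \<partial>lborel)"
    by (simp add: sum_distrib_left mult_ac)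
  also have "\<dots> = (\<Sum>e\<in>Basis. \<integral>z'. (d \<bullet> e) * (f z' * bump_deriv \<epsilon> e (z - z')) \<partial>lborel)"
    using mollify_integrands(2)[OF assms]
    by (intro Bochner_Integration.integral_sum integrable_mult_right)
  finally show ?thesis
    by (simp add: mollify_deriv_def sum_divide_distrib)
qed

lemma mollify_tendsto:
  fixes f :: "'b::euclidean_space \<Rightarrow> real"
  assumes f: "integrable lborel f" and z: "isCont f z" and "\<eta> > 0"
  obtains \<epsilon>0 where "\<epsilon>0 > 0" "\<And>\<epsilon>. 0 < \<epsilon> \<Longrightarrow> \<epsilon> \<le> \<epsilon>0 \<Longrightarrow> \<bar>mollify \<epsilon> f z - f z\<bar> \<le> \<eta>"
proof -
  \<comment> \<open>The constant of \<open>bump_mass_ge\<close>: a deviation of at most \<eta>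
    \<kappa> on the ball becomes an error of at most \<eta> after division by the mass of the
    bump.\<close>
  define \<kappa> where "\<kappa> = flat 0 (3/4) / 2 ^ DIM('b)"
  have \<kappa>: "\<kappa> > 0" using flat_0_pos[of "3/4"] by (simp add: \<kappa>_def)
  have "\<eta> * \<kappa> > 0" using \<kappa> assms(3) by simp
  with z obtain s where s: "s > 0" "\<And>z'. dist z' z < s \<Longrightarrow> dist (f z') (f z) < \<eta> * \<kappa>"
    unfolding continuous_at_eps_delta by blast
  show thesis
  proof (rule that[OF s(1)])
    fix \<epsilon> :: real assume \<epsilon>: "0 < \<epsilon>" "\<epsilon> \<le> s"
    have "oscillation \<epsilon> f z \<le> (\<integral>z'. indicator (ball z \<epsilon>) z' * (\<eta> * \<kappa>) \<partial>lborel)"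
      unfolding oscillation_def
    proof (intro integral_mono integrable_indicator_ball_mult(2,3)[OF f])
      fix z'
      show "indicator (ball z \<epsilon>) z' * \<bar>f z' - f z\<bar> \<le> indicator (ball z \<epsilon>) z' * (\<eta> * \<kappa>)"
        using s(2)[of z'] \<epsilon> by (cases "dist z z' < \<epsilon>") (auto simp: dist_commute dist_real_def)
    qed
    also have "\<dots> = \<eta> * (\<kappa> * measure lborel (ball z \<epsilon>))" by simp
    also have "\<dots> \<le> \<eta> * bump_mass TYPE('b) \<epsilon>"
      using bump_mass_ge[OF \<epsilon>(1), of z] assms(3) unfolding \<kappa>_def by (intro mult_left_mono) auto
    finally have "oscillation \<epsilon> f z / bump_mass TYPE('b) \<epsilon> \<le> \<eta>"
      using bump_mass_pos[OF \<epsilon>(1), where ?'b = 'b] by (simp add: divide_le_eq)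
    then show "\<bar>mollify \<epsilon> f z - f z\<bar> \<le> \<eta>"
      using mollify_diff_le[OF f \<epsilon>(1), of z] by linarith
  qed
qed

text \<open>Where a ball of radius \<epsilon> fits into \<open>Q\<close>, the gradient of the
  mollification inherits the essential bounds of the weak derivatives. The mean value theorem along
  the segment and \<epsilon> \<rightarrow> 0 at its endpoints give the claim. Segments are the right
  class of pairs, as \<open>Q\<close> may fail to be convex.\<close>

lemma W1inf_lipschitz_on_segments:
  fixes w g :: "'b::euclidean_space \<Rightarrow> real"
  assumes Q: "open Q" "bounded Q" and w: "continuous_on Q w" and V: "\<And>z. z \<in> Q \<Longrightarrow> \<bar>w z\<bar> \<le> V"
    and g: "g \<in> W1inf Q" and wg: "AE z in lebesgue_on Q. w z = g z"
  obtains L where "L \<ge> 0" "\<And>z z'. closed_segment z z' \<subseteq> Q \<Longrightarrow> \<bar>w z - w z'\<bar> \<le> L * dist z z'"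
proof -
  have Qb: "Q \<in> sets borel" using Q(1) by simp
  define f where "f z = indicator Q z * w z" for z
  have fm [measurable]: "f \<in> borel_measurable borel"
    using borel_measurable_continuous_on_indicator[OF Qb w] by (simp add: f_def[abs_def])
  obtain R where R: "\<And>z. z \<in> Q \<Longrightarrow> norm z \<le> R" using Q(2) by (auto simp: bounded_iff)
  have f: "integrable lborel f"
    by (rule integrable_lborel_bounded_support[of _ "\<bar>V\<bar>" R]) (use V R in \<open>force simp: f_def indicator_def\<close>)+
  have gm: "g \<in> borel_measurable (lebesgue_on Q)" using g by (simp add: W1inf_def Linf_def)
  have wm: "w \<in> borel_measurable (lebesgue_on Q)"
    using Q(1) w by (intro continuous_imp_measurable_on_sets_lebesgue) auto
  have "\<forall>e\<in>Basis. \<exists>h C. has_weak_partial Q e g h \<and> (AE z in lebesgue_on Q. \<bar>h z\<bar> \<le> C)"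
    using g unfolding W1inf_def Linf_def by blast
  then obtain h C where h: "\<And>e. e \<in> Basis \<Longrightarrow> has_weak_partial Q e g (h e)"
    and C: "\<And>e. e \<in> Basis \<Longrightarrow> AE z in lebesgue_on Q. \<bar>h e z\<bar> \<le> C e" by metis
  define L where "L = (\<Sum>e\<in>(Basis :: 'b set). \<bar>C e\<bar>)"
  have L: "L \<ge> 0" by (simp add: L_def sum_nonneg)
  \<comment> \<open>The bump centred at \<open>z\<close> is an admissible test function, so the
    derivative of the mollification is the average of the weak derivative \<open>h e\<close> against
    a nonnegative kernel.\<close>
  have bound: "\<bar>mollify_deriv \<epsilon> e f z\<bar> \<le> \<bar>C e\<bar>" if \<epsilon>: "\<epsilon> > 0" and sub: "cball z \<epsilon> \<subseteq> Q" and e: "e \<in> Basis" for \<epsilon> e z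
  proof -
    let ?\<phi> = "\<lambda>z'. bump \<epsilon> (z' - z)"
    have bi: "integrable lborel ?\<phi>" using bump_integrable[OF \<epsilon>, of z] by (subst bump_commute)
    have "?\<phi> \<in> Cc_inf Q" by (rule bump_in_Cc_inf[OF \<epsilon> sub])
    then have "(\<integral>z'. g z' * bump_deriv \<epsilon> e (z' - z) \<partial>lebesgue_on Q) = - (\<integral>z'. h e z' * ?\<phi> z' \<partial>lebesgue_on Q)"
      using h[OF e] unfolding has_weak_partial_def by (auto simp: partial_deriv_bump)
    moreover have "(\<integral>z'. g z' * bump_deriv \<epsilon> e (z' - z) \<partial>lebesgue_on Q) = (\<integral>z'. w z' * bump_deriv \<epsilon> e (z' - z) \<partial>lebesgue_on Q)"
      using wg by (intro integral_cong_AE borel_measurable_times gm wm borel_imp_measurable_lebesgue_on) auto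
    moreover have "(\<integral>z'. w z' * bump_deriv \<epsilon> e (z' - z) \<partial>lebesgue_on Q) = (\<integral>z'. f z' * bump_deriv \<epsilon> e (z' - z) \<partial>lborel)"
    proof (subst integral_lebesgue_on_eq_lborel[OF Qb])
      have eq: "(\<lambda>z'. indicator Q z' * (w z' * bump_deriv \<epsilon> e (z' - z))) = (\<lambda>z'. f z' * bump_deriv \<epsilon> e (z' - z))"
        by (simp add: f_def fun_eq_iff)
      show "(\<lambda>z'. indicator Q z' * (w z' * bump_deriv \<epsilon> e (z' - z))) \<in> borel_measurable borel"
        unfolding eq by measurable
      show "(\<integral>z'. indicator Q z' * (w z' * bump_deriv \<epsilon> e (z' - z)) \<partial>lborel) = (\<integral>z'. f z' * bump_deriv \<epsilon> e (z' - z) \<partial>lborel)"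
        unfolding eq ..
    qed
    moreover have "(\<integral>z'. f z' * bump_deriv \<epsilon> e (z' - z) \<partial>lborel) = - (\<integral>z'. f z' * bump_deriv \<epsilon> e (z - z') \<partial>lborel)"
      by (subst bump_deriv_commute) simp
    ultimately have eq: "(\<integral>z'. f z' * bump_deriv \<epsilon> e (z - z') \<partial>lborel) = (\<integral>z'. h e z' * ?\<phi> z' \<partial>lebesgue_on Q)"
      by simp
    have bm: "(\<lambda>z'. indicator Q z' * (\<bar>C e\<bar> * ?\<phi> z')) \<in> borel_measurable borel"
      using Qb by measurable
    have i1: "integrable lborel (\<lambda>z'. indicator Q z' * (\<bar>C e\<bar> * ?\<phi> z'))"
      by (rule Bochner_Integration.integrable_bound[of _ "\<lambda>z'. \<bar>C e\<bar> * ?\<phi> z'"])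
         (use bi bm in \<open>auto simp: indicator_def\<close>)
    then have i2: "integrable (lebesgue_on Q) (\<lambda>z'. \<bar>C e\<bar> * ?\<phi> z')"
      using Qb bm by (subst integrable_restrict_space) (auto intro!: integrable_completion[THEN iffD2])
    have "\<bar>\<integral>z'. h e z' * ?\<phi> z' \<partial>lebesgue_on Q\<bar> \<le> (\<integral>z'. \<bar>h e z' * ?\<phi> z'\<bar> \<partial>lebesgue_on Q)"
      by (rule integral_abs_bound)
    also have "\<dots> \<le> (\<integral>z'. \<bar>C e\<bar> * ?\<phi> z' \<partial>lebesgue_on Q)"
    proof (rule integral_mono_AE'[OF i2])
      show "AE z' in lebesgue_on Q. \<bar>h e z' * ?\<phi> z'\<bar> \<le> \<bar>C e\<bar> * ?\<phi> z'"
        using C[OF e]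
      proof eventually_elim
        case (elim z')
        then have "\<bar>h e z'\<bar> \<le> \<bar>C e\<bar>" by linarith
        then show ?case using bump_nonneg[of \<epsilon> "z' - z"] by (simp add: abs_mult mult_right_mono)
      qed
    qed (simp add: bump_nonneg)
    also have "\<dots> = (\<integral>z'. indicator Q z' * (\<bar>C e\<bar> * ?\<phi> z') \<partial>lborel)"
      by (rule integral_lebesgue_on_eq_lborel[OF Qb bm])
    also have "\<dots> \<le> (\<integral>z'. \<bar>C e\<bar> * ?\<phi> z' \<partial>lborel)"
      using i1 bi by (intro integral_mono) (auto simp: indicator_def bump_nonneg)
    also have "\<dots> = \<bar>C e\<bar> * bump_mass TYPE('b) \<epsilon>"
    proof -
      have "(\<integral>z'. ?\<phi> z' \<partial>lborel) = bump_mass TYPE('b) \<epsilon>"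
        using integral_bump[of \<epsilon> z] by (subst bump_commute)
      then show ?thesis by simp
    qed
    finally show ?thesis
      using bump_mass_pos[OF \<epsilon>, where ?'b = 'b]
      by (simp add: mollify_deriv_def eq abs_divide divide_le_eq)
  qed
  have "\<bar>w z - w z'\<bar> \<le> L * dist z z'" if seg: "closed_segment z z' \<subseteq> Q" for z z'
  proof (rule field_le_epsilon)
    fix \<eta> :: real assume \<eta>: "\<eta> > 0"
    have inQ: "z \<in> Q" "z' \<in> Q" using seg by auto
    have fw: "isCont f y" "f y = w y" if "y \<in> Q" for y
    proof -
      have "isCont w y" using w Q(1) that by (simp add: continuous_on_eq_continuous_at)
      moreover have "\<forall>\<^sub>F x in nhds y. f x = w x"
        using Q(1) that by (auto simp: eventually_nhds f_def intro!: exI[of _ Q])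
      ultimately show "isCont f y" by (simp add: isCont_cong)
      show "f y = w y" using that by (simp add: f_def)
    qed
    \<comment> \<open>The segment is compact, so a single radius keeps the balls around all its
      points inside \<open>Q\<close>.\<close>
    obtain e0 where e0: "e0 > 0" "(\<Union>x\<in>closed_segment z z'. cball x e0) \<subseteq> Q"
      using compact_subset_open_imp_cball_epsilon_subset[OF compact_segment Q(1) seg] by blast
    obtain e1 where e1: "e1 > 0" "\<And>\<epsilon>. 0 < \<epsilon> \<Longrightarrow> \<epsilon> \<le> e1 \<Longrightarrow> \<bar>mollify \<epsilon> f z - f z\<bar> \<le> \<eta> / 2"
      using mollify_tendsto[OF f fw(1)[OF inQ(1)], of "\<eta> / 2"] \<eta> by auto
    obtain e2 where e2: "e2 > 0" "\<And>\<epsilon>. 0 < \<epsilon> \<Longrightarrow> \<epsilon> \<le> e2 \<Longrightarrow> \<bar>mollify \<epsilon> f z' - f z'\<bar> \<le> \<eta> / 2"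
      using mollify_tendsto[OF f fw(1)[OF inQ(2)], of "\<eta> / 2"] \<eta> by auto
    define \<epsilon> where "\<epsilon> = min e0 (min e1 e2)"
    have \<epsilon>: "\<epsilon> > 0" "\<epsilon> \<le> e0" "\<epsilon> \<le> e1" "\<epsilon> \<le> e2" using e0 e1 e2 by (auto simp: \<epsilon>_def)
    define d where "d = z' - z"
    have der: "\<bar>mollify_deriv \<epsilon> d f (z + s *\<^sub>R d)\<bar> \<le> L * norm d" if s: "s \<in> {0..1}" for s
    proof -
      have "z + s *\<^sub>R d \<in> closed_segment z z'"
        using s by (auto simp: in_segment d_def algebra_simps intro!: exI[of _ s])
      then have "cball (z + s *\<^sub>R d) \<epsilon> \<subseteq> Q" using e0(2) \<epsilon>(2) by force
      then have b: "e \<in> Basis \<Longrightarrow> \<bar>mollify_deriv \<epsilon> e f (z + s *\<^sub>R d)\<bar> \<le> \<bar>C e\<bar>" for e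
        using bound[OF \<epsilon>(1)] by blast
      have "\<bar>mollify_deriv \<epsilon> d f (z + s *\<^sub>R d)\<bar> \<le> (\<Sum>e\<in>Basis. \<bar>(d \<bullet> e) * mollify_deriv \<epsilon> e f (z + s *\<^sub>R d)\<bar>)"
        unfolding mollify_deriv_Basis[OF f \<epsilon>(1), of d] by (rule sum_abs)
      also have "\<dots> \<le> (\<Sum>e\<in>Basis. norm d * \<bar>C e\<bar>)"
        unfolding abs_mult using b by (intro sum_mono mult_mono Basis_le_norm) auto
      finally show ?thesis by (simp add: L_def sum_distrib_left mult.commute)
    qed
    have "norm (mollify \<epsilon> f (z + 1 *\<^sub>R d) - mollify \<epsilon> f (z + 0 *\<^sub>R d)) \<le> (L * norm d) * norm (1 - 0 :: real)"
      by (rule field_differentiable_bound[of "{0..1}" "\<lambda>s. mollify \<epsilon> f (z + s *\<^sub>R d)" "\<lambda>s. mollify_deriv \<epsilon> d f (z + s *\<^sub>R d)"])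
         (use mollify_line_derivative[OF f \<epsilon>(1)] der in \<open>auto intro: has_field_derivative_at_within\<close>)
    then have "\<bar>mollify \<epsilon> f z' - mollify \<epsilon> f z\<bar> \<le> L * dist z z'"
      by (simp add: d_def dist_norm norm_minus_commute)
    then show "\<bar>w z - w z'\<bar> \<le> L * dist z z' + \<eta>"
      using e1(2)[OF \<epsilon>(1,3)] e2(2)[OF \<epsilon>(1,4)] fw(2)[OF inQ(1)] fw(2)[OF inQ(2)] by linarith
  qed
  with L show thesis by (rule that)
qed

subsection \<open>The skeleton of a polyhedral set\<close>

text \<open>Gram-Schmidt: \<open>e\<close> is the component of \<open>a'\<close> orthogonal to
  \<open>a\<close>, rescaled. For a = 0 the quotient is 0 by convention and the component is
  \<open>a'\<close> itself.\<close>

lemma dual_vector_exists: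
  fixes a a' :: "'b::euclidean_space"
  assumes "\<And>c. a' \<noteq> c *\<^sub>R a"
  obtains e where "a \<bullet> e = 0" "a' \<bullet> e = 1"
proof -
  define d where "d = a' - ((a \<bullet> a') / (a \<bullet> a)) *\<^sub>R a"
  have ad: "a \<bullet> d = 0"
    by (cases "a = 0") (auto simp: d_def inner_diff_right)
  have "d \<noteq> 0" using assms by (auto simp: d_def)
  then have dd: "d \<bullet> d > 0" by simp
  have "a' = d + ((a \<bullet> a') / (a \<bullet> a)) *\<^sub>R a" by (simp add: d_def)
  then have "a' \<bullet> d = d \<bullet> d"
    by (metis ad add.right_neutral inner_add_left inner_scaleR_left mult_zero_right)
  then show thesis
    using that[of "d /\<^sub>R (d \<bullet> d)"] ad dd by simp
qed

text \<open>Translates of the set along two dual directions are disjoint and about \<open>1 / \<delta>\<^sup>2\<close> of them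
  fit into a fixed ball.\<close>

lemma measure_two_strips:
  fixes a a' :: "'b::euclidean_space"
  assumes "a \<noteq> 0" and ind: "\<And>c. a' \<noteq> c *\<^sub>R a"
  obtains C where "\<And>\<delta>. 0 < \<delta> \<Longrightarrow> \<delta> \<le> 1 \<Longrightarrow>
    measure lebesgue (cball 0 R \<inter> {z. \<bar>a \<bullet> z - b\<bar> \<le> norm a * \<delta> \<and> \<bar>a' \<bullet> z - b'\<bar> \<le> norm a' * \<delta>}) \<le> C * \<delta>\<^sup>2"
proof -
  have "a' \<noteq> 0" using ind[of 0] by simp
  have ind': "a \<noteq> c *\<^sub>R a'" for c
  proof
    assume "a = c *\<^sub>R a'"
    moreover then have "c \<noteq> 0" using assms(1) by auto
    ultimately have "a' = inverse c *\<^sub>R a" by simp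
    then show False using ind by blast
  qed
  obtain f2 where f2: "a \<bullet> f2 = 0" "a' \<bullet> f2 = 1" using dual_vector_exists[OF ind] .
  obtain f1 where f1: "a' \<bullet> f1 = 0" "a \<bullet> f1 = 1" using dual_vector_exists[OF ind'] .
  \<comment> \<open>A strip has width \<open>2 * norm a * \<delta>\<close> in the variable
    \<open>a \<bullet> z\<close>, and a shift by \<delta> e1 changes that variable by
    \<open>3 * norm a * \<delta>\<close>, leaving a gap. Duality keeps the other strip variable
    fixed.\<close>
  define e1 where "e1 = (3 * norm a) *\<^sub>R f1"
  define e2 where "e2 = (3 * norm a') *\<^sub>R f2"
  have e: "a \<bullet> e1 = 3 * norm a" "a' \<bullet> e1 = 0" "a \<bullet> e2 = 0" "a' \<bullet> e2 = 3 * norm a'"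
    using f1 f2 by (auto simp: e1_def e2_def)
  define R' where "R' = R + 2 * (norm e1 + norm e2)"
  let ?C = "measure lebesgue (cball (0::'b) R')"
  show thesis
  proof (rule that)
    fix \<delta> :: real assume \<delta>: "0 < \<delta>" "\<delta> \<le> 1"
    let ?A = "cball 0 R \<inter> {z. \<bar>a \<bullet> z - b\<bar> \<le> norm a * \<delta> \<and> \<bar>a' \<bullet> z - b'\<bar> \<le> norm a' * \<delta>}"
    have "closed ({z. \<bar>a \<bullet> z - b\<bar> \<le> norm a * \<delta>} \<inter> {z. \<bar>a' \<bullet> z - b'\<bar> \<le> norm a' * \<delta>})"
      by (intro closed_Int closed_Collect_le continuous_intros)
    moreover have "?A = cball 0 R \<inter> ({z. \<bar>a \<bullet> z - b\<bar> \<le> norm a * \<delta>} \<inter> {z. \<bar>a' \<bullet> z - b'\<bar> \<le> norm a' * \<delta>})"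
      by auto
    ultimately have "compact ?A" by (simp add: compact_Int_closed)
    then have Am: "?A \<in> lmeasurable" by (rule lmeasurable_compact)
    \<comment> \<open>Large enough for N^2 translates to yield the factor 1 / \<delta>^2, yet
      \<delta> N \<le> 2 keeps every shift below \<open>2 * (norm e1 + norm e2)\<close>, whence the
      radius \<open>R'\<close>.\<close>
    define N where "N = nat \<lceil>1 / \<delta>\<rceil>"
    have N: "real N \<ge> 1 / \<delta>" by (simp add: N_def real_nat_ceiling_ge)
    have "real N \<le> 1 / \<delta> + 1"
      using \<delta> by (simp add: N_def)
    then have N2: "\<delta> * real N \<le> 2" using \<delta> by (simp add: field_simps)
    define c where "c = (\<lambda>(k::nat, l::nat). (\<delta> * real k) *\<^sub>R e1 + (\<delta> * real l) *\<^sub>R e2)"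
    define B where "B p = (+) (c p) ` ?A" for p
    define I where "I = {..<N} \<times> {..<N}"
    have Bm: "B p \<in> lmeasurable" for p unfolding B_def using Am by (rule measurable_translation)
    have mB: "measure lebesgue (B p) = measure lebesgue ?A" for p
      unfolding B_def by (rule measure_translation)
    have key: "k = k'" if "\<bar>x - n * (\<delta> * 3 * real k)\<bar> \<le> n * \<delta>" "\<bar>x - n * (\<delta> * 3 * real k')\<bar> \<le> n * \<delta>" "n > 0"
      for x n :: real and k k' :: nat
    proof -
      have "\<bar>n * (\<delta> * 3 * real k) - n * (\<delta> * 3 * real k')\<bar> \<le> 2 * (n * \<delta>)" using that by linarith
      moreover have "n * (\<delta> * 3 * real k) - n * (\<delta> * 3 * real k') = (n * \<delta>) * (3 * (real k - real k'))"
        by (simp add: algebra_simps)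
      ultimately have "(n * \<delta>) * \<bar>3 * (real k - real k')\<bar> \<le> (n * \<delta>) * 2"
        using that(3) \<delta> by (simp add: abs_mult)
      then have "\<bar>3 * (real k - real k')\<bar> \<le> 2" using that(3) \<delta> by simp
      then have "3 * \<bar>real k - real k'\<bar> \<le> 2" by (simp only: abs_mult)
      moreover have "3 * w \<le> 2 \<Longrightarrow> w < 1" for w :: real by linarith
      ultimately have b: "\<bar>real k - real k'\<bar> < 1" by blast
      show "k = k'"
      proof (rule ccontr)
        assume "k \<noteq> k'"
        then have "k + 1 \<le> k' \<or> k' + 1 \<le> k" by linarith
        then have "real (k + 1) \<le> real k' \<or> real (k' + 1) \<le> real k" by (simp only: of_nat_le_iff)
        then show False using b by auto
      qed
    qed
    have disj: "pairwise (\<lambda>p q. disjnt (B p) (B q)) I"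
    proof (intro pairwiseI)
      fix p q :: "nat \<times> nat" assume "p \<noteq> q"
      obtain k l k' l' where pq: "p = (k, l)" "q = (k', l')" by (cases p, cases q) auto
      show "disjnt (B p) (B q)"
      proof (rule ccontr)
        assume "\<not> disjnt (B p) (B q)"
        then obtain z where z: "z \<in> B p" "z \<in> B q" by (auto simp: disjnt_def)
        have "\<bar>(a \<bullet> z - b) - norm a * (\<delta> * 3 * real k)\<bar> \<le> norm a * \<delta>"
            "\<bar>(a' \<bullet> z - b') - norm a' * (\<delta> * 3 * real l)\<bar> \<le> norm a' * \<delta>"
          if "z \<in> B (k, l)" for k l
          using that by (auto simp: B_def c_def inner_add_right e algebra_simps)
        note this[of k l] this[of k' l']
        with z have "k = k'" "l = l'" using key assms(1) \<open>a' \<noteq> 0\<close> unfolding pq by (metis zero_less_norm_iff)+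
        then show False using \<open>p \<noteq> q\<close> pq by simp
      qed
    qed
    have sub: "(\<Union>p\<in>I. B p) \<subseteq> cball 0 R'"
    proof (intro UN_least subsetI)
      fix p z assume "p \<in> I" "z \<in> B p"
      then obtain k l w where p: "p = (k, l)" "k < N" "l < N" and w: "w \<in> ?A" "z = c p + w"
        by (auto simp: I_def B_def)
      have le2: "\<delta> * real j \<le> 2" if "j < N" for j
        using that N2 \<delta> by (smt (verit, best) mult_left_mono of_nat_less_iff)
      have "norm z \<le> norm (c p) + norm w" using w(2) norm_triangle_ineq by blast
      also have "norm (c p) \<le> norm ((\<delta> * real k) *\<^sub>R e1) + norm ((\<delta> * real l) *\<^sub>R e2)"
        unfolding c_def p(1) prod.case by (rule norm_triangle_ineq)
      also have "\<dots> \<le> 2 * norm e1 + 2 * norm e2"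
        using le2[OF p(2)] le2[OF p(3)] \<delta> by (auto intro!: add_mono mult_right_mono)
      finally show "z \<in> cball 0 R'" using w(1) by (simp add: R'_def)
    qed
    have "real N * real N * measure lebesgue ?A = (\<Sum>p\<in>I. measure lebesgue (B p))"
      by (simp add: mB I_def)
    also have "\<dots> = measure lebesgue (\<Union>p\<in>I. B p)"
      by (rule measure_UNION'[symmetric]) (use Bm disj in \<open>auto simp: I_def\<close>)
    also have "\<dots> \<le> ?C"
      using sub Bm by (intro measure_mono_fmeasurable) (auto simp: I_def intro!: fmeasurableD)
    finally have NN: "real N * real N * measure lebesgue ?A \<le> ?C" .
    have "(1 / \<delta>) * (1 / \<delta>) * measure lebesgue ?A \<le> real N * real N * measure lebesgue ?A"
      using N \<delta> by (intro mult_right_mono mult_mono) auto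
    with NN have "(1 / \<delta>) * (1 / \<delta>) * measure lebesgue ?A \<le> ?C" by linarith
    then show "measure lebesgue ?A \<le> ?C * \<delta>\<^sup>2"
      using \<delta> by (simp add: field_simps power2_eq_square)
  qed
qed

text \<open>Where at most one hyperplane direction passes through \<open>x\<close>, membership in the polyhedron
  depends near \<open>x\<close> only on the side of that hyperplane.\<close>

lemma interior_one_hyperplane_convex:
  fixes X :: "'a::euclidean_space set"
  assumes "closed X" "a \<noteq> 0"
    and sides: "\<And>y y'. y \<in> ball x r \<Longrightarrow> y' \<in> ball x r \<Longrightarrow> sgn (a \<bullet> y - b) = sgn (a \<bullet> y' - b) \<Longrightarrow> y \<in> X \<Longrightarrow> y' \<in> X"
  shows "convex (interior X \<inter> ball x r)"
proof -
  define pos where "pos \<longleftrightarrow> (\<exists>y\<in>ball x r. y \<in> X \<and> a \<bullet> y > b)"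
  define neg where "neg \<longleftrightarrow> (\<exists>y\<in>ball x r. y \<in> X \<and> a \<bullet> y < b)"
  have step: "\<exists>d>0. y + d *\<^sub>R e \<in> U" if "open U" "y \<in> U" for y e and U :: "'a set"
  proof -
    have "((\<lambda>d. y + d *\<^sub>R e) \<longlongrightarrow> y + 0 *\<^sub>R e) (at_right 0)" by (intro tendsto_intros)
    then have "\<forall>\<^sub>F d in at_right 0. y + d *\<^sub>R e \<in> U"
      using that by (auto intro: topological_tendstoD)
    then obtain d0 where "d0 > 0" "\<And>d. 0 < d \<Longrightarrow> d < d0 \<Longrightarrow> y + d *\<^sub>R e \<in> U"
      by (auto simp: eventually_at_right_field)
    then show ?thesis by (metis field_lbound_gt_zero)
  qed
  have aa: "a \<bullet> a > 0" using assms(2) by simp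
  have oi: "open (interior X \<inter> ball x r)" by (intro open_Int open_interior open_ball)
  \<comment> \<open>An interior point that is not strictly on the positive side can be pushed along
    -a to the strictly negative side without leaving the set, which then meets that side.\<close>
  have A: "a \<bullet> y > b" if n: "\<not> neg" and y: "y \<in> interior X \<inter> ball x r" for y
  proof (rule ccontr)
    assume "\<not> a \<bullet> y > b"
    obtain d where d: "d > 0" "y + d *\<^sub>R (- a) \<in> interior X \<inter> ball x r"
      using step[OF oi y, of "- a"] by blast
    have "d * (a \<bullet> a) > 0" using d aa by simp
    then have "a \<bullet> (y + d *\<^sub>R (- a)) < b"
      using \<open>\<not> a \<bullet> y > b\<close> by (simp add: inner_diff_right)
    then show False using n d interior_subset unfolding neg_def by blast
  qed
  have B: "a \<bullet> y < b" if n: "\<not> pos" and y: "y \<in> interior X \<inter> ball x r" for y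
  proof (rule ccontr)
    assume "\<not> a \<bullet> y < b"
    obtain d where d: "d > 0" "y + d *\<^sub>R a \<in> interior X \<inter> ball x r"
      using step[OF oi y, of a] by blast
    have "d * (a \<bullet> a) > 0" using d aa by simp
    then have "a \<bullet> (y + d *\<^sub>R a) > b"
      using \<open>\<not> a \<bullet> y < b\<close> by (simp add: inner_add_right)
    then show False using n d interior_subset unfolding pos_def by blast
  qed
  have C: "{y. a \<bullet> y > b} \<inter> ball x r \<subseteq> interior X" if pos
  proof (rule interior_maximal)
    show "{y. a \<bullet> y > b} \<inter> ball x r \<subseteq> X"
    proof
      fix y assume y: "y \<in> {y. a \<bullet> y > b} \<inter> ball x r"
      from that obtain y0 where "y0 \<in> ball x r" "y0 \<in> X" "a \<bullet> y0 > b" unfolding pos_def by blast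
      then show "y \<in> X" using y by (intro sides[of y0 y]) auto
    qed
    show "open ({y. a \<bullet> y > b} \<inter> ball x r)" by (intro open_Int open_halfspace_gt open_ball)
  qed
  have D: "{y. a \<bullet> y < b} \<inter> ball x r \<subseteq> interior X" if neg
  proof (rule interior_maximal)
    show "{y. a \<bullet> y < b} \<inter> ball x r \<subseteq> X"
    proof
      fix y assume y: "y \<in> {y. a \<bullet> y < b} \<inter> ball x r"
      from that obtain y0 where "y0 \<in> ball x r" "y0 \<in> X" "a \<bullet> y0 < b" unfolding neg_def by blast
      then show "y \<in> X" using y by (intro sides[of y0 y]) auto
    qed
    show "open ({y. a \<bullet> y < b} \<inter> ball x r)" by (intro open_Int open_halfspace_lt open_ball)
  qed
  consider "pos" "neg" | "pos" "\<not> neg" | "\<not> pos" "neg" | "\<not> pos" "\<not> neg" by blast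
  then show ?thesis
  proof cases
    \<comment> \<open>Both open sides belong to \<open>X\<close>; closedness adds the hyperplane
      between them, so the whole ball is interior. A slit cannot occur.\<close>
    case 1
    have "y \<in> X" if y: "y \<in> ball x r" for y
    proof (cases "a \<bullet> y = b")
      case True
      show ?thesis
      proof (rule ccontr)
        assume "y \<notin> X"
        then have "open (- X \<inter> ball x r)" "y \<in> - X \<inter> ball x r" using assms(1) y by (auto simp: closed_def)
        from step[OF this, of a] obtain d where d: "d > 0" "y + d *\<^sub>R a \<in> - X \<inter> ball x r" by blast
        have "d * (a \<bullet> a) > 0" using d aa by simp
        then have "a \<bullet> (y + d *\<^sub>R a) > b" using True by (simp add: inner_add_right)
        then show False using C[OF 1(1)] d interior_subset by blast
      qed
    next
      case False
      then show ?thesis using C[OF 1(1)] D[OF 1(2)] y interior_subset by force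
    qed
    then have "ball x r \<subseteq> interior X" by (intro interior_maximal) auto
    then have "interior X \<inter> ball x r = ball x r" by blast
    then show ?thesis by simp
  next
    case 2
    then have "interior X \<inter> ball x r = {y. a \<bullet> y > b} \<inter> ball x r" using A C by blast
    then show ?thesis by (simp add: convex_Int convex_halfspace_gt)
  next
    case 3
    then have "interior X \<inter> ball x r = {y. a \<bullet> y < b} \<inter> ball x r" using B D by blast
    then show ?thesis by (simp add: convex_Int convex_halfspace_lt)
  next
    case 4
    then have "interior X \<inter> ball x r = {}" using A B by fastforce
    then show ?thesis by simp
  qed
qed

text \<open>Membership in a finite union of polytopes is a Boolean combination of finitely many
  linear inequalities, so it is determined by their truth values. No shape of the union beyond this
  is kept.\<close>

lemma polyhedral_hyperplanes:
  fixes \<Omega> :: "'a::euclidean_space set"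
  assumes "polyhedral \<Omega>"
  obtains X and H :: "('a \<times> real) set" where "closed X" "\<Omega> = interior X" "finite H"
    "\<And>a b. (a, b) \<in> H \<Longrightarrow> a \<noteq> 0"
    "\<And>y y'. y \<in> X \<Longrightarrow> (\<And>a b. (a, b) \<in> H \<Longrightarrow> a \<bullet> y \<le> b \<longleftrightarrow> a \<bullet> y' \<le> b) \<Longrightarrow> y' \<in> X"
proof -
  obtain P where P: "finite P" "\<forall>p\<in>P. polytope p" "\<Omega> = interior (\<Union>P)"
    using assms unfolding polyhedral_def by blast
  have "\<exists>h. finite h \<and> (\<forall>(a,b)\<in>h. a \<noteq> 0) \<and> p = {x. \<forall>(a,b)\<in>h. a \<bullet> x \<le> b}" if "p \<in> P" for p
  proof -
    have "polyhedron p" using P(2) that polytope_imp_polyhedron by blast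
    then obtain F where F: "finite F" "p = \<Inter>F" "\<forall>h\<in>F. \<exists>a b. a \<noteq> 0 \<and> h = {x. a \<bullet> x \<le> b}"
      unfolding polyhedron_def by blast
    then obtain A B where AB: "\<forall>h\<in>F. A h \<noteq> 0 \<and> h = {x. A h \<bullet> x \<le> B h}" by metis
    show ?thesis
    proof (intro exI[of _ "(\<lambda>h. (A h, B h)) ` F"] conjI)
      have "x \<in> h \<longleftrightarrow> A h \<bullet> x \<le> B h" if "h \<in> F" for h x using AB that by blast
      then show "p = {x. \<forall>(a, b)\<in>(\<lambda>h. (A h, B h)) ` F. a \<bullet> x \<le> b}"
        unfolding F(2) by auto
    qed (use F(1) AB in auto)
  qed
  then have "\<forall>p\<in>P. \<exists>h. finite h \<and> (\<forall>(a,b)\<in>h. a \<noteq> 0) \<and> p = {x. \<forall>(a,b)\<in>h. a \<bullet> x \<le> b}" by blast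
  from bchoice[OF this] obtain h where h: "\<forall>p\<in>P. finite (h p) \<and> (\<forall>(a,b)\<in>h p. a \<noteq> 0) \<and> p = {x. \<forall>(a,b)\<in>h p. a \<bullet> x \<le> b}" ..
  show thesis
  proof (rule that[of "\<Union>P" "\<Union>(h ` P)"])
    show "closed (\<Union>P)" using P polytope_imp_closed by (intro closed_Union) auto
    show "\<Omega> = interior (\<Union>P)" by fact
    show "finite (\<Union>(h ` P))" using P h by auto
    show "a \<noteq> 0" if "(a, b) \<in> \<Union>(h ` P)" for a b using that h by blast
    fix y y' assume y: "y \<in> \<Union>P" and eq: "\<And>a b. (a, b) \<in> \<Union>(h ` P) \<Longrightarrow> a \<bullet> y \<le> b \<longleftrightarrow> a \<bullet> y' \<le> b"
    from y obtain p where p: "p \<in> P" "y \<in> p" by blast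
    have px: "x \<in> p \<longleftrightarrow> (\<forall>(a,b)\<in>h p. a \<bullet> x \<le> b)" for x using h p(1) by blast
    have "y' \<in> p" using p(2) eq p(1) unfolding px by fastforce
    then show "y' \<in> \<Union>P" using p(1) by blast
  qed
qed

text \<open>The function \<open>s\<close> is the distance to a set of codimension two, which
  explains both the Lipschitz constant 1 and the quadratic measure bound. Positive distance leaves
  at most one hyperplane through a point, up to multiples.\<close>

lemma polyhedral_skeleton:
  fixes \<Omega> :: "'a::euclidean_space set"
  assumes "polyhedral \<Omega>" "bounded \<Omega>"
  obtains s :: "'a \<Rightarrow> real" and C :: real where
    "\<And>x y. \<bar>s x - s y\<bar> \<le> dist x y"
    "\<And>x. s x > 0 \<Longrightarrow> \<exists>r>0. convex (\<Omega> \<inter> ball x r)"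
    "\<And>\<delta>. 0 < \<delta> \<Longrightarrow> \<delta> \<le> 1 \<Longrightarrow> measure lebesgue {z \<in> cylinder \<Omega> T. s (fst z) \<le> \<delta>} \<le> C * \<delta>\<^sup>2"
proof -
  obtain X and H :: "('a \<times> real) set" where X: "closed X" "\<Omega> = interior X" and H: "finite H"
    "\<And>a b. (a, b) \<in> H \<Longrightarrow> a \<noteq> 0"
    and XH: "\<And>y y'. y \<in> X \<Longrightarrow> (\<And>a b. (a, b) \<in> H \<Longrightarrow> a \<bullet> y \<le> b \<longleftrightarrow> a \<bullet> y' \<le> b) \<Longrightarrow> y' \<in> X"
    using polyhedral_hyperplanes[OF assms(1)] by metis
  \<comment> \<open>Only pairs with non-parallel normals: parallel hyperplanes either coincide or do
    not meet, and neither case produces a singular point.\<close>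
  define J where "J = {(p, q) \<in> H \<times> H. \<forall>c. fst q \<noteq> c *\<^sub>R fst p}"
  have J: "finite J" using finite_subset[of J "H \<times> H"] H(1) by (auto simp: J_def)
  define L where "L = (\<lambda>(p, q). {x. fst p \<bullet> x = snd p} \<inter> {x. fst q \<bullet> x = (snd q :: real)} :: 'a set)"
  define S where "S = (\<Union>j\<in>J. L j)"
  have S: "closed S"
    unfolding S_def L_def using J by (intro closed_UN) (auto intro!: closed_Int closed_hyperplane)
  have loc: "\<exists>r>0. convex (\<Omega> \<inter> ball x r)" if x: "x \<notin> S" for x
  proof -
    have "\<exists>a b. a \<noteq> 0 \<and> (\<forall>(a', b')\<in>H. a' \<bullet> x = b' \<longrightarrow> (\<exists>c. a' = c *\<^sub>R a \<and> b' = c * b))"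
    proof (cases "\<exists>(a0, b0)\<in>H. a0 \<bullet> x = b0")
      case True
      then obtain a0 b0 where ab: "(a0, b0) \<in> H" "a0 \<bullet> x = b0" by blast
      have "\<exists>c. a' = c *\<^sub>R a0 \<and> b' = c * b0" if "(a', b') \<in> H" "a' \<bullet> x = b'" for a' b'
      proof -
        have "\<exists>c. a' = c *\<^sub>R a0"
        proof (rule ccontr)
          assume "\<nexists>c. a' = c *\<^sub>R a0"
          then have "((a0, b0), (a', b')) \<in> J" using ab that by (auto simp: J_def)
          moreover have "x \<in> L ((a0, b0), (a', b'))" using ab that by (simp add: L_def)
          ultimately show False using x unfolding S_def by blast
        qed
        then show ?thesis using ab that by auto
      qed
      then show ?thesis using ab(1) H(2) by (intro exI[of _ a0] exI[of _ b0]) auto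
    next
      case False
      \<comment> \<open>No hyperplane passes through \<open>x\<close>, so the condition on
        \<open>a\<close> and \<open>b\<close> is vacuous and any nonzero direction serves.\<close>
      obtain e :: 'a where "e \<in> Basis" using nonempty_Basis by blast
      then have "e \<noteq> 0" by auto
      then show ?thesis using False by (intro exI[of _ e] exI[of _ 0]) auto
    qed
    then obtain a b where a: "a \<noteq> 0"
      and par: "\<forall>(a', b')\<in>H. a' \<bullet> x = b' \<longrightarrow> (\<exists>c. a' = c *\<^sub>R a \<and> b' = c * b)" by blast
    \<comment> \<open>Hyperplanes that miss \<open>x\<close> keep their sign nearby, uniformly as
      there are finitely many. Those through \<open>x\<close> are multiples of
      \<open>(a, b)\<close>, so their sign follows that of \<open>a \<bullet> y - b\<close>.\<close>
    have "\<forall>\<^sub>F y in nhds x. \<forall>p\<in>H. fst p \<bullet> x \<noteq> snd p \<longrightarrow> sgn (fst p \<bullet> y - snd p) = sgn (fst p \<bullet> x - snd p)"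
    proof (rule eventually_ball_finite[OF H(1)], intro ballI)
      fix p
      have lim: "((\<lambda>y. fst p \<bullet> y - snd p) \<longlongrightarrow> fst p \<bullet> x - snd p) (nhds x)"
        by (intro tendsto_intros filterlim_ident)
      consider "fst p \<bullet> x - snd p > 0" | "fst p \<bullet> x - snd p < 0" | "fst p \<bullet> x = snd p" by linarith
      then show "\<forall>\<^sub>F y in nhds x. fst p \<bullet> x \<noteq> snd p \<longrightarrow> sgn (fst p \<bullet> y - snd p) = sgn (fst p \<bullet> x - snd p)"
      proof cases
        case 1
        from order_tendstoD(1)[OF lim this] show ?thesis by eventually_elim (use 1 in auto)
      next
        case 2
        from order_tendstoD(2)[OF lim this] show ?thesis by eventually_elim (use 2 in auto)
      qed simp
    qed
    then obtain r where r: "r > 0" "\<And>y p. dist y x < r \<Longrightarrow> p \<in> H \<Longrightarrow> fst p \<bullet> x \<noteq> snd p \<Longrightarrow>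
        sgn (fst p \<bullet> y - snd p) = sgn (fst p \<bullet> x - snd p)"
      unfolding eventually_nhds_metric by blast
    have "convex (interior X \<inter> ball x r)"
    proof (rule interior_one_hyperplane_convex[OF X(1) a])
      fix y y' assume y: "y \<in> ball x r" "y' \<in> ball x r" "sgn (a \<bullet> y - b) = sgn (a \<bullet> y' - b)" "y \<in> X"
      show "y' \<in> X"
      proof (rule XH[OF y(4)])
        fix a' b' assume h: "(a', b') \<in> H"
        have "sgn (a' \<bullet> y - b') = sgn (a' \<bullet> y' - b')"
        proof (cases "a' \<bullet> x = b'")
          case True
          with par h obtain c where c: "a' = c *\<^sub>R a" "b' = c * b" by blast
          have "a' \<bullet> w - b' = c * (a \<bullet> w - b)" for w by (simp add: c algebra_simps)
          then show ?thesis using y(3) by (simp add: sgn_mult)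
        next
          case False
          then show ?thesis using r(2)[of y "(a', b')"] r(2)[of y' "(a', b')"] h y by (simp add: dist_commute)
        qed
        moreover have "(u \<le> 0) = (sgn u \<noteq> 1)" for u :: real by (simp add: sgn_if)
        ultimately show "a' \<bullet> y \<le> b' \<longleftrightarrow> a' \<bullet> y' \<le> b'"
          by (metis diff_le_0_iff_le)
      qed
    qed
    then show ?thesis using r(1) X(2) by blast
  qed
  show thesis
  proof (cases "S = {}")
    case True
    \<comment> \<open>The distance to the empty set is 0 by convention, which would fail the measure
      bound. The constant 2 exceeds every admissible \<delta>, so the sets to be measured are
      empty.\<close>
    show thesis
      by (rule that[of "\<lambda>_. 2" 0]) (use loc True in auto)
  next
    case False
    obtain R where R: "\<And>z. z \<in> cylinder \<Omega> T \<Longrightarrow> norm z \<le> R"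
    proof -
      have "bounded (cylinder \<Omega> T)" unfolding cylinder_def
        using bounded_box[of 0 T] by (intro bounded_Times assms) simp
      then show thesis using that by (auto simp: bounded_iff)
    qed
    \<comment> \<open>Normals are extended by a zero time component: they stay independent in
      space-time, and being close to the skeleton in space becomes a condition on two strips
      there.\<close>
    define E where "E \<delta> j = (case j of ((a, b), (a', b')) \<Rightarrow> cball (0::'a\<times>real) R \<inter>
       {z. \<bar>(a, 0) \<bullet> z - b\<bar> \<le> norm (a, 0::real) * \<delta> \<and> \<bar>(a', 0) \<bullet> z - b'\<bar> \<le> norm (a', 0::real) * \<delta>})" for \<delta> j
    have "\<exists>C. \<forall>\<delta>. 0 < \<delta> \<longrightarrow> \<delta> \<le> 1 \<longrightarrow> measure lebesgue (E \<delta> j) \<le> C * \<delta>\<^sup>2" if j: "j \<in> J" for j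
    proof -
      obtain a b a' b' where jj: "j = ((a, b), (a', b'))" by (metis surj_pair)
      have 1: "(a, 0::real) \<noteq> 0" using j H(2) by (auto simp: J_def jj zero_prod_def)
      have 2: "(a', 0::real) \<noteq> c *\<^sub>R (a, 0)" for c using j by (auto simp: J_def jj)
      obtain C where "\<And>\<delta>. 0 < \<delta> \<Longrightarrow> \<delta> \<le> 1 \<Longrightarrow> measure lebesgue (E \<delta> j) \<le> C * \<delta>\<^sup>2"
        unfolding E_def jj prod.case using measure_two_strips[OF 1 2] by blast
      then show ?thesis by blast
    qed
    then obtain Cj where Cj: "\<And>j \<delta>. j \<in> J \<Longrightarrow> 0 < \<delta> \<Longrightarrow> \<delta> \<le> 1 \<Longrightarrow> measure lebesgue (E \<delta> j) \<le> Cj j * \<delta>\<^sup>2"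
      by metis
    have Em: "E \<delta> j \<in> lmeasurable" for \<delta> j
    proof -
      obtain a b a' b' where jj: "j = ((a, b), (a', b'))" by (metis surj_pair)
      have "closed ({z. \<bar>(a, 0) \<bullet> z - b\<bar> \<le> norm (a, 0::real) * \<delta>} \<inter> {z. \<bar>(a', 0) \<bullet> z - b'\<bar> \<le> norm (a', 0::real) * \<delta>})"
        by (intro closed_Int closed_Collect_le continuous_intros)
      moreover have "E \<delta> j = cball 0 R \<inter> ({z. \<bar>(a, 0) \<bullet> z - b\<bar> \<le> norm (a, 0::real) * \<delta>} \<inter> {z. \<bar>(a', 0) \<bullet> z - b'\<bar> \<le> norm (a', 0::real) * \<delta>})"
        by (auto simp: E_def jj)
      ultimately have "compact (E \<delta> j)" by (metis compact_Int_closed compact_cball)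
      then show ?thesis by (rule lmeasurable_compact)
    qed
    show thesis
    proof (rule that[of "\<lambda>x. infdist x S" "\<Sum>j\<in>J. Cj j"])
      show "\<bar>infdist x S - infdist y S\<bar> \<le> dist x y" for x y
        using infdist_triangle_abs by blast
      show "\<exists>r>0. convex (\<Omega> \<inter> ball x r)" if "0 < infdist x S" for x
        using that by (intro loc) auto
      fix \<delta> :: real assume \<delta>: "0 < \<delta>" "\<delta> \<le> 1"
      have sub: "{z \<in> cylinder \<Omega> T. infdist (fst z) S \<le> \<delta>} \<subseteq> (\<Union>j\<in>J. E \<delta> j)"
      proof
        fix z assume z: "z \<in> {z \<in> cylinder \<Omega> T. infdist (fst z) S \<le> \<delta>}"
        obtain y where y: "y \<in> S" "infdist (fst z) S = dist (fst z) y"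
          using infdist_attains_inf[OF S False] by blast
        then obtain a b a' b' where j: "((a, b), (a', b')) \<in> J" "a \<bullet> y = b" "a' \<bullet> y = b'"
          by (auto simp: S_def L_def)
        have d: "norm (fst z - y) \<le> \<delta>" using y(2) z by (simp add: dist_norm)
        have est: "\<bar>(v, 0) \<bullet> z - v \<bullet> y\<bar> \<le> norm (v, 0::real) * \<delta>" for v
        proof -
          have "(v, 0::real) \<bullet> z - v \<bullet> y = v \<bullet> (fst z - y)"
            by (simp add: inner_prod_def inner_diff_right)
          then show ?thesis
            using Cauchy_Schwarz_ineq2[of v "fst z - y"] mult_left_mono[OF d norm_ge_zero[of v]]
            by (simp add: norm_Pair)
        qed
        have "z \<in> E \<delta> ((a, b), (a', b'))"
          using est[of a] est[of a'] j R[of z] z by (simp add: E_def)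
        then show "z \<in> (\<Union>j\<in>J. E \<delta> j)" using j by blast
      qed
      show "measure lebesgue {z \<in> cylinder \<Omega> T. infdist (fst z) S \<le> \<delta>} \<le> (\<Sum>j\<in>J. Cj j) * \<delta>\<^sup>2"
      proof -
        have op: "open (cylinder \<Omega> T)" unfolding cylinder_def X(2) by (intro open_Times) auto
        have "closed {z :: 'a \<times> real. infdist (fst z) S \<le> \<delta>}"
          by (intro closed_Collect_le continuous_intros continuous_on_infdist)
        then have m: "{z \<in> cylinder \<Omega> T. infdist (fst z) S \<le> \<delta>} \<in> sets lebesgue"
          using op by (auto simp: Collect_conj_eq intro!: sets.Int)
        have "measure lebesgue {z \<in> cylinder \<Omega> T. infdist (fst z) S \<le> \<delta>} \<le> measure lebesgue (\<Union>j\<in>J. E \<delta> j)"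
          using J Em by (intro measure_mono_fmeasurable sub m fmeasurable.finite_UN) auto
        also have "\<dots> \<le> (\<Sum>j\<in>J. measure lebesgue (E \<delta> j))"
          using J Em by (intro measure_UNION_le) (auto intro: fmeasurableD)
        also have "\<dots> \<le> (\<Sum>j\<in>J. Cj j * \<delta>\<^sup>2)" using Cj \<delta> by (intro sum_mono) auto
        finally show ?thesis by (simp add: sum_distrib_right)
      qed
    qed
  qed
qed

subsection \<open>Extension, renormalisation and weights\<close>

text \<open>McShane's infimum formula gives an extension with the same constant; truncation at -V
  and V restores the bound and does not increase differences.\<close>

lemma lipschitz_extension_bounded:
  fixes f :: "'b::metric_space \<Rightarrow> real"
  assumes lip: "\<And>x y. x \<in> A \<Longrightarrow> y \<in> A \<Longrightarrow> \<bar>f x - f y\<bar> \<le> K * dist x y"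
    and V: "\<And>x. x \<in> A \<Longrightarrow> \<bar>f x\<bar> \<le> V" and "K \<ge> 0" "V \<ge> 0"
  obtains F where "\<And>x. x \<in> A \<Longrightarrow> F x = f x" "\<And>x y. \<bar>F x - F y\<bar> \<le> K * dist x y" "\<And>x. \<bar>F x\<bar> \<le> V"
proof (cases "A = {}")
  case True
  then show thesis using that[of "\<lambda>_. 0"] assms by simp
next
  case False
  define F0 where "F0 x = (INF y\<in>A. f y + K * dist x y)" for x
  have bdd: "bdd_below ((\<lambda>y. f y + K * dist x y) ` A)" for x
  proof (rule bdd_belowI2)
    fix y assume "y \<in> A"
    then have "- V \<le> f y" using V[of y] by linarith
    then show "- V \<le> f y + K * dist x y" using \<open>K \<ge> 0\<close> by (simp add: add_increasing2)
  qed
  have F0A: "F0 x = f x" if x: "x \<in> A" for x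
  proof (rule antisym)
    show "F0 x \<le> f x" unfolding F0_def using cINF_lower[OF bdd x, of x] by simp
    show "f x \<le> F0 x" unfolding F0_def
    proof (rule cINF_greatest[OF False])
      fix y assume "y \<in> A"
      then show "f x \<le> f y + K * dist x y" using lip[OF x, of y] by linarith
    qed
  qed
  have half: "F0 x \<le> F0 y + K * dist x y" for x y
  proof -
    have "F0 x - K * dist x y \<le> F0 y"
      unfolding F0_def[of y]
    proof (rule cINF_greatest[OF False])
      fix p assume p: "p \<in> A"
      have "F0 x \<le> f p + K * dist x p" unfolding F0_def by (rule cINF_lower[OF bdd p])
      also have "\<dots> \<le> f p + K * (dist x y + dist y p)"
        using \<open>K \<ge> 0\<close> by (intro add_left_mono mult_left_mono dist_triangle)
      finally show "F0 x - K * dist x y \<le> f p + K * dist y p" by (simp add: algebra_simps)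
    qed
    then show ?thesis by linarith
  qed
  define F where "F x = max (- V) (min V (F0 x))" for x
  show thesis
  proof (rule that[of F])
    show "F x = f x" if "x \<in> A" for x using F0A[OF that] V[OF that] by (simp add: F_def)
    show "\<bar>F x - F y\<bar> \<le> K * dist x y" for x y
    proof -
      have "\<bar>F x - F y\<bar> \<le> \<bar>F0 x - F0 y\<bar>" by (auto simp: F_def)
      also have "\<dots> \<le> K * dist x y" using half[of x y] half[of y x] by (simp add: dist_commute abs_le_iff)
      finally show ?thesis .
    qed
    show "\<bar>F x\<bar> \<le> V" for x using \<open>V \<ge> 0\<close> by (auto simp: F_def)
  qed
qed

section \<open>The bounded renormalisation\<close>

definition renorm :: "real \<Rightarrow> real" where "renorm s = s\<^sup>2 / (1 + s\<^sup>2)"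
definition renorm_deriv :: "real \<Rightarrow> real" where "renorm_deriv s = 2 * s / (1 + s\<^sup>2)\<^sup>2"

lemma one_plus_square_pos: "1 + s\<^sup>2 > (0::real)" "1 + s\<^sup>2 \<noteq> (0::real)"
  by (metis add_pos_nonneg zero_le_power2 zero_less_one)
     (metis add_pos_nonneg less_irrefl zero_le_power2 zero_less_one)

lemma renorm_has_derivative: "(renorm has_real_derivative renorm_deriv s) (at s)"
proof -
  have "((\<lambda>s. s\<^sup>2 / (1 + s\<^sup>2)) has_real_derivative ((2 * s) * (1 + s\<^sup>2) - s\<^sup>2 * (2 * s)) / ((1 + s\<^sup>2) * (1 + s\<^sup>2))) (at s)"
    using one_plus_square_pos(2)[of s] by (auto intro!: derivative_eq_intros)
  moreover have "((2 * s) * (1 + s\<^sup>2) - s\<^sup>2 * (2 * s)) / ((1 + s\<^sup>2) * (1 + s\<^sup>2)) = renorm_deriv s"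
    by (simp add: renorm_deriv_def power2_eq_square algebra_simps)
  ultimately show ?thesis by (simp add: renorm_def[abs_def])
qed

lemma renorm_nonneg: "0 \<le> renorm s" and renorm_le_1: "renorm s \<le> 1"
  and renorm_eq_0_iff: "renorm s = 0 \<longleftrightarrow> s = 0"
  using one_plus_square_pos[of s] by (auto simp: renorm_def)

text \<open>This makes the Gronwall argument close: a commutator bounded by |u|, multiplied by the
  derivative of \<open>renorm\<close>, is again bounded by \<open>renorm\<close>.\<close>

lemma abs_mult_renorm_deriv_le: "\<bar>s\<bar> * \<bar>renorm_deriv s\<bar> \<le> 2 * renorm s"
proof -
  have "s\<^sup>2 / (1 + s\<^sup>2)\<^sup>2 \<le> s\<^sup>2 / (1 + s\<^sup>2)"
    using one_plus_square_pos[of s] by (intro divide_left_mono) (auto simp: power2_eq_square)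
  moreover have "\<bar>s\<bar> * \<bar>renorm_deriv s\<bar> = 2 * (s\<^sup>2 / (1 + s\<^sup>2)\<^sup>2)"
    by (simp add: renorm_deriv_def abs_mult abs_divide power2_eq_square mult.left_commute[of "\<bar>s\<bar>"])
  ultimately show ?thesis by (simp add: renorm_def)
qed

lemma abs_renorm_deriv_le: "\<bar>renorm_deriv s\<bar> \<le> 2"
proof -
  have "\<bar>s\<bar> \<le> 1 + s\<^sup>2" using sum_squares_bound[of 1 "\<bar>s\<bar>"] by (simp add: power2_eq_square)
  also have "\<dots> \<le> (1 + s\<^sup>2)\<^sup>2" using one_plus_square_pos[of s] by (simp add: power2_eq_square)
  finally show ?thesis using one_plus_square_pos[of s] by (simp add: renorm_deriv_def abs_mult abs_divide divide_le_eq)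
qed

lemma renorm_lipschitz: "\<bar>renorm a - renorm b\<bar> \<le> 2 * \<bar>a - b\<bar>"
proof -
  have "norm (renorm a - renorm b) \<le> 2 * norm (a - b)"
    by (rule field_differentiable_bound[of UNIV renorm renorm_deriv])
       (use renorm_has_derivative abs_renorm_deriv_le in auto)
  then show ?thesis by simp
qed

lemma renorm_le_abs: "renorm s \<le> 2 * \<bar>s\<bar>"
  using renorm_lipschitz[of s 0] by (simp add: renorm_def)

lemma renorm_continuous_on [continuous_intros]:
  "continuous_on A f \<Longrightarrow> continuous_on A (\<lambda>x. renorm (f x))"
  by (rule continuous_on_compose2[of UNIV renorm])
     (auto intro!: continuous_at_imp_continuous_on DERIV_isCont[OF renorm_has_derivative])

text \<open>Zero from \<open>T'\<close> on, so the equation is only used where the support of the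
  bump stays below the final time. Subtracting 1 makes the weight continuous at \<open>T'\<close>;
  the exponential gives its growth backwards in time.\<close>

definition time_weight :: "real \<Rightarrow> real \<Rightarrow> real \<Rightarrow> real" where
  "time_weight \<mu> T' t = max 0 (exp (\<mu> * (T' - t)) - 1)"

lemma time_weight_nonneg: "0 \<le> time_weight \<mu> T' t"
  by (simp add: time_weight_def)

lemma time_weight_pos: "\<mu> > 0 \<Longrightarrow> t < T' \<Longrightarrow> 0 < time_weight \<mu> T' t"
  by (simp add: time_weight_def less_max_iff_disj)

lemma time_weight_eq_0: "\<mu> \<ge> 0 \<Longrightarrow> T' \<le> t \<Longrightarrow> time_weight \<mu> T' t = 0"
  by (simp add: time_weight_def mult_nonneg_nonpos)

lemma time_weight_continuous_on [continuous_intros]: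
  "continuous_on A f \<Longrightarrow> continuous_on A (\<lambda>x. time_weight \<mu> T' (f x))"
  unfolding time_weight_def by (intro continuous_intros)

lemma time_weight_le: "\<mu> \<ge> 0 \<Longrightarrow> \<bar>t\<bar> \<le> \<rho> \<Longrightarrow> time_weight \<mu> T' t \<le> exp (\<mu> * (T' + \<rho>))"
proof -
  assume a: "\<mu> \<ge> 0" "\<bar>t\<bar> \<le> \<rho>"
  then have "\<mu> * (T' - t) \<le> \<mu> * (T' + \<rho>)" by (intro mult_left_mono) auto
  then have "exp (\<mu> * (T' - t)) \<le> exp (\<mu> * (T' + \<rho>))" by simp
  moreover have "0 < exp (\<mu> * (T' + \<rho>))" by simp
  ultimately show ?thesis unfolding time_weight_def by linarith
qed

text \<open>This growth backwards in time replaces Gronwall's inequality.\<close>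

lemma time_weight_growth:
  assumes "\<mu> \<ge> 0" "h \<ge> 0"
  shows "time_weight \<mu> T' (t - h) - time_weight \<mu> T' t \<ge> h * (\<mu> * time_weight \<mu> T' t)"
proof (cases "exp (\<mu> * (T' - t)) \<ge> 1")
  case True
  let ?E = "exp (\<mu> * (T' - t))"
  have "exp (\<mu> * (T' - (t - h))) = ?E * exp (\<mu> * h)" by (simp add: exp_add[symmetric] algebra_simps)
  moreover have "?E * (1 + \<mu> * h) \<le> ?E * exp (\<mu> * h)"
    using exp_ge_add_one_self[of "\<mu> * h"] by (intro mult_left_mono) auto
  ultimately have "?E * (1 + \<mu> * h) - 1 \<le> time_weight \<mu> T' (t - h)"
    by (simp add: time_weight_def le_max_iff_disj)
  moreover have "time_weight \<mu> T' t = ?E - 1" using True by (simp add: time_weight_def)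
  moreover have "0 \<le> \<mu> * h" using assms by simp
  moreover have "h * (\<mu> * (?E - 1)) = ?E * (\<mu> * h) - \<mu> * h" "?E * (1 + \<mu> * h) = ?E + ?E * (\<mu> * h)"
    by (simp_all only: algebra_simps)
  ultimately show ?thesis by simp
next
  case False
  then have "time_weight \<mu> T' t = 0" by (simp add: time_weight_def)
  then show ?thesis using time_weight_nonneg[of \<mu> T' "t - h"] by simp
qed

text \<open>From 1 - x \<le> exp(-x) follows exp(x) - 1 \<le> x exp(x), used with x = \<mu> h. The
  bound dominates the difference quotients of the weight in the integration by parts.\<close>

lemma time_weight_diff_le:
  assumes "\<mu> \<ge> 0" "0 < h" "h \<le> 1" "\<bar>t\<bar> \<le> \<rho>"
  shows "\<bar>time_weight \<mu> T' (t - h) - time_weight \<mu> T' t\<bar> \<le> (exp (\<mu> * (T' + \<rho>)) * (\<mu> * exp \<mu>)) * h"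
proof -
  let ?E = "exp (\<mu> * (T' - t))"
  have "exp (\<mu> * h) - 1 \<le> \<mu> * h * exp (\<mu> * h)"
  proof -
    have "1 - \<mu> * h \<le> exp (- (\<mu> * h))" using exp_ge_add_one_self[of "- (\<mu> * h)"] by simp
    then have "(1 - \<mu> * h) * exp (\<mu> * h) \<le> exp (- (\<mu> * h)) * exp (\<mu> * h)" by (intro mult_right_mono) auto
    then show ?thesis by (simp add: exp_minus algebra_simps)
  qed
  also have "\<dots> \<le> \<mu> * h * exp \<mu>" using assms by (intro mult_left_mono) (auto intro: mult_left_le)
  finally have 1: "exp (\<mu> * h) - 1 \<le> \<mu> * h * exp \<mu>" .
  have 0: "exp (\<mu> * h) - 1 \<ge> 0" using assms by simp
  have E: "?E \<le> exp (\<mu> * (T' + \<rho>))" using assms by (auto intro!: mult_left_mono)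
  have eq: "exp (\<mu> * (T' - (t - h))) - ?E = ?E * (exp (\<mu> * h) - 1)"
    by (simp add: exp_add[symmetric] algebra_simps)
  have "\<bar>time_weight \<mu> T' (t - h) - time_weight \<mu> T' t\<bar> \<le> \<bar>exp (\<mu> * (T' - (t - h))) - ?E\<bar>"
    by (auto simp: time_weight_def)
  also have "\<dots> = ?E * (exp (\<mu> * h) - 1)" unfolding eq using 0 by (simp add: abs_mult)
  also have "\<dots> \<le> exp (\<mu> * (T' + \<rho>)) * (\<mu> * h * exp \<mu>)" by (rule mult_mono[OF E 1]) (use 0 in auto)
  finally show ?thesis by (simp add: mult_ac)
qed

text \<open>A linear ramp from \<delta> to 2 \<delta>, to be composed with the distance
  \<open>s\<close>. Being Lipschitz is enough, as weights are only differenced.\<close>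

definition cutoff :: "real \<Rightarrow> real \<Rightarrow> real" where
  "cutoff \<delta> x = max 0 (min 1 (x / \<delta> - 1))"

lemma cutoff_range: "0 \<le> cutoff \<delta> x" "cutoff \<delta> x \<le> 1"
  by (auto simp: cutoff_def)

lemma cutoff_eq_1: "\<delta> > 0 \<Longrightarrow> x \<ge> 2 * \<delta> \<Longrightarrow> cutoff \<delta> x = 1"
  by (simp add: cutoff_def le_divide_eq min_absorb1 le_diff_eq)

lemma cutoff_eq_0: "\<delta> > 0 \<Longrightarrow> x \<le> \<delta> \<Longrightarrow> cutoff \<delta> x = 0"
  by (simp add: cutoff_def divide_le_eq max_absorb1 min_le_iff_disj)

lemma cutoff_lipschitz: "\<delta> > 0 \<Longrightarrow> \<bar>cutoff \<delta> x - cutoff \<delta> y\<bar> \<le> \<bar>x - y\<bar> / \<delta>"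
proof -
  assume "\<delta> > 0"
  have "\<bar>cutoff \<delta> x - cutoff \<delta> y\<bar> \<le> \<bar>x / \<delta> - y / \<delta>\<bar>" by (auto simp: cutoff_def)
  also have "\<dots> = \<bar>x - y\<bar> / \<delta>" using \<open>\<delta> > 0\<close> by (simp add: diff_divide_distrib[symmetric] abs_divide)
  finally show ?thesis .
qed

lemma cutoff_continuous_on [continuous_intros]:
  "continuous_on A f \<Longrightarrow> continuous_on A (\<lambda>x. cutoff \<delta> (f x))"
  unfolding cutoff_def divide_inverse by (intro continuous_intros)

subsection \<open>The regularised transport equation\<close>

text \<open>The integrand on the right is the weight times the derivative of
  \<open>renorm (mollify \<epsilon> u z)\<close> along \<open>e\<close>, by the chain rule. The
  radius grows to R + 1 because mollification with \<epsilon> \<le> 1 enlarges the support by at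
  most 1.\<close>

lemma renorm_mollify_weight_ge:
  fixes u W \<Lambda> :: "'b::euclidean_space \<Rightarrow> real" and e :: 'b
  assumes u: "integrable lborel u" "\<And>z. norm z > R \<Longrightarrow> u z = 0" and \<epsilon>: "0 < \<epsilon>" "\<epsilon> \<le> 1"
    and W: "continuous_on UNIV W"
    and Wlip: "\<And>z h. norm z \<le> R + 1 \<Longrightarrow> 0 < h \<Longrightarrow> h \<le> 1 \<Longrightarrow> \<bar>W (z - h *\<^sub>R e) - W z\<bar> \<le> C * h"
    and L: "\<Lambda> \<in> borel_measurable borel" and Lb: "\<And>z. norm z \<le> R + 1 \<Longrightarrow> \<bar>\<Lambda> z\<bar> \<le> C'"
    and ev: "\<And>z. \<forall>\<^sub>F h in at_right 0. W (z - h *\<^sub>R e) - W z \<ge> h * \<Lambda> z"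
  shows "integrable lborel (\<lambda>z. W z * (renorm_deriv (mollify \<epsilon> u z) * mollify_deriv \<epsilon> e u z))"
    "(\<integral>z. renorm (mollify \<epsilon> u z) * \<Lambda> z \<partial>lborel)
      \<le> (\<integral>z. W z * (renorm_deriv (mollify \<epsilon> u z) * mollify_deriv \<epsilon> e u z) \<partial>lborel)"
    "integrable lborel (\<lambda>z. renorm (mollify \<epsilon> u z) * \<Lambda> z)"
proof -
  define K where "K = 4 / \<epsilon> * (\<integral>z. \<bar>u z\<bar> \<partial>lborel) / bump_mass TYPE('b) \<epsilon>"
  have c: "continuous_on UNIV (\<lambda>z. renorm (mollify \<epsilon> u z))"
    by (intro continuous_intros mollify_continuous_on u \<epsilon>)
  have z: "renorm (mollify \<epsilon> u z) = 0" if "norm z > R + 1" for z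
    using that \<epsilon> u(2) by (subst mollify_eq_0[of \<epsilon> R]) (auto simp: renorm_def)
  have lip: "\<bar>renorm (mollify \<epsilon> u (z + h *\<^sub>R e)) - renorm (mollify \<epsilon> u z)\<bar> \<le> (2 * (K * norm e)) * \<bar>h\<bar>" for z h
  proof -
    have "\<bar>mollify \<epsilon> u (z + h *\<^sub>R e) - mollify \<epsilon> u z\<bar> \<le> K * (\<bar>h\<bar> * norm e)"
      using mollify_lipschitz[OF u(1) \<epsilon>(1), of "z + h *\<^sub>R e" z] by (simp add: K_def)
    then show ?thesis
      using renorm_lipschitz[of "mollify \<epsilon> u (z + h *\<^sub>R e)" "mollify \<epsilon> u z"] by (simp add: mult_ac)
  qed
  have der: "((\<lambda>s. renorm (mollify \<epsilon> u (z + s *\<^sub>R e))) has_real_derivative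
      renorm_deriv (mollify \<epsilon> u z) * mollify_deriv \<epsilon> e u z) (at 0)" for z
    using DERIV_chain2[OF renorm_has_derivative mollify_line_derivative[OF u(1) \<epsilon>(1), of z e 0]] by simp
  note * = integral_weight_deriv_ge[OF c renorm_nonneg z lip der W Wlip L Lb ev]
  show "integrable lborel (\<lambda>z. W z * (renorm_deriv (mollify \<epsilon> u z) * mollify_deriv \<epsilon> e u z))"
    "(\<integral>z. renorm (mollify \<epsilon> u z) * \<Lambda> z \<partial>lborel)
      \<le> (\<integral>z. W z * (renorm_deriv (mollify \<epsilon> u z) * mollify_deriv \<epsilon> e u z) \<partial>lborel)"
    "integrable lborel (\<lambda>z. renorm (mollify \<epsilon> u z) * \<Lambda> z)"
    using * by blast+
qed

text \<open>The analytic content of the problem: \<open>u\<close> is a difference of solutions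
  extended by zero, \<open>w\<close> a pointwise velocity, and \<open>weak\<close> the equation
  tested with a bump centred at \<open>z\<close>. The centre is restricted only by the final time;
  the bump may cross the boundary of the domain and t = 0.\<close>

locale transport =
  fixes \<Omega> :: "'a::euclidean_space set" and T V L Cq R C :: real
    and u q :: "'a \<times> real \<Rightarrow> real" and w :: "'a \<times> real \<Rightarrow> 'a" and s :: "'a \<Rightarrow> real"
  assumes open_domain: "open \<Omega>"
    and R: "\<And>z. z \<in> cylinder \<Omega> T \<Longrightarrow> norm z \<le> R" "R \<ge> 0"
    and u: "integrable lborel u" "\<And>z. z \<notin> cylinder \<Omega> T \<Longrightarrow> u z = 0"
    and q: "q \<in> borel_measurable borel" "\<And>z. \<bar>q z\<bar> \<le> Cq"
    and w_measurable: "\<And>b. b \<in> Basis \<Longrightarrow> (\<lambda>z. w z \<bullet> b) \<in> borel_measurable borel"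
    and w_bound: "\<And>z b. b \<in> Basis \<Longrightarrow> \<bar>w z \<bullet> b\<bar> \<le> V"
    and w_lipschitz: "\<And>b z z'. b \<in> Basis \<Longrightarrow> closed_segment z z' \<subseteq> cylinder \<Omega> T \<Longrightarrow>
      \<bar>w z \<bullet> b - w z' \<bullet> b\<bar> \<le> L * dist z z'"
    and L: "L \<ge> 0"
    and s_lipschitz: "\<And>x y. \<bar>s x - s y\<bar> \<le> dist x y"
    and s_convex: "\<And>x. s x > 0 \<Longrightarrow> \<exists>r>0. convex (\<Omega> \<inter> ball x r)"
    and s_measure: "\<And>\<delta>. 0 < \<delta> \<Longrightarrow> \<delta> \<le> 1 \<Longrightarrow>
      measure lebesgue {z \<in> cylinder \<Omega> T. s (fst z) \<le> \<delta>} \<le> C * \<delta>\<^sup>2"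
    and weak: "\<And>z \<epsilon>. \<epsilon> > 0 \<Longrightarrow> snd z + \<epsilon> < T \<Longrightarrow>
      (\<integral>z'. u z' * bump_deriv \<epsilon> (0, 1) (z - z') \<partial>lborel)
      + (\<Sum>b\<in>Basis. \<integral>z'. u z' * (w z' \<bullet> b) * bump_deriv \<epsilon> (b, 0) (z - z') \<partial>lborel)
      + (\<integral>z'. u z' * q z' * bump \<epsilon> (z - z') \<partial>lborel) = 0"
begin

abbreviation "Q \<equiv> cylinder \<Omega> T"

lemma open_Q: "open Q"
  unfolding cylinder_def by (intro open_Times open_domain) auto

lemma V_nonneg: "V \<ge> 0"
proof -
  obtain b :: 'a where "b \<in> Basis" using nonempty_Basis by blast
  from w_bound[OF this, of 0] show ?thesis by linarith
qed

lemma Cq_nonneg: "Cq \<ge> 0"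
  using q(2)[of 0] by linarith

lemma s_continuous_on: "continuous_on A f \<Longrightarrow> continuous_on A (\<lambda>x. s (f x))"
proof -
  have "1-lipschitz_on UNIV s" using s_lipschitz by (intro lipschitz_onI) (auto simp: dist_real_def)
  then have "continuous_on UNIV s" by (rule lipschitz_on_continuous_on)
  then show "continuous_on A f \<Longrightarrow> continuous_on A (\<lambda>x. s (f x))"
    by (rule continuous_on_compose2) auto
qed

lemma s_fst_lipschitz: "\<bar>s (fst z) - s (fst z')\<bar> \<le> dist z z'"
  using s_lipschitz[of "fst z" "fst z'"] dist_fst_le[of z z'] by linarith

text \<open>A Lebesgue number of the cover by balls with convex trace: two points at distance below
  \<open>r\<close> lie in one convex piece, so their segment stays in the cylinder. The scale
  \<open>r\<close> depends on \<delta>, the constant \<open>L\<close> does not, and this keeps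
  \<delta> out of \<open>rate\<close>.\<close>

lemma uniform_lipschitz_scale:
  assumes "\<delta> > 0"
  obtains r where "r > 0" "\<And>b z z'. b \<in> Basis \<Longrightarrow> z \<in> Q \<Longrightarrow> z' \<in> Q \<Longrightarrow> s (fst z) \<ge> \<delta> \<Longrightarrow> dist z z' < r \<Longrightarrow>
    \<bar>w z \<bullet> b - w z' \<bullet> b\<bar> \<le> L * dist z z'"
proof (cases "Q = {}")
  case True
  then show thesis using that[of 1] by simp
next
  case False
  then have T: "{0<..<T} \<noteq> {}" by (auto simp: cylinder_def)
  \<comment> \<open>The bound \<open>R\<close> concerns the cylinder; a time between 0 and
    \<open>T\<close> transfers it to the domain. Hence the separate treatment of an empty
    cylinder.\<close>
  have "bounded \<Omega>"
  proof -
    obtain t where "t \<in> {0<..<T}" using T by blast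
    then have "(x, t) \<in> Q" if "x \<in> \<Omega>" for x using that by (auto simp: cylinder_def)
    then have "norm x \<le> R" if "x \<in> \<Omega>" for x
      using that R(1)[of "(x, t)"] norm_fst_le[of x t] by force
    then show ?thesis by (auto simp: bounded_iff)
  qed
  then have "compact (closure \<Omega>)" by (simp add: compact_closure)
  moreover have "closed {x. \<delta> \<le> s x}"
    by (intro closed_Collect_le continuous_intros s_continuous_on)
  ultimately have comp: "compact (closure \<Omega> \<inter> {x. \<delta> \<le> s x})" by (rule compact_Int_closed)
  define \<G> where "\<G> = {ball x r |x r. r > 0 \<and> convex (\<Omega> \<inter> ball x r)}"
  have cover: "closure \<Omega> \<inter> {x. \<delta> \<le> s x} \<subseteq> \<Union>\<G>"
  proof
    fix x assume "x \<in> closure \<Omega> \<inter> {x. \<delta> \<le> s x}"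
    then have "s x > 0" using assms by auto
    then obtain r where "r > 0" "convex (\<Omega> \<inter> ball x r)" using s_convex by blast
    then show "x \<in> \<Union>\<G>" unfolding \<G>_def by (intro UnionI[of "ball x r"]) auto
  qed
  obtain r where r: "r > 0" "\<forall>x \<in> closure \<Omega> \<inter> {x. \<delta> \<le> s x}. \<exists>G\<in>\<G>. ball x r \<subseteq> G"
  proof (rule Heine_Borel_lemma[OF comp cover])
    show "open G" if "G \<in> \<G>" for G using that by (auto simp: \<G>_def)
  qed (use that in blast)
  show thesis
  proof (rule that[OF r(1)])
    fix b z z' assume b: "b \<in> (Basis :: 'a set)" and z: "z \<in> Q" "z' \<in> Q" "s (fst z) \<ge> \<delta>" "dist z z' < r"
    have x: "fst z \<in> \<Omega>" "fst z' \<in> \<Omega>" using z by (auto simp: cylinder_def)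
    then obtain x0 r0 where G: "ball (fst z) r \<subseteq> ball x0 r0" "convex (\<Omega> \<inter> ball x0 r0)"
      using r(2) z(3) closure_subset[of \<Omega>] unfolding \<G>_def by blast
    have "convex ((\<Omega> \<inter> ball x0 r0) \<times> {0<..<T})" by (intro convex_Times G convex_real_interval)
    moreover have "z \<in> (\<Omega> \<inter> ball x0 r0) \<times> {0<..<T}"
    proof -
      have "fst z \<in> ball x0 r0" using G(1) r(1) by (meson centre_in_ball subsetD)
      then show ?thesis using z x by (auto simp: cylinder_def mem_Times_iff)
    qed
    moreover have "z' \<in> (\<Omega> \<inter> ball x0 r0) \<times> {0<..<T}"
    proof -
      have "fst z' \<in> ball (fst z) r" using z(4) dist_fst_le[of z z'] by simp
      then have "fst z' \<in> ball x0 r0" using G(1) by blast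
      then show ?thesis using z x by (auto simp: cylinder_def mem_Times_iff)
    qed
    ultimately have "closed_segment z z' \<subseteq> (\<Omega> \<inter> ball x0 r0) \<times> {0<..<T}" by (rule closed_segment_subset[rotated 2])
    then have "closed_segment z z' \<subseteq> Q" by (auto simp: cylinder_def)
    then show "\<bar>w z \<bullet> b - w z' \<bullet> b\<bar> \<le> L * dist z z'" by (rule w_lipschitz[OF b])
  qed
qed

text \<open>For distant pairs the bound on the velocity acts as a Lipschitz bound: a difference of
  at most 2 V over a distance of at least \<open>r\<close>. The price is a constant \<open>K\<close>
  that depends on \<delta> through \<open>r\<close>.\<close>

lemma velocity_extension:
  assumes "r > 0" and lip: "\<And>b z z'. b \<in> Basis \<Longrightarrow> z \<in> Q \<Longrightarrow> z' \<in> Q \<Longrightarrow> s (fst z) \<ge> \<delta> \<Longrightarrow> dist z z' < r \<Longrightarrow>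
    \<bar>w z \<bullet> b - w z' \<bullet> b\<bar> \<le> L * dist z z'"
  obtains K vt where "K \<ge> 0" "\<And>b z. b \<in> Basis \<Longrightarrow> z \<in> Q \<Longrightarrow> s (fst z) \<ge> \<delta> \<Longrightarrow> vt b z = w z \<bullet> b"
    "\<And>b z z'. b \<in> Basis \<Longrightarrow> \<bar>vt b z - vt b z'\<bar> \<le> K * dist z z'" "\<And>b z. b \<in> Basis \<Longrightarrow> \<bar>vt b z\<bar> \<le> V"
proof -
  define K where "K = max L (2 * V / r)"
  have K: "K \<ge> 0" "K \<ge> L" "K \<ge> 2 * V / r" using L by (auto simp: K_def)
  have "\<exists>F. (\<forall>z\<in>{z \<in> Q. s (fst z) \<ge> \<delta>}. F z = w z \<bullet> b) \<and> (\<forall>z z'. \<bar>F z - F z'\<bar> \<le> K * dist z z') \<and> (\<forall>z. \<bar>F z\<bar> \<le> V)"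
    if b: "b \<in> Basis" for b
  proof -
    have "\<bar>w z \<bullet> b - w z' \<bullet> b\<bar> \<le> K * dist z z'"
      if "z \<in> {z \<in> Q. s (fst z) \<ge> \<delta>}" "z' \<in> {z \<in> Q. s (fst z) \<ge> \<delta>}" for z z'
    proof (cases "dist z z' < r")
      case True
      then have "\<bar>w z \<bullet> b - w z' \<bullet> b\<bar> \<le> L * dist z z'" using that by (intro lip b) auto
      also have "\<dots> \<le> K * dist z z'" by (intro mult_right_mono K) auto
      finally show ?thesis .
    next
      case False
      have "\<bar>w z \<bullet> b - w z' \<bullet> b\<bar> \<le> 2 * V" using w_bound[OF b, of z] w_bound[OF b, of z'] by linarith
      also have "\<dots> = (2 * V / r) * r" using assms(1) by simp
      also have "\<dots> \<le> K * dist z z'" using False K V_nonneg assms(1) by (intro mult_mono) auto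
      finally show ?thesis .
    qed
    then show ?thesis
    proof (rule lipschitz_extension_bounded[of "{z \<in> Q. s (fst z) \<ge> \<delta>}" "\<lambda>z. w z \<bullet> b" K V])
      fix F assume "\<And>z. z \<in> {z \<in> Q. s (fst z) \<ge> \<delta>} \<Longrightarrow> F z = w z \<bullet> b"
        "\<And>z z'. \<bar>F z - F z'\<bar> \<le> K * dist z z'" "\<And>z. \<bar>F z\<bar> \<le> V"
      then show ?thesis by (intro exI[of _ F] conjI ballI allI)
    qed (use w_bound[OF b] K(1) V_nonneg in auto)
  qed
  then have "\<forall>b\<in>Basis. \<exists>F. (\<forall>z\<in>{z \<in> Q. s (fst z) \<ge> \<delta>}. F z = w z \<bullet> b) \<and> (\<forall>z z'. \<bar>F z - F z'\<bar> \<le> K * dist z z') \<and> (\<forall>z. \<bar>F z\<bar> \<le> V)"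
    by blast
  from bchoice[OF this] obtain vt where "\<forall>b\<in>Basis. (\<forall>z\<in>{z \<in> Q. s (fst z) \<ge> \<delta>}. vt b z = w z \<bullet> b) \<and> (\<forall>z z'. \<bar>vt b z - vt b z'\<bar> \<le> K * dist z z') \<and> (\<forall>z. \<bar>vt b z\<bar> \<le> V)" ..
  then show thesis by (intro that[of K vt, OF K(1)]) auto
qed

text \<open>The velocity is frozen at values \<open>a b\<close>. Its deviation over the ball is at
  most M \<epsilon>, the derivative of the bump at most 4 / \<epsilon>, and the powers of \<epsilon>
  cancel. \<open>M\<close> is a parameter because it will be \<open>L\<close> inside the cylinder
  and \<open>K\<close> outside.\<close>

lemma transport_mollify_bound:
  fixes z :: "'a \<times> real" and a :: "'a \<Rightarrow> real" and M :: real
  assumes \<epsilon>: "\<epsilon> > 0" "snd z + \<epsilon> < T" and M: "M \<ge> 0"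
    and a: "\<And>b z'. b \<in> Basis \<Longrightarrow> z' \<in> Q \<Longrightarrow> dist z z' < \<epsilon> \<Longrightarrow> \<bar>a b - w z' \<bullet> b\<bar> \<le> M * \<epsilon>"
  shows "\<bar>mollify_deriv \<epsilon> (0, 1) u z + (\<Sum>b\<in>Basis. a b * mollify_deriv \<epsilon> (b, 0) u z)\<bar>
    \<le> (4 * DIM('a) * M + Cq) * ((\<integral>z'. indicator (ball z \<epsilon>) z' * \<bar>u z'\<bar> \<partial>lborel) / bump_mass TYPE('a \<times> real) \<epsilon>)"
proof -
  let ?N = "bump_mass TYPE('a \<times> real) \<epsilon>"
  define I where "I = (\<integral>z'. indicator (ball z \<epsilon>) z' * \<bar>u z'\<bar> \<partial>lborel)"
  note N = bump_mass_pos[OF \<epsilon>(1), where ?'b = "'a \<times> real"]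
  have um [measurable]: "u \<in> borel_measurable borel" using u(1) by auto
  note wm [measurable] = w_measurable
  note qm [measurable] = q(1)
  have i1: "integrable lborel (\<lambda>z'. u z' * bump_deriv \<epsilon> e (z - z'))" for e
    by (rule mollify_integrands[OF u(1) \<epsilon>(1)])
  have i2: "integrable lborel (\<lambda>z'. u z' * (w z' \<bullet> b) * bump_deriv \<epsilon> e (z - z'))" if "b \<in> Basis" for b e
    by (intro mollify_integrands[OF integrable_mult_bounded[OF u(1) w_measurable[OF that] w_bound[OF that]] \<epsilon>(1)])
  have i3: "integrable lborel (\<lambda>z'. u z' * q z' * bump \<epsilon> (z - z'))"
    by (intro mollify_integrands[OF integrable_mult_bounded[OF u(1) q] \<epsilon>(1)])
  have ind: "integrable lborel (\<lambda>z'. indicator (ball z \<epsilon>) z' * \<bar>u z'\<bar>)"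
    by (rule integrable_indicator_ball_mult[OF u(1)])
  have comm: "\<bar>\<integral>z'. u z' * (a b - w z' \<bullet> b) * bump_deriv \<epsilon> (b, 0) (z - z') \<partial>lborel\<bar> \<le> 4 * M * I"
    and comm_eq: "(\<integral>z'. u z' * (a b - w z' \<bullet> b) * bump_deriv \<epsilon> (b, 0) (z - z') \<partial>lborel)
      = a b * (\<integral>z'. u z' * bump_deriv \<epsilon> (b, 0) (z - z') \<partial>lborel)
        - (\<integral>z'. u z' * (w z' \<bullet> b) * bump_deriv \<epsilon> (b, 0) (z - z') \<partial>lborel)"
    if b: "b \<in> Basis" for b
  proof -
    have eq: "u z' * (a b - w z' \<bullet> b) * bump_deriv \<epsilon> (b, 0) (z - z')
      = a b * (u z' * bump_deriv \<epsilon> (b, 0) (z - z')) - u z' * (w z' \<bullet> b) * bump_deriv \<epsilon> (b, 0) (z - z')" for z'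
      by (simp add: algebra_simps)
    have i4: "integrable lborel (\<lambda>z'. a b * (u z' * bump_deriv \<epsilon> (b, 0) (z - z')))"
      by (intro integrable_mult_right i1)
    show "(\<integral>z'. u z' * (a b - w z' \<bullet> b) * bump_deriv \<epsilon> (b, 0) (z - z') \<partial>lborel)
      = a b * (\<integral>z'. u z' * bump_deriv \<epsilon> (b, 0) (z - z') \<partial>lborel)
        - (\<integral>z'. u z' * (w z' \<bullet> b) * bump_deriv \<epsilon> (b, 0) (z - z') \<partial>lborel)"
      unfolding eq Bochner_Integration.integral_diff[OF i4 i2[OF b]] by simp
    have "\<bar>\<integral>z'. u z' * (a b - w z' \<bullet> b) * bump_deriv \<epsilon> (b, 0) (z - z') \<partial>lborel\<bar>
      \<le> (\<integral>z'. (4 * M) * (indicator (ball z \<epsilon>) z' * \<bar>u z'\<bar>) \<partial>lborel)"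
    proof (rule integral_abs_bound_integral)
      show "integrable lborel (\<lambda>z'. u z' * (a b - w z' \<bullet> b) * bump_deriv \<epsilon> (b, 0) (z - z'))"
        unfolding eq by (intro Bochner_Integration.integrable_diff i4 i2[OF b])
      show "integrable lborel (\<lambda>z'. (4 * M) * (indicator (ball z \<epsilon>) z' * \<bar>u z'\<bar>))"
        by (intro integrable_mult_right ind)
      fix z'
      show "\<bar>u z' * (a b - w z' \<bullet> b) * bump_deriv \<epsilon> (b, 0) (z - z')\<bar> \<le> (4 * M) * (indicator (ball z \<epsilon>) z' * \<bar>u z'\<bar>)"
      proof (cases "z' \<in> Q \<and> dist z z' < \<epsilon>")
        case True
        have "\<bar>bump_deriv \<epsilon> (b, 0) (z - z')\<bar> \<le> 4 / \<epsilon>"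
          using bump_deriv_bound[OF \<epsilon>(1), of "(b, 0)" "z - z'"] b by (simp add: norm_Pair)
        then have "\<bar>a b - w z' \<bullet> b\<bar> * \<bar>bump_deriv \<epsilon> (b, 0) (z - z')\<bar> \<le> (M * \<epsilon>) * (4 / \<epsilon>)"
          using a[OF b] True M \<epsilon> by (intro mult_mono) auto
        also have "\<dots> = 4 * M" using \<epsilon> by simp
        finally have "\<bar>u z'\<bar> * (\<bar>a b - w z' \<bullet> b\<bar> * \<bar>bump_deriv \<epsilon> (b, 0) (z - z')\<bar>) \<le> \<bar>u z'\<bar> * (4 * M)"
          by (rule mult_left_mono) simp
        then show ?thesis using True by (simp add: abs_mult mult_ac)
      next
        case False
        then have "u z' = 0 \<or> bump_deriv \<epsilon> (b, 0) (z - z') = 0"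
          using u(2)[of z'] bump_deriv_eq_0[OF \<epsilon>(1), of "z - z'" "(b, 0)"] by (auto simp: dist_norm)
        then show ?thesis using M by auto
      qed
    qed
    then show "\<bar>\<integral>z'. u z' * (a b - w z' \<bullet> b) * bump_deriv \<epsilon> (b, 0) (z - z') \<partial>lborel\<bar> \<le> 4 * M * I"
      by (simp add: I_def)
  qed
  have sink: "\<bar>\<integral>z'. u z' * q z' * bump \<epsilon> (z - z') \<partial>lborel\<bar> \<le> Cq * I"
  proof -
    have "\<bar>\<integral>z'. u z' * q z' * bump \<epsilon> (z - z') \<partial>lborel\<bar> \<le> (\<integral>z'. Cq * (indicator (ball z \<epsilon>) z' * \<bar>u z'\<bar>) \<partial>lborel)"
    proof (rule integral_abs_bound_integral[OF i3])
      show "integrable lborel (\<lambda>z'. Cq * (indicator (ball z \<epsilon>) z' * \<bar>u z'\<bar>))"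
        by (intro integrable_mult_right ind)
      fix z'
      show "\<bar>u z' * q z' * bump \<epsilon> (z - z')\<bar> \<le> Cq * (indicator (ball z \<epsilon>) z' * \<bar>u z'\<bar>)"
      proof (cases "dist z z' < \<epsilon>")
        case True
        have "\<bar>q z'\<bar> * \<bar>bump \<epsilon> (z - z')\<bar> \<le> Cq * 1"
          using q(2)[of z'] bump_nonneg[of \<epsilon> "z - z'"] bump_le_1[of \<epsilon> "z - z'"] Cq_nonneg by (intro mult_mono) auto
        then have "\<bar>u z'\<bar> * (\<bar>q z'\<bar> * \<bar>bump \<epsilon> (z - z')\<bar>) \<le> \<bar>u z'\<bar> * (Cq * 1)" by (rule mult_left_mono) simp
        then show ?thesis using True by (simp add: abs_mult mult_ac)
      next
        case False
        then show ?thesis using bump_eq_0[OF \<epsilon>(1), of "z - z'"] by (simp add: dist_norm)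
      qed
    qed
    then show ?thesis by (simp add: I_def)
  qed
  let ?X = "(\<integral>z'. u z' * bump_deriv \<epsilon> (0, 1) (z - z') \<partial>lborel)
     + (\<Sum>b\<in>Basis. a b * (\<integral>z'. u z' * bump_deriv \<epsilon> (b, 0) (z - z') \<partial>lborel))"
  \<comment> \<open>The weak equation trades the time derivative for the true flux and the sink;
    frozen minus true flux is the commutator.\<close>
  have "?X = (\<Sum>b\<in>Basis. \<integral>z'. u z' * (a b - w z' \<bullet> b) * bump_deriv \<epsilon> (b, 0) (z - z') \<partial>lborel)
     - (\<integral>z'. u z' * q z' * bump \<epsilon> (z - z') \<partial>lborel)"
    using weak[OF \<epsilon>] by (simp add: comm_eq sum_subtractf)
  also have "\<bar>\<dots>\<bar> \<le> (\<Sum>b\<in>(Basis::'a set). 4 * M * I) + Cq * I"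
    by (rule order_trans[OF abs_triangle_ineq4 add_mono[OF order_trans[OF sum_abs sum_mono[OF comm]] sink]])
  finally have X: "\<bar>?X\<bar> \<le> (4 * DIM('a) * M + Cq) * I" by (simp add: algebra_simps)
  have "mollify_deriv \<epsilon> (0, 1) u z + (\<Sum>b\<in>Basis. a b * mollify_deriv \<epsilon> (b, 0) u z) = ?X / ?N"
    by (simp add: mollify_deriv_def add_divide_distrib sum_divide_distrib)
  then have "\<bar>mollify_deriv \<epsilon> (0, 1) u z + (\<Sum>b\<in>Basis. a b * mollify_deriv \<epsilon> (b, 0) u z)\<bar> = \<bar>?X\<bar> / ?N"
    using N by (simp add: abs_divide)
  also have "\<dots> \<le> ((4 * DIM('a) * M + Cq) * I) / ?N" using X N by (intro divide_right_mono) auto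
  finally show ?thesis by (simp add: I_def)
qed

end

subsection \<open>Energy estimate\<close>

context transport begin

definition mass_ratio :: real where
  "mass_ratio = flat 0 (3/4) / 2 ^ DIM('a \<times> real)"

text \<open>The first summand is the coefficient of the energy in the commutator and sink estimate,
  the second comes from differencing the velocity in each of the space directions, and the 1 is what
  remains after absorbing both. Neither \<open>K\<close> nor \<delta> occurs.\<close>

definition rate :: real where
  "rate = (4 * DIM('a) * L + Cq) * (2 / mass_ratio) + DIM('a) * L + 1"

definition weight_bound :: "real \<Rightarrow> real" where
  "weight_bound T' = exp (rate * (T' + (R + 1)))"

lemma mass_ratio_pos: "mass_ratio > 0"
  using flat_0_pos[of "3/4"] by (simp add: mass_ratio_def)

lemma rate_pos: "rate > 0"
  using mass_ratio_pos L Cq_nonneg by (auto simp: rate_def intro!: add_nonneg_pos)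

lemma weight_bound_pos: "weight_bound T' > 0"
  by (simp add: weight_bound_def)

lemma time_weight_le_bound: "norm z \<le> R + 1 \<Longrightarrow> time_weight rate T' (snd z) \<le> weight_bound T'"
  using time_weight_le[of rate "snd z" "R + 1" T'] rate_pos norm_snd_le[of "snd z" "fst z"]
  by (simp add: weight_bound_def)

end

text \<open>All scales fixed. The cut-off lives where s > \<delta>, and \<epsilon> \<le> \<delta> /
  2 ensures that points of the cylinder within \<epsilon> of its support still have s \<ge> \<delta>
  / 2, where the extension \<open>vt\<close> is the true velocity.\<close>

locale transport_cutoff = transport \<Omega> T V L Cq R C u q w s
  for \<Omega> :: "'a::euclidean_space set" and T V L Cq R C :: real
    and u q :: "'a \<times> real \<Rightarrow> real" and w :: "'a \<times> real \<Rightarrow> 'a" and s :: "'a \<Rightarrow> real" +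
  fixes \<delta> r K T' \<epsilon> :: real and vt :: "'a \<Rightarrow> 'a \<times> real \<Rightarrow> real"
  assumes \<delta>: "0 < \<delta>" "2 * \<delta> \<le> 1" and r: "r > 0" and K: "K \<ge> 0"
    and \<epsilon>: "0 < \<epsilon>" "\<epsilon> < r" "\<epsilon> \<le> \<delta> / 2" "\<epsilon> \<le> 1" "T' + \<epsilon> < T"
    and lip: "\<And>b z z'. b \<in> Basis \<Longrightarrow> z \<in> cylinder \<Omega> T \<Longrightarrow> z' \<in> cylinder \<Omega> T \<Longrightarrow>
      s (fst z) \<ge> \<delta> / 2 \<Longrightarrow> dist z z' < r \<Longrightarrow> \<bar>w z \<bullet> b - w z' \<bullet> b\<bar> \<le> L * dist z z'"
    and vt_eq: "\<And>b z. b \<in> Basis \<Longrightarrow> z \<in> cylinder \<Omega> T \<Longrightarrow> s (fst z) \<ge> \<delta> / 2 \<Longrightarrow> vt b z = w z \<bullet> b"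
    and vt_lip: "\<And>b z z'. b \<in> Basis \<Longrightarrow> \<bar>vt b z - vt b z'\<bar> \<le> K * dist z z'"
    and vt_bound: "\<And>b z. b \<in> Basis \<Longrightarrow> \<bar>vt b z\<bar> \<le> V"
begin

section \<open>Weights, energy density and error quantities\<close>

definition \<eta> :: "'a \<times> real \<Rightarrow> real" where "\<eta> z = cutoff \<delta> (s (fst z))"
definition \<theta> :: "'a \<times> real \<Rightarrow> real" where "\<theta> z = time_weight rate T' (snd z)"
definition B :: "'a \<times> real \<Rightarrow> real" where "B z = renorm (mollify \<epsilon> u z)"
definition osc :: "'a \<times> real \<Rightarrow> real" where
  "osc z = oscillation \<epsilon> u z / bump_mass TYPE('a \<times> real) \<epsilon>"
text \<open>Inside the cylinder and off this set, \<open>\<eta>\<close> is locally constant 1, so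
  the gradient of the cut-off costs nothing there.\<close>

definition E :: "('a \<times> real) set" where "E = {z \<in> Q. s (fst z) \<le> 2 * \<delta>}"
definition P :: "'a \<times> real \<Rightarrow> real" where "P z = indicator Q z * (B z * (\<eta> z * \<theta> z))"

definition \<Theta> :: real where "\<Theta> = weight_bound T'"

lemma \<Theta>_pos: "\<Theta> > 0"
  by (simp add: \<Theta>_def weight_bound_pos)

lemma \<eta>_range: "0 \<le> \<eta> z" "\<eta> z \<le> 1"
  by (auto simp: \<eta>_def cutoff_range)

lemma \<theta>_nonneg: "0 \<le> \<theta> z"
  by (simp add: \<theta>_def time_weight_nonneg)

lemma \<theta>_le: "norm z \<le> R + 1 \<Longrightarrow> \<theta> z \<le> \<Theta>"
  unfolding \<theta>_def \<Theta>_def by (rule time_weight_le_bound)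

lemma \<eta>_continuous: "continuous_on UNIV \<eta>"
  unfolding \<eta>_def by (intro continuous_intros s_continuous_on)

lemma \<theta>_continuous: "continuous_on UNIV \<theta>"
  unfolding \<theta>_def by (intro continuous_intros)

lemma \<eta>_lipschitz: "\<bar>\<eta> z - \<eta> z'\<bar> \<le> dist z z' / \<delta>"
proof -
  have "\<bar>\<eta> z - \<eta> z'\<bar> \<le> \<bar>s (fst z) - s (fst z')\<bar> / \<delta>" unfolding \<eta>_def by (rule cutoff_lipschitz[OF \<delta>(1)])
  also have "\<dots> \<le> dist z z' / \<delta>" using s_fst_lipschitz[of z z'] \<delta> by (intro divide_right_mono) auto
  finally show ?thesis .
qed

lemma \<eta>_nonzero: "\<eta> z \<noteq> 0 \<Longrightarrow> s (fst z) > \<delta>"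
  using cutoff_eq_0[OF \<delta>(1)] unfolding \<eta>_def by (metis linorder_not_le)

lemma B_range: "0 \<le> B z" "B z \<le> 1"
  by (auto simp: B_def renorm_nonneg renorm_le_1)

lemma u_far: "norm z > R \<Longrightarrow> u z = 0"
  using R(1)[of z] u(2)[of z] by force

lemma B_far: "norm z > R + 1 \<Longrightarrow> B z = 0"
  using \<epsilon> u_far by (simp add: B_def mollify_eq_0[of \<epsilon> R] renorm_def)

lemma osc_nonneg: "0 \<le> osc z"
  unfolding osc_def oscillation_def using bump_mass_pos[OF \<epsilon>(1), where ?'b = "'a \<times> real"]
  by (intro divide_nonneg_pos integral_nonneg_AE) auto

lemma mollify_osc: "\<bar>mollify \<epsilon> u z - u z\<bar> \<le> osc z"
  unfolding osc_def by (rule mollify_diff_le[OF u(1) \<epsilon>(1)])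

lemma osc_integrable: "integrable lborel osc"
  unfolding osc_def using oscillation_integrable(1)[OF u(1)] by simp

text \<open>\<open>u\<close> vanishes there, so all of \<open>B\<close> is mollification error. This
  is how the boundary disappears from the estimate.\<close>

lemma B_outside: "z \<notin> Q \<Longrightarrow> B z \<le> 2 * osc z"
  using mollify_osc[of z] u(2)[of z] renorm_le_abs[of "mollify \<epsilon> u z"] by (simp add: B_def)

lemma E_measurable: "E \<in> sets borel"
proof -
  have "closed {z :: 'a \<times> real. s (fst z) \<le> 2 * \<delta>}"
    by (intro closed_Collect_le continuous_intros s_continuous_on)
  then have "Q \<inter> {z. s (fst z) \<le> 2 * \<delta>} \<in> sets borel" using open_Q by (intro sets.Int) auto
  moreover have "E = Q \<inter> {z. s (fst z) \<le> 2 * \<delta>}" by (auto simp: E_def)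
  ultimately show ?thesis by simp
qed

lemma E_finite: "emeasure lborel E < \<infinity>"
proof (rule emeasure_bounded_finite)
  show "bounded E" using R(1) by (auto simp: E_def bounded_iff)
qed

lemma measure_E: "measure lborel E \<le> C * (2 * \<delta>)\<^sup>2"
  using s_measure[of "2 * \<delta>"] \<delta> E_measurable by (simp add: E_def[symmetric] measure_completion)

lemma P_measurable: "P \<in> borel_measurable borel"
proof -
  have "B \<in> borel_measurable borel" unfolding B_def
    by (intro borel_measurable_continuous_onI continuous_intros mollify_continuous_on u \<epsilon>)
  moreover have "\<eta> \<in> borel_measurable borel" "\<theta> \<in> borel_measurable borel"
    using \<eta>_continuous \<theta>_continuous by (auto intro: borel_measurable_continuous_onI)
  moreover have "indicator Q \<in> borel_measurable borel" using open_Q by simp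
  ultimately show ?thesis unfolding P_def by measurable
qed

lemma P_nonneg: "0 \<le> P z"
  unfolding P_def using B_range \<eta>_range \<theta>_nonneg by simp

lemma P_integrable: "integrable lborel P"
proof (rule integrable_lborel_bounded_support[OF P_measurable, of \<Theta> R])
  show "P z = 0" if "norm z > R" for z using that R(1)[of z] by (auto simp: P_def indicator_def)
  show "\<bar>P z\<bar> \<le> \<Theta>" for z
  proof (cases "z \<in> Q")
    case True
    have "B z * (\<eta> z * \<theta> z) \<le> 1 * (1 * \<Theta>)"
      using B_range[of z] \<eta>_range[of z] \<theta>_nonneg[of z] \<theta>_le[of z] R(1)[OF True] by (intro mult_mono) auto
    then show ?thesis using True P_nonneg[of z] by (simp add: P_def)
  qed (simp add: P_def \<Theta>_pos less_imp_le)
qed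

definition space_rate :: "'a \<times> real \<Rightarrow> real" where
  "space_rate z = - (\<theta> z * (indicator Q z * (\<eta> z * L + indicator E z * (V / \<delta>)) + (1 - indicator Q z) * (K + V / \<delta>)))"

lemma space_weight_diff:
  assumes b: "b \<in> Basis" and z: "snd z' = snd z"
  shows "\<bar>\<eta> z' * \<theta> z' * vt b z' - \<eta> z * \<theta> z * vt b z\<bar> \<le> \<theta> z * (\<eta> z * \<bar>vt b z' - vt b z\<bar> + V * \<bar>\<eta> z' - \<eta> z\<bar>)"
proof -
  have "\<theta> z' = \<theta> z" using z by (simp add: \<theta>_def)
  then have "\<eta> z' * \<theta> z' * vt b z' - \<eta> z * \<theta> z * vt b z = \<theta> z * (\<eta> z * (vt b z' - vt b z) + vt b z' * (\<eta> z' - \<eta> z))"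
    by (simp add: algebra_simps)
  then have "\<bar>\<eta> z' * \<theta> z' * vt b z' - \<eta> z * \<theta> z * vt b z\<bar> = \<theta> z * \<bar>\<eta> z * (vt b z' - vt b z) + vt b z' * (\<eta> z' - \<eta> z)\<bar>"
    using \<theta>_nonneg by (simp add: abs_mult)
  also have "\<bar>\<eta> z * (vt b z' - vt b z) + vt b z' * (\<eta> z' - \<eta> z)\<bar> \<le> \<eta> z * \<bar>vt b z' - vt b z\<bar> + V * \<bar>\<eta> z' - \<eta> z\<bar>"
  proof (rule order_trans[OF abs_triangle_ineq add_mono])
    show "\<bar>\<eta> z * (vt b z' - vt b z)\<bar> \<le> \<eta> z * \<bar>vt b z' - vt b z\<bar>" using \<eta>_range by (simp add: abs_mult)
    show "\<bar>vt b z' * (\<eta> z' - \<eta> z)\<bar> \<le> V * \<bar>\<eta> z' - \<eta> z\<bar>"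
      unfolding abs_mult using vt_bound[OF b] by (intro mult_right_mono) auto
  qed
  finally show ?thesis using \<theta>_nonneg by (simp add: mult_left_mono)
qed

lemma space_weight_diff':
  assumes b: "b \<in> Basis" and h: "h > 0"
  shows "\<bar>\<eta> (z - h *\<^sub>R (b, 0)) * \<theta> (z - h *\<^sub>R (b, 0)) * vt b (z - h *\<^sub>R (b, 0)) - \<eta> z * \<theta> z * vt b z\<bar>
    \<le> \<theta> z * (K + V / \<delta>) * h"
proof -
  let ?z = "z - h *\<^sub>R (b, 0)"
  have d: "dist ?z z = h" using b h by (simp add: dist_norm norm_Pair)
  have v: "\<eta> z * \<bar>vt b ?z - vt b z\<bar> \<le> K * h"
    using mult_mono[OF \<eta>_range(2) vt_lip[OF b, of ?z z]] \<eta>_range d by simp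
  have e: "V * \<bar>\<eta> ?z - \<eta> z\<bar> \<le> V * (h / \<delta>)"
    using \<eta>_lipschitz[of ?z z] d V_nonneg by (intro mult_left_mono) auto
  have "\<bar>\<eta> ?z * \<theta> ?z * vt b ?z - \<eta> z * \<theta> z * vt b z\<bar> \<le> \<theta> z * (\<eta> z * \<bar>vt b ?z - vt b z\<bar> + V * \<bar>\<eta> ?z - \<eta> z\<bar>)"
    by (rule space_weight_diff[OF b]) simp
  also have "\<dots> \<le> \<theta> z * (K * h + V * (h / \<delta>))"
    by (rule mult_left_mono[OF add_mono[OF v e] \<theta>_nonneg])
  finally show ?thesis by (simp add: algebra_simps)
qed

lemma space_weight_ev:
  assumes b: "b \<in> Basis"
  shows "\<forall>\<^sub>F h in at_right 0. \<eta> (z - h *\<^sub>R (b, 0)) * \<theta> (z - h *\<^sub>R (b, 0)) * vt b (z - h *\<^sub>R (b, 0)) - \<eta> z * \<theta> z * vt b z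
    \<ge> h * space_rate z"
proof (cases "z \<in> Q")
  case False
  have "\<forall>\<^sub>F h in at_right 0. (h::real) > 0" by (simp add: eventually_at_right_less)
  then show ?thesis
  proof eventually_elim
    case (elim h)
    show ?case using space_weight_diff'[OF b elim, of z] False by (simp add: space_rate_def algebra_simps abs_le_iff)
  qed
next
  case z: True
  obtain \<rho> where \<rho>: "\<rho> > 0" "ball z \<rho> \<subseteq> Q" using open_Q z open_contains_ball by blast
  \<comment> \<open>The shift stays in the cylinder, stays within the scale \<open>r\<close>, and
    changes \<open>s\<close> by less than \<delta> / 2. If s > 2 \<delta> it stays above 2 \<delta>,
    so the cut-off does not move. The bound is pointwise in \<open>z\<close>, which is all the
    integration by parts asks for.\<close>
  define h0 where "h0 = min \<rho> (min r (min (\<delta> / 2) (if s (fst z) > 2 * \<delta> then s (fst z) - 2 * \<delta> else 1)))"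
  have h0: "h0 > 0" using \<rho> r \<delta> by (simp add: h0_def)
  have "\<eta> (z - h *\<^sub>R (b, 0)) * \<theta> (z - h *\<^sub>R (b, 0)) * vt b (z - h *\<^sub>R (b, 0)) - \<eta> z * \<theta> z * vt b z
    \<ge> h * space_rate z" if h: "0 < h" "h < h0" for h
  proof -
    let ?z = "z - h *\<^sub>R (b, 0)"
    have d: "dist ?z z = h" "dist z ?z = h" using b h by (auto simp: dist_norm norm_Pair)
    have hh: "h < \<rho>" "h < r" "h < \<delta> / 2" "s (fst z) > 2 * \<delta> \<Longrightarrow> h < s (fst z) - 2 * \<delta>"
      using h(2) by (auto simp: h0_def)
    have "?z \<in> ball z \<rho>" using hh(1) by (simp only: mem_ball d)
    then have zQ: "?z \<in> Q" using \<rho>(2) by blast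
    have sz: "\<bar>s (fst ?z) - s (fst z)\<bar> \<le> h" using s_fst_lipschitz[of ?z z] d by simp
    have v: "\<eta> z * \<bar>vt b ?z - vt b z\<bar> \<le> \<eta> z * (L * h)"
    proof (cases "\<eta> z = 0")
      case False
      then have sd: "s (fst z) > \<delta>" by (rule \<eta>_nonzero)
      have "vt b z = w z \<bullet> b" by (rule vt_eq[OF b z]) (use sd \<delta> in simp)
      moreover have "vt b ?z = w ?z \<bullet> b" by (rule vt_eq[OF b zQ]) (use sd sz hh(3) in linarith)
      moreover have "\<bar>w z \<bullet> b - w ?z \<bullet> b\<bar> \<le> L * dist z ?z"
        by (rule lip[OF b z zQ]) (use sd \<delta> d hh in simp_all)
      ultimately have "\<bar>vt b ?z - vt b z\<bar> \<le> L * h" using d by (simp add: abs_minus_commute)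
      then show ?thesis using \<eta>_range by (intro mult_left_mono) auto
    qed simp
    have e: "V * \<bar>\<eta> ?z - \<eta> z\<bar> \<le> (indicator E z * (V / \<delta>)) * h"
    proof (cases "s (fst z) \<le> 2 * \<delta>")
      case True
      have "V * \<bar>\<eta> ?z - \<eta> z\<bar> \<le> V * (h / \<delta>)"
        using \<eta>_lipschitz[of ?z z] d V_nonneg by (intro mult_left_mono) auto
      then show ?thesis using True z by (simp add: E_def)
    next
      case False
      then have "h < s (fst z) - 2 * \<delta>" using hh(4) by simp
      then have "\<eta> ?z = 1" "\<eta> z = 1" unfolding \<eta>_def using sz False \<delta>(1) by (auto intro!: cutoff_eq_1)
      then show ?thesis using h V_nonneg \<delta> by simp
    qed
    have "\<bar>\<eta> ?z * \<theta> ?z * vt b ?z - \<eta> z * \<theta> z * vt b z\<bar> \<le> \<theta> z * (\<eta> z * \<bar>vt b ?z - vt b z\<bar> + V * \<bar>\<eta> ?z - \<eta> z\<bar>)"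
      by (rule space_weight_diff[OF b]) simp
    also have "\<dots> \<le> \<theta> z * (\<eta> z * (L * h) + (indicator E z * (V / \<delta>)) * h)"
      by (rule mult_left_mono[OF add_mono[OF v e] \<theta>_nonneg])
    also have "\<dots> = - (h * space_rate z)" using z by (simp add: space_rate_def algebra_simps)
    finally show ?thesis by linarith
  qed
  then show ?thesis using h0 unfolding eventually_at_right_field by blast
qed

lemma space_rate_bound:
  assumes "norm z \<le> R + 1"
  shows "\<bar>space_rate z\<bar> \<le> \<Theta> * (L + V / \<delta> + (K + V / \<delta>))"
proof -
  have nn: "0 \<le> V / \<delta>" using V_nonneg \<delta> by simp
  have "\<bar>space_rate z\<bar> = \<theta> z * \<bar>indicator Q z * (\<eta> z * L + indicator E z * (V / \<delta>)) + (1 - indicator Q z) * (K + V / \<delta>)\<bar>"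
    using \<theta>_nonneg by (simp add: space_rate_def abs_mult)
  also have "\<dots> \<le> \<Theta> * (L + V / \<delta> + (K + V / \<delta>))"
  proof (rule mult_mono)
    have "0 \<le> \<eta> z * L" "\<eta> z * L \<le> L" using \<eta>_range[of z] L by (auto intro: mult_left_le_one_le)
    then show "\<bar>indicator Q z * (\<eta> z * L + indicator E z * (V / \<delta>)) + (1 - indicator Q z) * (K + V / \<delta>)\<bar> \<le> L + V / \<delta> + (K + V / \<delta>)"
      using nn K L by (auto simp: indicator_def)
  qed (use \<theta>_le[OF assms] \<Theta>_pos in auto)
  finally show ?thesis .
qed

lemma space_rate_measurable: "space_rate \<in> borel_measurable borel"
proof -
  have "\<eta> \<in> borel_measurable borel" "\<theta> \<in> borel_measurable borel"
    using \<eta>_continuous \<theta>_continuous by (auto intro: borel_measurable_continuous_onI)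
  moreover have "indicator Q \<in> borel_measurable borel" using open_Q by simp
  moreover have "indicator E \<in> borel_measurable borel" using E_measurable by simp
  ultimately show ?thesis unfolding space_rate_def by measurable
qed

lemma vt_continuous:
  assumes "b \<in> Basis"
  shows "continuous_on UNIV (vt b)"
proof (rule lipschitz_on_continuous_on)
  show "K-lipschitz_on UNIV (vt b)"
    using vt_lip[OF assms] K by (intro lipschitz_onI) (auto simp: dist_real_def)
qed

text \<open>Three losses of different nature: the multiple of the energy is absorbed by
  \<open>rate\<close>, the term on \<open>E\<close> is small because its measure is quadratic in
  \<delta>, and everything outside the cylinder is paid by the oscillation.\<close>

lemma space_estimate:
  assumes b: "b \<in> Basis"
  defines "F \<equiv> \<lambda>z. (\<eta> z * \<theta> z * vt b z) * (renorm_deriv (mollify \<epsilon> u z) * mollify_deriv \<epsilon> (b, 0) u z)"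
  shows "integrable lborel F"
    and "- (L * (\<integral>z. P z \<partial>lborel) + \<Theta> * (V / \<delta>) * measure lborel E + 2 * \<Theta> * (K + V / \<delta>) * (\<integral>z. osc z \<partial>lborel))
      \<le> (\<integral>z. F z \<partial>lborel)"
proof -
  have W: "continuous_on UNIV (\<lambda>z. \<eta> z * \<theta> z * vt b z)"
    by (intro continuous_intros \<eta>_continuous \<theta>_continuous vt_continuous b)
  have Wlip: "\<bar>\<eta> (z - h *\<^sub>R (b, 0)) * \<theta> (z - h *\<^sub>R (b, 0)) * vt b (z - h *\<^sub>R (b, 0)) - \<eta> z * \<theta> z * vt b z\<bar>
    \<le> (\<Theta> * (K + V / \<delta>)) * h" if "norm z \<le> R + 1" "0 < h" "h \<le> 1" for z h
  proof (rule order_trans[OF space_weight_diff'[OF b that(2)]])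
    show "\<theta> z * (K + V / \<delta>) * h \<le> (\<Theta> * (K + V / \<delta>)) * h"
      using \<theta>_le[OF that(1)] that(2) K V_nonneg \<delta> by (intro mult_right_mono) auto
  qed
  note ibp = renorm_mollify_weight_ge[where R=R, OF u(1) u_far \<epsilon>(1,4) W Wlip space_rate_measurable space_rate_bound space_weight_ev[OF b]]
  show "integrable lborel F" unfolding F_def by (rule ibp(1))
  let ?G = "\<lambda>z. - (L * P z + \<Theta> * (V / \<delta>) * indicator E z + 2 * \<Theta> * (K + V / \<delta>) * osc z)"
  have nn: "0 \<le> V / \<delta>" using V_nonneg \<delta> by simp
  note \<Theta> = \<Theta>_pos
  have pt: "?G z \<le> renorm (mollify \<epsilon> u z) * space_rate z" for z
  proof (cases "z \<in> Q")
    case True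
    have iE: "0 \<le> indicator E z * (V / \<delta>)" using nn by (simp add: indicator_def)
    have "B z * (\<theta> z * (indicator E z * (V / \<delta>))) \<le> 1 * (\<Theta> * (indicator E z * (V / \<delta>)))"
      by (intro mult_mono mult_nonneg_nonneg iE)
         (use B_range[of z] \<theta>_le[of z] R(1)[OF True] \<theta>_nonneg[of z] \<Theta> nn in auto)
    moreover have "0 \<le> 2 * \<Theta> * (K + V / \<delta>) * osc z" using \<Theta> K nn osc_nonneg[of z] by simp
    moreover have "renorm (mollify \<epsilon> u z) * space_rate z = - (L * P z + B z * (\<theta> z * (indicator E z * (V / \<delta>))))"
      using True by (simp add: space_rate_def P_def B_def algebra_simps)
    ultimately show ?thesis by (simp add: mult_ac)
  next
    case False
    have "B z * (\<theta> z * (K + V / \<delta>)) \<le> 2 * osc z * (\<Theta> * (K + V / \<delta>))"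
    proof (cases "norm z > R + 1")
      case True
      then show ?thesis using B_far[OF True] osc_nonneg[of z] \<Theta> K nn by simp
    next
      case 2: False
      show ?thesis using B_range[of z] B_outside[OF False] \<theta>_le[of z] 2 nn K \<theta>_nonneg[of z] \<Theta> osc_nonneg[of z]
        by (intro mult_mono) auto
    qed
    moreover have "renorm (mollify \<epsilon> u z) * space_rate z = - (B z * (\<theta> z * (K + V / \<delta>)))"
      using False by (simp add: space_rate_def B_def)
    moreover have "P z = 0" "z \<notin> E" using False by (auto simp: P_def E_def)
    ultimately show ?thesis by (simp add: mult_ac)
  qed
  have Ei: "integrable lborel (indicator E :: _ \<Rightarrow> real)" using E_measurable E_finite by simp
  have i1: "integrable lborel (\<lambda>z. L * P z + \<Theta> * (V / \<delta>) * indicator E z)"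
    by (intro Bochner_Integration.integrable_add integrable_mult_right P_integrable Ei)
  have i2: "integrable lborel (\<lambda>z. 2 * \<Theta> * (K + V / \<delta>) * osc z)"
    by (intro integrable_mult_right osc_integrable)
  have "(\<integral>z. L * P z + \<Theta> * (V / \<delta>) * indicator E z \<partial>lborel) = L * (\<integral>z. P z \<partial>lborel) + \<Theta> * (V / \<delta>) * measure lborel E"
  proof -
    have "(\<integral>z. L * P z + \<Theta> * (V / \<delta>) * indicator E z \<partial>lborel) = (\<integral>z. L * P z \<partial>lborel) + (\<integral>z. \<Theta> * (V / \<delta>) * indicator E z \<partial>lborel)"
      by (intro Bochner_Integration.integral_add integrable_mult_right P_integrable Ei)
    then show ?thesis using E_measurable by simp
  qed
  moreover have "(\<integral>z. ?G z \<partial>lborel) = - ((\<integral>z. L * P z + \<Theta> * (V / \<delta>) * indicator E z \<partial>lborel)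
      + (\<integral>z. 2 * \<Theta> * (K + V / \<delta>) * osc z \<partial>lborel))"
    unfolding Bochner_Integration.integral_minus Bochner_Integration.integral_add[OF i1 i2] ..
  ultimately have "- (L * (\<integral>z. P z \<partial>lborel) + \<Theta> * (V / \<delta>) * measure lborel E + 2 * \<Theta> * (K + V / \<delta>) * (\<integral>z. osc z \<partial>lborel)) = (\<integral>z. ?G z \<partial>lborel)"
    by simp
  also have "\<dots> \<le> (\<integral>z. renorm (mollify \<epsilon> u z) * space_rate z \<partial>lborel)"
    by (intro integral_mono ibp(3) pt integrable_minus Bochner_Integration.integrable_add i1 i2)
  also have "\<dots> \<le> (\<integral>z. F z \<partial>lborel)" unfolding F_def by (rule ibp(2))
  finally show "- (L * (\<integral>z. P z \<partial>lborel) + \<Theta> * (V / \<delta>) * measure lborel E + 2 * \<Theta> * (K + V / \<delta>) * (\<integral>z. osc z \<partial>lborel))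
      \<le> (\<integral>z. F z \<partial>lborel)" .
qed

text \<open>The gain: growth of the weight backwards in time produces \<open>rate\<close> times the
  energy. The cut-off does not depend on time and merely factors through.\<close>

lemma time_estimate:
  defines "F \<equiv> \<lambda>z. (\<eta> z * \<theta> z) * (renorm_deriv (mollify \<epsilon> u z) * mollify_deriv \<epsilon> (0, 1) u z)"
  shows "integrable lborel F" and "rate * (\<integral>z. P z \<partial>lborel) \<le> (\<integral>z. F z \<partial>lborel)"
proof -
  have W: "continuous_on UNIV (\<lambda>z. \<eta> z * \<theta> z)"
    by (intro continuous_intros \<eta>_continuous \<theta>_continuous)
  have shift: "\<eta> (z - h *\<^sub>R (0, 1)) = \<eta> z" "\<theta> (z - h *\<^sub>R (0, 1)) = time_weight rate T' (snd z - h)" for z h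
    by (simp_all add: \<eta>_def \<theta>_def)
  have Wlip: "\<bar>\<eta> (z - h *\<^sub>R (0, 1)) * \<theta> (z - h *\<^sub>R (0, 1)) - \<eta> z * \<theta> z\<bar>
    \<le> (exp (rate * (T' + (R + 1))) * (rate * exp rate)) * h" if "norm z \<le> R + 1" "0 < h" "h \<le> 1" for z h
  proof -
    have "\<bar>snd z\<bar> \<le> R + 1" using that(1) norm_snd_le[of "snd z" "fst z"] by simp
    then have t: "\<bar>time_weight rate T' (snd z - h) - \<theta> z\<bar> \<le> (exp (rate * (T' + (R + 1))) * (rate * exp rate)) * h"
      unfolding \<theta>_def using that rate_pos by (intro time_weight_diff_le) auto
    have "\<bar>\<eta> z * time_weight rate T' (snd z - h) - \<eta> z * \<theta> z\<bar> = \<eta> z * \<bar>time_weight rate T' (snd z - h) - \<theta> z\<bar>"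
      using \<eta>_range[of z] by (simp add: right_diff_distrib[symmetric] abs_mult)
    also have "\<dots> \<le> \<bar>time_weight rate T' (snd z - h) - \<theta> z\<bar>"
      using \<eta>_range[of z] by (intro mult_left_le_one_le) auto
    finally show ?thesis using t unfolding shift by linarith
  qed
  \<comment> \<open>Restricting a nonnegative lower bound to the cylinder only weakens it, and makes
    its product with \<open>B\<close> equal to \<open>rate * P z\<close>.\<close>
  let ?\<Lambda> = "\<lambda>z. rate * (indicator Q z * (\<eta> z * \<theta> z))"
  have m: "?\<Lambda> \<in> borel_measurable borel"
  proof -
    have "\<eta> \<in> borel_measurable borel" "\<theta> \<in> borel_measurable borel"
      using \<eta>_continuous \<theta>_continuous by (auto intro: borel_measurable_continuous_onI)
    moreover have "indicator Q \<in> borel_measurable borel" using open_Q by simp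
    ultimately show ?thesis by measurable
  qed
  have b: "\<bar>?\<Lambda> z\<bar> \<le> rate * \<Theta>" if "norm z \<le> R + 1" for z
  proof -
    have "\<eta> z * \<theta> z \<le> 1 * \<Theta>" using \<eta>_range[of z] \<theta>_nonneg[of z] \<theta>_le[OF that] by (intro mult_mono) auto
    then have "indicator Q z * (\<eta> z * \<theta> z) \<le> \<Theta>" "0 \<le> indicator Q z * (\<eta> z * \<theta> z)"
      using \<eta>_range[of z] \<theta>_nonneg[of z] \<Theta>_pos by (auto simp: indicator_def)
    then show ?thesis using rate_pos by (simp add: abs_mult)
  qed
  have ev: "\<forall>\<^sub>F h in at_right 0. \<eta> (z - h *\<^sub>R (0, 1)) * \<theta> (z - h *\<^sub>R (0, 1)) - \<eta> z * \<theta> z \<ge> h * ?\<Lambda> z" for z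
  proof -
    have "\<forall>\<^sub>F h in at_right 0. (h::real) > 0" by (simp add: eventually_at_right_less)
    then show ?thesis
    proof eventually_elim
      case (elim h)
      have "h * (rate * \<theta> z) \<le> time_weight rate T' (snd z - h) - \<theta> z"
        unfolding \<theta>_def using elim rate_pos by (intro time_weight_growth) auto
      then have "\<eta> z * (h * (rate * \<theta> z)) \<le> \<eta> z * (time_weight rate T' (snd z - h) - \<theta> z)"
        using \<eta>_range by (intro mult_left_mono)
      moreover have "h * ?\<Lambda> z \<le> \<eta> z * (h * (rate * \<theta> z))"
        using elim rate_pos \<eta>_range[of z] \<theta>_nonneg[of z] by (auto simp: indicator_def mult_ac)
      ultimately show ?case unfolding shift by (simp add: right_diff_distrib)
    qed
  qed
  note ibp = renorm_mollify_weight_ge[where R=R, OF u(1) u_far \<epsilon>(1,4) W Wlip m b ev]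
  show "integrable lborel F" unfolding F_def by (rule ibp(1))
  have eq: "renorm (mollify \<epsilon> u z) * ?\<Lambda> z = rate * P z" for z by (simp add: P_def B_def mult_ac)
  show "rate * (\<integral>z. P z \<partial>lborel) \<le> (\<integral>z. F z \<partial>lborel)"
    using ibp(2) unfolding F_def eq by simp
qed

text \<open>On the ball |u z'| is at most |u z| plus the deviation from it; the volume of the ball
  over the mass of the bump is at most \<open>1 / mass_ratio\<close>.\<close>

lemma average_le:
  "(\<integral>z'. indicator (ball z \<epsilon>) z' * \<bar>u z'\<bar> \<partial>lborel) / bump_mass TYPE('a \<times> real) \<epsilon> \<le> \<bar>u z\<bar> / mass_ratio + osc z"
proof -
  let ?N = "bump_mass TYPE('a \<times> real) \<epsilon>"
  note N = bump_mass_pos[OF \<epsilon>(1), where ?'b = "'a \<times> real"]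
  note i = integrable_indicator_ball_mult[OF u(1)]
  have "(\<integral>z'. indicator (ball z \<epsilon>) z' * \<bar>u z'\<bar> \<partial>lborel)
    \<le> (\<integral>z'. indicator (ball z \<epsilon>) z' * \<bar>u z\<bar> + indicator (ball z \<epsilon>) z' * \<bar>u z' - u z\<bar> \<partial>lborel)"
    by (intro integral_mono Bochner_Integration.integrable_add i) (auto simp: indicator_def)
  also have "\<dots> = measure lborel (ball z \<epsilon>) * \<bar>u z\<bar> + oscillation \<epsilon> u z"
    unfolding Bochner_Integration.integral_add[OF i(3) i(2)] oscillation_def by simp
  finally have "(\<integral>z'. indicator (ball z \<epsilon>) z' * \<bar>u z'\<bar> \<partial>lborel) / ?N
     \<le> (measure lborel (ball z \<epsilon>) * \<bar>u z\<bar> + oscillation \<epsilon> u z) / ?N"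
    using N by (intro divide_right_mono) auto
  moreover have "measure lborel (ball z \<epsilon>) * \<bar>u z\<bar> / ?N \<le> \<bar>u z\<bar> / mass_ratio"
  proof -
    have "mass_ratio * measure lborel (ball z \<epsilon>) \<le> ?N"
      unfolding mass_ratio_def by (rule bump_mass_ge[OF \<epsilon>(1)])
    then have "measure lborel (ball z \<epsilon>) / ?N \<le> 1 / mass_ratio"
      using N mass_ratio_pos by (simp add: field_simps)
    from mult_right_mono[OF this abs_ge_zero[of "u z"]] show ?thesis by simp
  qed
  ultimately show ?thesis by (simp add: osc_def add_divide_distrib)
qed

text \<open>The derivative of \<open>renorm\<close> is evaluated at the mollified value, so |u z| is
  first replaced by it at the cost of an oscillation. The main part then uses |s \<beta>'(s)| \<le>
  2 \<beta>(s), the error part |\<beta>'| \<le> 2.\<close>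

lemma renorm_deriv_average_le:
  "\<bar>renorm_deriv (mollify \<epsilon> u z)\<bar> * ((\<integral>z'. indicator (ball z \<epsilon>) z' * \<bar>u z'\<bar> \<partial>lborel) / bump_mass TYPE('a \<times> real) \<epsilon>)
    \<le> 2 / mass_ratio * B z + (2 / mass_ratio + 2) * osc z"
proof -
  let ?m = "mollify \<epsilon> u z"
  note \<kappa> = mass_ratio_pos
  have "\<bar>u z\<bar> \<le> \<bar>?m\<bar> + osc z" using mollify_osc[of z] by linarith
  then have "\<bar>u z\<bar> / mass_ratio \<le> (\<bar>?m\<bar> + osc z) / mass_ratio" using \<kappa> by (intro divide_right_mono) auto
  with average_le[of z] have "(\<integral>z'. indicator (ball z \<epsilon>) z' * \<bar>u z'\<bar> \<partial>lborel) / bump_mass TYPE('a \<times> real) \<epsilon>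
    \<le> \<bar>?m\<bar> / mass_ratio + (1 / mass_ratio + 1) * osc z" by (simp add: add_divide_distrib distrib_right)
  then have "\<bar>renorm_deriv ?m\<bar> * ((\<integral>z'. indicator (ball z \<epsilon>) z' * \<bar>u z'\<bar> \<partial>lborel) / bump_mass TYPE('a \<times> real) \<epsilon>)
    \<le> \<bar>renorm_deriv ?m\<bar> * (\<bar>?m\<bar> / mass_ratio + (1 / mass_ratio + 1) * osc z)" by (rule mult_left_mono) simp
  also have "\<dots> = (\<bar>?m\<bar> * \<bar>renorm_deriv ?m\<bar>) / mass_ratio + \<bar>renorm_deriv ?m\<bar> * ((1 / mass_ratio + 1) * osc z)"
    by (simp add: algebra_simps)
  also have "\<dots> \<le> (2 * B z) / mass_ratio + 2 * ((1 / mass_ratio + 1) * osc z)"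
    using abs_mult_renorm_deriv_le[of ?m] abs_renorm_deriv_le[of ?m] \<kappa> osc_nonneg[of z]
    by (intro add_mono divide_right_mono mult_right_mono) (auto simp: B_def)
  finally show ?thesis by (simp add: algebra_simps)
qed

text \<open>The operator d/dt + vt . grad applied to \<open>renorm (mollify \<epsilon> u z)\<close>,
  times the weight \<open>\<eta> z * \<theta> z\<close>.\<close>

definition transport_term :: "'a \<times> real \<Rightarrow> real" where
  "transport_term z = (\<eta> z * \<theta> z) * (renorm_deriv (mollify \<epsilon> u z) * mollify_deriv \<epsilon> (0, 1) u z)
    + (\<Sum>b\<in>Basis. (\<eta> z * \<theta> z * vt b z) * (renorm_deriv (mollify \<epsilon> u z) * mollify_deriv \<epsilon> (b, 0) u z))"

text \<open>\<open>L + K\<close> covers both choices of the commutator constant. The 6 is the worst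
  case, outside the cylinder: 2 * 2 from \<open>B z \<le> 2 * osc z\<close> and 2 from the
  replacement of \<open>u\<close> by its mollification.\<close>

definition osc_factor :: real where
  "osc_factor = \<Theta> * (4 * DIM('a) * (L + K) + Cq) * (6 / mass_ratio + 2)"

lemma osc_factor_nonneg: "0 \<le> osc_factor"
  using \<Theta>_pos L K Cq_nonneg mass_ratio_pos by (simp add: osc_factor_def)

lemma transport_term_le:
  "transport_term z \<le> (4 * DIM('a) * L + Cq) * (2 / mass_ratio) * P z + osc_factor * osc z"
proof (cases "\<eta> z * \<theta> z = 0 \<or> norm z > R + 1")
  case True
  have "mollify \<epsilon> u z = 0" if "norm z > R + 1"
    using that \<epsilon> u_far by (intro mollify_eq_0[of \<epsilon> R]) auto
  with True have "transport_term z = 0"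
    by (auto simp: transport_term_def renorm_deriv_def)
  then show ?thesis
    using P_nonneg[of z] osc_nonneg[of z] osc_factor_nonneg L Cq_nonneg mass_ratio_pos by simp
next
  case False
  let ?m = "mollify \<epsilon> u z"
  let ?A = "(\<integral>z'. indicator (ball z \<epsilon>) z' * \<bar>u z'\<bar> \<partial>lborel) / bump_mass TYPE('a \<times> real) \<epsilon>"
  let ?D = "mollify_deriv \<epsilon> (0, 1) u z + (\<Sum>b\<in>Basis. vt b z * mollify_deriv \<epsilon> (b, 0) u z)"
  note \<kappa> = mass_ratio_pos
  have \<eta>: "\<eta> z \<noteq> 0" and \<theta>: "\<theta> z \<noteq> 0" and nz: "norm z \<le> R + 1" using False by auto
  have sd: "s (fst z) > \<delta>" by (rule \<eta>_nonzero[OF \<eta>])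
  have "snd z < T'" using \<theta> time_weight_eq_0[of rate T' "snd z"] rate_pos unfolding \<theta>_def by force
  then have t: "snd z + \<epsilon> < T" using \<epsilon> by simp
  \<comment> \<open>Inside the cylinder \<open>z\<close> is compared with nearby points by the local
    constant, which \<open>rate\<close> can absorb. Outside only \<open>K\<close> is available, but
    then every term is bounded by the oscillation.\<close>
  define M where "M = (if z \<in> Q then L else K)"
  have M: "M \<ge> 0" using L K by (simp add: M_def)
  have D: "\<bar>?D\<bar> \<le> (4 * DIM('a) * M + Cq) * ?A"
  proof (rule transport_mollify_bound[where a="\<lambda>b. vt b z", OF \<epsilon>(1) t M])
    fix b z' assume b: "b \<in> (Basis :: 'a set)" and z': "z' \<in> Q" "dist z z' < \<epsilon>"
    have "s (fst z') \<ge> \<delta> / 2" using s_fst_lipschitz[of z z'] z'(2) sd \<epsilon>(3) by linarith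
    then have e: "vt b z' = w z' \<bullet> b" by (rule vt_eq[OF b z'(1)])
    have "\<bar>vt b z - w z' \<bullet> b\<bar> \<le> M * dist z z'"
    proof (cases "z \<in> Q")
      case True
      have "vt b z = w z \<bullet> b" by (rule vt_eq[OF b True]) (use sd \<delta> in simp)
      moreover have "\<bar>w z \<bullet> b - w z' \<bullet> b\<bar> \<le> L * dist z z'"
        by (rule lip[OF b True z'(1)]) (use sd \<delta> z' \<epsilon> in simp_all)
      ultimately show ?thesis using True by (simp add: M_def)
    next
      case False
      then show ?thesis using vt_lip[OF b, of z z'] by (simp add: M_def e)
    qed
    also have "\<dots> \<le> M * \<epsilon>" using z' M by (intro mult_left_mono) auto
    finally show "\<bar>vt b z - w z' \<bullet> b\<bar> \<le> M * \<epsilon>" .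
  qed
  have "transport_term z = (\<eta> z * \<theta> z) * (renorm_deriv ?m * ?D)"
    by (simp add: transport_term_def sum_distrib_left algebra_simps)
  also have "\<dots> \<le> (\<eta> z * \<theta> z) * (\<bar>renorm_deriv ?m\<bar> * \<bar>?D\<bar>)"
    using \<eta>_range[of z] \<theta>_nonneg[of z] abs_ge_self[of "renorm_deriv ?m * ?D"]
    by (intro mult_left_mono) (auto simp: abs_mult)
  also have "\<dots> \<le> (\<eta> z * \<theta> z) * (\<bar>renorm_deriv ?m\<bar> * ((4 * DIM('a) * M + Cq) * ?A))"
    using \<eta>_range[of z] \<theta>_nonneg[of z] D by (intro mult_left_mono) auto
  also have "\<dots> = (\<eta> z * \<theta> z) * ((4 * DIM('a) * M + Cq) * (\<bar>renorm_deriv ?m\<bar> * ?A))" by (simp add: mult_ac)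
  also have "\<dots> \<le> (\<eta> z * \<theta> z) * ((4 * DIM('a) * M + Cq) * (2 / mass_ratio * B z + (2 / mass_ratio + 2) * osc z))"
    using \<eta>_range[of z] \<theta>_nonneg[of z] M Cq_nonneg renorm_deriv_average_le[of z] by (intro mult_left_mono) auto
  also have "\<dots> \<le> (4 * DIM('a) * L + Cq) * (2 / mass_ratio) * P z + osc_factor * osc z"
  proof -
    have \<eta>\<theta>: "\<eta> z * \<theta> z \<le> \<Theta>" "0 \<le> \<eta> z * \<theta> z"
      using mult_mono[OF \<eta>_range(2)[of z] \<theta>_le[OF nz]] \<eta>_range[of z] \<theta>_nonneg[of z] by auto
    have Mb: "4 * DIM('a) * M + Cq \<le> 4 * DIM('a) * (L + K) + Cq" "0 \<le> 4 * DIM('a) * M + Cq"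
      using L K M Cq_nonneg by (auto simp: M_def)
    have step: "(\<eta> z * \<theta> z) * ((4 * DIM('a) * M + Cq) * (c * osc z)) \<le> osc_factor * osc z"
      if c: "0 \<le> c" "c \<le> 6 / mass_ratio + 2" for c
    proof -
      have "(\<eta> z * \<theta> z) * (4 * DIM('a) * M + Cq) * c \<le> osc_factor"
        unfolding osc_factor_def using \<eta>\<theta> Mb c \<Theta>_pos L K Cq_nonneg by (intro mult_mono) auto
      from mult_right_mono[OF this osc_nonneg[of z]] show ?thesis by (simp add: mult_ac)
    qed
    show ?thesis
    proof (cases "z \<in> Q")
      case True
      then have P: "P z = B z * (\<eta> z * \<theta> z)" and Mb: "M = L" by (auto simp: P_def M_def)
      have "(\<eta> z * \<theta> z) * ((4 * DIM('a) * M + Cq) * (2 / mass_ratio * B z + (2 / mass_ratio + 2) * osc z))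
        = (4 * DIM('a) * L + Cq) * (2 / mass_ratio) * P z
          + (\<eta> z * \<theta> z) * ((4 * DIM('a) * M + Cq) * ((2 / mass_ratio + 2) * osc z))"
        unfolding P Mb by (simp only: distrib_left mult_ac)
      moreover have "0 \<le> 2 / mass_ratio + 2" "2 / mass_ratio + 2 \<le> 6 / mass_ratio + 2"
        using \<kappa> by (auto simp: divide_right_mono)
      ultimately show ?thesis using step by simp
    next
      case False
      then have P: "P z = 0" by (simp add: P_def)
      have "2 / mass_ratio * B z \<le> 2 / mass_ratio * (2 * osc z)"
        using B_outside[OF False] \<kappa> by (intro mult_left_mono) auto
      then have "2 / mass_ratio * B z + (2 / mass_ratio + 2) * osc z \<le> (6 / mass_ratio + 2) * osc z"
        by (simp add: algebra_simps)
      then have "(\<eta> z * \<theta> z) * ((4 * DIM('a) * M + Cq) * (2 / mass_ratio * B z + (2 / mass_ratio + 2) * osc z))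
        \<le> (\<eta> z * \<theta> z) * ((4 * DIM('a) * M + Cq) * ((6 / mass_ratio + 2) * osc z))"
        using \<eta>\<theta> Mb by (intro mult_left_mono) auto
      also have "\<dots> \<le> osc_factor * osc z" using \<kappa> by (intro step) auto
      finally show ?thesis by (simp add: P)
    qed
  qed
  finally show ?thesis .
qed

text \<open>The integral of \<open>transport_term\<close> is estimated from below by the two
  integrations by parts and from above by the equation.\<close>

lemma integral_P_le:
  "(\<integral>z. P z \<partial>lborel) \<le> DIM('a) * (\<Theta> * (V / \<delta>) * measure lborel E)
    + (DIM('a) * (2 * \<Theta> * (K + V / \<delta>)) + osc_factor) * (\<integral>z. osc z \<partial>lborel)"
proof -
  define c1 where "c1 = (4 * DIM('a) * L + Cq) * (2 / mass_ratio)"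
  let ?Ft = "\<lambda>z. (\<eta> z * \<theta> z) * (renorm_deriv (mollify \<epsilon> u z) * mollify_deriv \<epsilon> (0, 1) u z)"
  let ?F = "\<lambda>b z. (\<eta> z * \<theta> z * vt b z) * (renorm_deriv (mollify \<epsilon> u z) * mollify_deriv \<epsilon> (b, 0) u z)"
  let ?P = "\<integral>z. P z \<partial>lborel" and ?O = "\<integral>z. osc z \<partial>lborel"
  let ?e = "\<Theta> * (V / \<delta>) * measure lborel E + 2 * \<Theta> * (K + V / \<delta>) * ?O"
  have si: "integrable lborel (\<lambda>z. \<Sum>b\<in>Basis. ?F b z)"
    by (intro Bochner_Integration.integrable_sum space_estimate(1))
  have sum: "(\<integral>z. transport_term z \<partial>lborel) = (\<integral>z. ?Ft z \<partial>lborel) + (\<Sum>b\<in>Basis. \<integral>z. ?F b z \<partial>lborel)"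
    unfolding transport_term_def Bochner_Integration.integral_add[OF time_estimate(1) si]
    by (intro arg_cong2[where f="(+)"] refl Bochner_Integration.integral_sum space_estimate(1))
  have ti: "integrable lborel transport_term"
    unfolding transport_term_def by (intro Bochner_Integration.integrable_add time_estimate(1) si)
  have "(\<Sum>b\<in>(Basis::'a set). - (L * ?P + ?e)) \<le> (\<Sum>b\<in>Basis. \<integral>z. ?F b z \<partial>lborel)"
    using space_estimate(2) by (intro sum_mono) (simp add: add.assoc)
  moreover have "(\<Sum>b\<in>(Basis::'a set). - X) = - (DIM('a) * X)" for X :: real by simp
  ultimately have "- (DIM('a) * (L * ?P + ?e)) \<le> (\<Sum>b\<in>Basis. \<integral>z. ?F b z \<partial>lborel)" by (simp only:)
  then have "rate * ?P - DIM('a) * (L * ?P + ?e) \<le> (\<integral>z. transport_term z \<partial>lborel)"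
    unfolding sum using time_estimate(2) by linarith
  also have "\<dots> \<le> (\<integral>z. c1 * P z + osc_factor * osc z \<partial>lborel)"
    unfolding c1_def
    by (intro integral_mono ti transport_term_le Bochner_Integration.integrable_add integrable_mult_right P_integrable osc_integrable)
  also have "\<dots> = c1 * ?P + osc_factor * ?O"
  proof -
    have "(\<integral>z. c1 * P z + osc_factor * osc z \<partial>lborel) = (\<integral>z. c1 * P z \<partial>lborel) + (\<integral>z. osc_factor * osc z \<partial>lborel)"
      by (intro Bochner_Integration.integral_add integrable_mult_right P_integrable osc_integrable)
    then show ?thesis by simp
  qed
  finally have "rate * ?P - DIM('a) * (L * ?P + ?e) \<le> c1 * ?P + osc_factor * ?O" .
  \<comment> \<open>The choice of \<open>rate\<close> leaves exactly one copy of the energy after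
    both absorptions.\<close>
  moreover have "rate * ?P = c1 * ?P + DIM('a) * (L * ?P) + ?P"
    by (simp add: rate_def c1_def algebra_simps)
  ultimately have "?P \<le> DIM('a) * ?e + osc_factor * ?O" by (simp add: distrib_left)
  then show ?thesis by (simp add: algebra_simps)
qed

text \<open>Removing the mollification costs an oscillation, and removing the cut-off costs the
  measure of \<open>E\<close>, because \<open>renorm\<close> is bounded by 1. In the result
  \<open>K\<close> stands only in front of the oscillation, and V / \<delta> meets \<delta>^2 in the
  other term.\<close>

lemma cutoff_estimate:
  "(\<integral>z. indicator Q z * (renorm (u z) * time_weight rate T' (snd z)) \<partial>lborel)
   \<le> weight_bound T' * ((DIM('a) * (V / \<delta>) + 1) * (C * (2 * \<delta>)\<^sup>2))
     + (DIM('a) * (2 * weight_bound T' * (K + V / \<delta>))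
        + weight_bound T' * (4 * DIM('a) * (L + K) + Cq) * (6 / mass_ratio + 2) + 2 * weight_bound T')
       * ((\<integral>z. oscillation \<epsilon> u z \<partial>lborel) / bump_mass TYPE('a \<times> real) \<epsilon>)"
proof -
  let ?O = "\<integral>z. osc z \<partial>lborel"
  have um: "u \<in> borel_measurable borel" using u(1) by auto
  have rm: "(\<lambda>z. renorm (u z)) \<in> borel_measurable borel"
    using um unfolding renorm_def by measurable
  have \<theta>m: "\<theta> \<in> borel_measurable borel"
    using \<theta>_continuous by (rule borel_measurable_continuous_onI)
  have Qm: "indicator Q \<in> borel_measurable borel" using open_Q by simp
  have Ei: "integrable lborel (indicator E :: _ \<Rightarrow> real)" using E_measurable E_finite by simp
  have i: "integrable lborel (\<lambda>z. indicator Q z * (renorm (u z) * \<theta> z))"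
  proof (rule integrable_lborel_bounded_support[of _ \<Theta> R])
    show "(\<lambda>z. indicator Q z * (renorm (u z) * \<theta> z)) \<in> borel_measurable borel"
      by (intro borel_measurable_times rm \<theta>m Qm)
    show "indicator Q z * (renorm (u z) * \<theta> z) = 0" if "norm z > R" for z
      using that R(1)[of z] by (auto simp: indicator_def)
    show "\<bar>indicator Q z * (renorm (u z) * \<theta> z)\<bar> \<le> \<Theta>" for z
    proof (cases "z \<in> Q")
      case True
      have "renorm (u z) * \<theta> z \<le> 1 * \<Theta>"
        using renorm_le_1[of "u z"] \<theta>_le[of z] R(1)[OF True] \<theta>_nonneg[of z] by (intro mult_mono) auto
      then show ?thesis using True renorm_nonneg[of "u z"] \<theta>_nonneg[of z] by (simp add: abs_mult)
    qed (simp add: \<Theta>_pos less_imp_le)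
  qed
  have pt: "indicator Q z * (renorm (u z) * \<theta> z) \<le> P z + (2 * \<Theta> * osc z + \<Theta> * indicator E z)" for z
  proof (cases "z \<in> Q")
    case True
    have \<theta>: "\<theta> z \<le> \<Theta>" using R(1)[OF True] by (intro \<theta>_le) simp
    have ru: "renorm (u z) \<le> B z + 2 * osc z"
    proof -
      have "renorm (u z) - B z \<le> 2 * \<bar>mollify \<epsilon> u z - u z\<bar>"
        using abs_le_D2[OF renorm_lipschitz[of "mollify \<epsilon> u z" "u z"]] by (simp add: B_def)
      also have "\<dots> \<le> 2 * osc z" using mollify_osc[of z] by simp
      finally show ?thesis by simp
    qed
    have 1: "renorm (u z) * (\<eta> z * \<theta> z) \<le> P z + 2 * \<Theta> * osc z"
    proof -
      have "\<eta> z * \<theta> z \<le> \<Theta>" "0 \<le> \<eta> z * \<theta> z"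
        using mult_mono[OF \<eta>_range(2)[of z] \<theta>] \<eta>_range[of z] \<theta>_nonneg[of z] by auto
      moreover have "renorm (u z) * (\<eta> z * \<theta> z) \<le> (B z + 2 * osc z) * (\<eta> z * \<theta> z)"
        using ru calculation(2) by (rule mult_right_mono)
      moreover have "2 * osc z * (\<eta> z * \<theta> z) \<le> 2 * osc z * \<Theta>"
        using calculation(1) osc_nonneg[of z] by (intro mult_left_mono) auto
      moreover have "(B z + 2 * osc z) * (\<eta> z * \<theta> z) = B z * (\<eta> z * \<theta> z) + 2 * osc z * (\<eta> z * \<theta> z)"
        by (rule distrib_right)
      moreover have "P z = B z * (\<eta> z * \<theta> z)" "2 * osc z * \<Theta> = 2 * \<Theta> * osc z" using True by (simp_all add: P_def)
      ultimately show ?thesis by linarith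
    qed
    have 2: "renorm (u z) * ((1 - \<eta> z) * \<theta> z) \<le> \<Theta> * indicator E z"
    proof (cases "z \<in> E")
      case True
      have "renorm (u z) * ((1 - \<eta> z) * \<theta> z) \<le> 1 * (1 * \<Theta>)"
        using renorm_le_1[of "u z"] \<eta>_range[of z] \<theta>_nonneg[of z] \<theta> by (intro mult_mono) auto
      then show ?thesis using True by simp
    next
      case False
      then have "\<eta> z = 1" using \<open>z \<in> Q\<close> \<delta>(1) unfolding \<eta>_def E_def by (intro cutoff_eq_1) auto
      then show ?thesis using False by simp
    qed
    have "renorm (u z) * \<theta> z = renorm (u z) * (\<eta> z * \<theta> z) + renorm (u z) * ((1 - \<eta> z) * \<theta> z)"
      by (simp add: algebra_simps)
    then show ?thesis using 1 2 True by simp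
  next
    case False
    then show ?thesis using P_nonneg[of z] osc_nonneg[of z] \<Theta>_pos by (simp add: indicator_def)
  qed
  have i2: "integrable lborel (\<lambda>z. 2 * \<Theta> * osc z + \<Theta> * indicator E z)"
    by (intro Bochner_Integration.integrable_add integrable_mult_right osc_integrable Ei)
  have "(\<integral>z. indicator Q z * (renorm (u z) * \<theta> z) \<partial>lborel) \<le> (\<integral>z. P z + (2 * \<Theta> * osc z + \<Theta> * indicator E z) \<partial>lborel)"
    by (intro integral_mono i pt Bochner_Integration.integrable_add[OF P_integrable i2])
  also have "\<dots> = (\<integral>z. P z \<partial>lborel) + (2 * \<Theta> * ?O + \<Theta> * measure lborel E)"
  proof -
    have "(\<integral>z. 2 * \<Theta> * osc z + \<Theta> * indicator E z \<partial>lborel) = (\<integral>z. 2 * \<Theta> * osc z \<partial>lborel) + (\<integral>z. \<Theta> * indicator E z \<partial>lborel)"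
      by (intro Bochner_Integration.integral_add integrable_mult_right osc_integrable Ei)
    then show ?thesis unfolding Bochner_Integration.integral_add[OF P_integrable i2] using E_measurable by simp
  qed
  also have "\<dots> \<le> \<Theta> * ((DIM('a) * (V / \<delta>) + 1) * measure lborel E)
      + (DIM('a) * (2 * \<Theta> * (K + V / \<delta>)) + osc_factor + 2 * \<Theta>) * ?O"
    using integral_P_le by (simp add: algebra_simps)
  also have "\<Theta> * ((DIM('a) * (V / \<delta>) + 1) * measure lborel E) \<le> \<Theta> * ((DIM('a) * (V / \<delta>) + 1) * (C * (2 * \<delta>)\<^sup>2))"
    using measure_E \<Theta>_pos V_nonneg \<delta>(1) by (intro mult_left_mono) auto
  finally show ?thesis
    unfolding \<theta>_def osc_factor_def \<Theta>_def osc_def by simp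
qed

end

text \<open>The left side of \<open>cutoff_estimate\<close> depends neither on \<delta> nor on
  \<epsilon>, so it is below every x > 0: \<delta> makes the first error at most x / 2, which fixes
  \<open>r\<close> and \<open>K\<close>, and then \<epsilon> makes the second at most x / 2.\<close>

lemma (in transport) solution_vanishes:
  assumes "T' < T"
  shows "AE z in lborel. snd z < T' \<longrightarrow> u z = 0"
proof -
  let ?f = "\<lambda>z. indicator Q z * (renorm (u z) * time_weight rate T' (snd z))"
  let ?\<Theta> = "weight_bound T'"
  have "measure lebesgue {z \<in> Q. s (fst z) \<le> 1} \<le> C" using s_measure[of 1] by simp
  then have C: "C \<ge> 0" by (rule order_trans[OF measure_nonneg])
  have le: "(\<integral>z. ?f z \<partial>lborel) \<le> 0 + x" if x: "x > 0" for x
  proof -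
    \<comment> \<open>Chosen so that the first error is at most A \<delta>: one power of \<delta>
      cancels against V / \<delta>, and \<delta> \<le> 1 bounds the rest. The added 1 makes
      \<open>A\<close> positive.\<close>
    define A where "A = ?\<Theta> * ((DIM('a) * V + 1) * (4 * C)) + 1"
    have A: "A > 0" unfolding A_def using weight_bound_pos[of T'] V_nonneg C by (intro add_nonneg_pos) auto
    define \<delta> where "\<delta> = min (1/2) (x / (2 * A))"
    have del: "0 < \<delta>" "2 * \<delta> \<le> 1" "\<delta> \<le> x / (2 * A)" using x A by (auto simp: \<delta>_def)
    have d2: "0 < \<delta> / 2" using del by simp
    obtain r where r: "r > 0" and lip: "\<And>b z z'. b \<in> Basis \<Longrightarrow> z \<in> Q \<Longrightarrow> z' \<in> Q \<Longrightarrow>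
        s (fst z) \<ge> \<delta> / 2 \<Longrightarrow> dist z z' < r \<Longrightarrow> \<bar>w z \<bullet> b - w z' \<bullet> b\<bar> \<le> L * dist z z'"
      using uniform_lipschitz_scale[OF d2] by blast
    obtain K vt where K: "K \<ge> 0" and vt: "\<And>b z. b \<in> Basis \<Longrightarrow> z \<in> Q \<Longrightarrow> s (fst z) \<ge> \<delta> / 2 \<Longrightarrow> vt b z = w z \<bullet> b"
      "\<And>b z z'. b \<in> Basis \<Longrightarrow> \<bar>vt b z - vt b z'\<bar> \<le> K * dist z z'" "\<And>b z. b \<in> Basis \<Longrightarrow> \<bar>vt b z\<bar> \<le> V"
      using velocity_extension[OF r lip] by blast
    define c where "c = DIM('a) * (2 * ?\<Theta> * (K + V / \<delta>))
        + ?\<Theta> * (4 * DIM('a) * (L + K) + Cq) * (6 / mass_ratio + 2) + 2 * ?\<Theta>"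
    have c: "c > 0"
      unfolding c_def using weight_bound_pos[of T'] K V_nonneg del(1) L Cq_nonneg mass_ratio_pos
      by (intro add_nonneg_pos add_nonneg_nonneg mult_nonneg_nonneg) auto
    \<comment> \<open>The factor \<open>mass_ratio\<close> converts the volume of the ball into the
      mass of the bump, and \<open>c\<close> collects the coefficients of the oscillation.\<close>
    define e where "e = mass_ratio * x / (2 * c)"
    have e: "e > 0" using mass_ratio_pos x c by (simp add: e_def)
    obtain \<epsilon>0 where \<epsilon>0: "\<epsilon>0 > 0" "\<And>\<epsilon>. 0 < \<epsilon> \<Longrightarrow> \<epsilon> < \<epsilon>0 \<Longrightarrow>
        (\<integral>z. oscillation \<epsilon> u z \<partial>lborel) \<le> e * measure lborel (ball (0 :: 'a \<times> real) \<epsilon>)"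
      using oscillation_small[OF u(1) e] by blast
    \<comment> \<open>Halving \<open>d\<close> turns these weak bounds into the strict ones
      required, and gives \<epsilon> \<le> \<delta> / 2.\<close>
    define d where "d = min (min \<epsilon>0 r) (min (min \<delta> 1) (T - T'))"
    have "d > 0" "d \<le> \<epsilon>0" "d \<le> r" "d \<le> \<delta>" "d \<le> 1" "d \<le> T - T'"
      using \<epsilon>0(1) r del(1) assms by (auto simp: d_def)
    moreover define \<epsilon> where "\<epsilon> = d / 2"
    ultimately have eps: "0 < \<epsilon>" "\<epsilon> < \<epsilon>0" "\<epsilon> < r" "\<epsilon> \<le> \<delta> / 2" "\<epsilon> \<le> 1" "T' + \<epsilon> < T"
      by linarith+
    interpret transport_cutoff \<Omega> T V L Cq R C u q w s \<delta> r K T' \<epsilon> vt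
      by unfold_locales (use del r K eps lip vt in auto)
    let ?N = "bump_mass TYPE('a \<times> real) \<epsilon>"
    note N = bump_mass_pos[OF eps(1), where ?'b = "'a \<times> real"]
    have "(\<integral>z. oscillation \<epsilon> u z \<partial>lborel) / ?N \<le> e / mass_ratio"
    proof -
      have "(\<integral>z. oscillation \<epsilon> u z \<partial>lborel) \<le> (e / mass_ratio) * (mass_ratio * measure lborel (ball (0 :: 'a \<times> real) \<epsilon>))"
        using \<epsilon>0(2)[OF eps(1,2)] mass_ratio_pos by simp
      also have "\<dots> \<le> (e / mass_ratio) * ?N"
        using bump_mass_ge[OF eps(1), of "0 :: 'a \<times> real", folded mass_ratio_def] e mass_ratio_pos
        by (intro mult_left_mono) auto
      finally show ?thesis using N by (simp add: divide_le_eq)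
    qed
    then have 1: "c * ((\<integral>z. oscillation \<epsilon> u z \<partial>lborel) / ?N) \<le> c * (e / mass_ratio)"
      using c by (intro mult_left_mono) auto
    have 2: "c * (e / mass_ratio) = x / 2" using c mass_ratio_pos by (simp add: e_def)
    have "(DIM('a) * (V / \<delta>) + 1) * (C * (2 * \<delta>)\<^sup>2) = (DIM('a) * V + \<delta>) * (4 * C) * \<delta>"
      using del(1) by (simp add: field_simps power2_eq_square)
    also have "\<dots> \<le> (DIM('a) * V + 1) * (4 * C) * \<delta>"
      using del(1,2) C by (intro mult_right_mono) auto
    finally have "?\<Theta> * ((DIM('a) * (V / \<delta>) + 1) * (C * (2 * \<delta>)\<^sup>2)) \<le> ?\<Theta> * ((DIM('a) * V + 1) * (4 * C) * \<delta>)"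
      using weight_bound_pos[of T'] by (intro mult_left_mono) auto
    also have "\<dots> \<le> A * \<delta>" using del(1) by (simp add: A_def algebra_simps)
    also have "\<dots> \<le> A * (x / (2 * A))" using del(3) A by (intro mult_left_mono) auto
    also have "\<dots> = x / 2" using A by simp
    finally have 3: "?\<Theta> * ((DIM('a) * (V / \<delta>) + 1) * (C * (2 * \<delta>)\<^sup>2)) \<le> x / 2" .
    show ?thesis using cutoff_estimate[folded c_def] 1 2 3 by linarith
  qed
  have f_le: "(\<integral>z. ?f z \<partial>lborel) \<le> 0" using le by (rule field_le_epsilon)
  have f_nn: "0 \<le> ?f z" for z using renorm_nonneg time_weight_nonneg by simp
  have f_int: "integrable lborel ?f"
  proof (rule integrable_lborel_bounded_support[of _ "weight_bound T'" R])
    have "u \<in> borel_measurable borel" using u(1) by auto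
    then have "(\<lambda>z. renorm (u z)) \<in> borel_measurable borel" unfolding renorm_def by measurable
    moreover have "(\<lambda>z :: 'a \<times> real. time_weight rate T' (snd z)) \<in> borel_measurable borel"
      by (intro borel_measurable_continuous_onI continuous_intros)
    moreover have "indicator Q \<in> borel_measurable borel" using open_Q by simp
    ultimately show "?f \<in> borel_measurable borel" by (intro borel_measurable_times)
    show "?f z = 0" if "norm z > R" for z using that R(1)[of z] by (auto simp: indicator_def)
    show "\<bar>?f z\<bar> \<le> weight_bound T'" for z
    proof (cases "z \<in> Q")
      case True
      have "renorm (u z) * time_weight rate T' (snd z) \<le> 1 * weight_bound T'"
        using renorm_le_1[of "u z"] time_weight_le_bound[of z T'] R(1)[OF True] time_weight_nonneg[of rate T' "snd z"]
        by (intro mult_mono) auto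
      then show ?thesis using f_nn[of z] True by simp
    qed (simp add: weight_bound_pos less_imp_le)
  qed
  have "(\<integral>z. ?f z \<partial>lborel) = 0"
    using f_le integral_nonneg_AE[of ?f lborel] f_nn by (intro antisym) auto
  then have "AE z in lborel. ?f z = 0"
    using integral_nonneg_eq_0_iff_AE[OF f_int] f_nn by auto
  then show ?thesis
  proof (rule AE_mp, intro AE_I2 impI)
    fix z assume f0: "?f z = 0" and t: "snd z < T'"
    show "u z = 0"
    proof (cases "z \<in> Q")
      case True
      then have "renorm (u z) = 0" using f0 time_weight_pos[OF rate_pos t] by simp
      then show ?thesis by (simp add: renorm_eq_0_iff)
    qed (rule u(2))
  qed
qed

subsection \<open>Uniqueness\<close>

lemma borel_representative:
  fixes g :: "'b::euclidean_space \<Rightarrow> real"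
  assumes Q: "Q \<in> sets borel" and g: "g \<in> borel_measurable (lebesgue_on Q)"
  obtains g' where "g' \<in> borel_measurable borel" "\<And>z. z \<notin> Q \<Longrightarrow> g' z = 0"
    "AE z in lborel. z \<in> Q \<longrightarrow> g z = g' z"
proof -
  have "Q \<inter> space lebesgue \<in> sets lebesgue" using Q by simp
  with g have "(\<lambda>z. g z * indicator Q z) \<in> borel_measurable lebesgue"
    by (simp add: borel_measurable_restrict_space_iff mult.commute)
  then obtain f where f: "f \<in> borel_measurable lborel" "AE z in lborel. g z * indicator Q z = f z"
    using completion_ex_borel_measurable_real by blast
  show thesis
  proof (rule that[of "\<lambda>z. indicator Q z * f z"])
    have "indicator Q \<in> borel_measurable borel" using Q by simp
    then show "(\<lambda>z. indicator Q z * f z) \<in> borel_measurable borel"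
      using f(1) by (intro borel_measurable_times) auto
    show "AE z in lborel. z \<in> Q \<longrightarrow> g z = indicator Q z * f z"
      using f(2) by (rule AE_mp) (auto intro!: AE_I2)
  qed simp
qed

text \<open>A representative that vanishes off \<open>Q\<close> lets integrals over the cylinder be
  read as integrals over the whole space, where translations act.\<close>

lemma lebesgue_on_borel_representative:
  fixes F G :: "'b::euclidean_space \<Rightarrow> real"
  assumes Q: "Q \<in> sets borel" and F: "F \<in> borel_measurable (lebesgue_on Q)"
    and G: "G \<in> borel_measurable borel" "\<And>z. z \<notin> Q \<Longrightarrow> G z = 0"
    and FG: "AE z in lborel. z \<in> Q \<longrightarrow> F z = G z"
  shows "(\<integral>z. F z \<partial>lebesgue_on Q) = (\<integral>z. G z \<partial>lborel)"
    and "integrable (lebesgue_on Q) F \<Longrightarrow> integrable lborel G"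
proof -
  have ae: "AE z in lebesgue_on Q. F z = G z" using FG by (simp add: AE_lebesgue_on_iff_lborel[OF Q])
  have Gm: "G \<in> borel_measurable (lebesgue_on Q)" using G(1) by (rule borel_imp_measurable_lebesgue_on)
  have eq: "indicator Q z * G z = G z" for z using G(2)[of z] by (cases "z \<in> Q") auto
  have "(\<integral>z. F z \<partial>lebesgue_on Q) = (\<integral>z. G z \<partial>lebesgue_on Q)"
    by (rule integral_cong_AE[OF F Gm ae])
  also have "\<dots> = (\<integral>z. indicator Q z * G z \<partial>lborel)"
    by (rule integral_lebesgue_on_eq_lborel[OF Q]) (simp add: eq G(1))
  finally show "(\<integral>z. F z \<partial>lebesgue_on Q) = (\<integral>z. G z \<partial>lborel)" by (simp add: eq)
  assume "integrable (lebesgue_on Q) F"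
  then have "integrable (lebesgue_on Q) G" using integrable_cong_AE[OF F Gm ae] by simp
  moreover have "Q \<inter> space lebesgue \<in> sets lebesgue" using Q by simp
  ultimately have "integrable lebesgue (\<lambda>z. indicator Q z *\<^sub>R G z)" by (simp only: integrable_restrict_space)
  then have "integrable lebesgue G" by (simp add: eq)
  then show "integrable lborel G" using G(1) by (simp add: integrable_completion)
qed

text \<open>On a set of finite measure |u| \<le> 1 + u^2 suffices; the remaining argument is carried
  out for integrable functions.\<close>

lemma L2_imp_integrable:
  fixes u :: "'b::euclidean_space \<Rightarrow> real"
  assumes Q: "open Q" "bounded Q" and u: "u \<in> L2 Q"
  shows "integrable (lebesgue_on Q) u"
proof -
  have um: "u \<in> borel_measurable (lebesgue_on Q)" and u2: "integrable (lebesgue_on Q) (\<lambda>z. (u z)\<^sup>2)"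
    using u by (auto simp: L2_def)
  have "Q \<in> lmeasurable" using Q by (simp add: bounded_set_imp_lmeasurable)
  then have "finite_measure (lebesgue_on Q)" by (simp add: finite_measure_lebesgue_on)
  then have "integrable (lebesgue_on Q) (\<lambda>z. 1 + (u z)\<^sup>2)"
    using u2 by (intro Bochner_Integration.integrable_add) (simp_all add: finite_measure.integrable_const)
  then show ?thesis
  proof (rule Bochner_Integration.integrable_bound)
    show "AE z in lebesgue_on Q. norm (u z) \<le> norm (1 + (u z)\<^sup>2)"
    proof (rule AE_I2)
      fix z
      have "0 \<le> (\<bar>u z\<bar> - 1)\<^sup>2" by simp
      then have "2 * \<bar>u z\<bar> \<le> 1 + (u z)\<^sup>2" by (simp add: power2_diff)
      then show "norm (u z) \<le> norm (1 + (u z)\<^sup>2)" by simp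
    qed
  qed (rule um)
qed

text \<open>The set where the bound fails is open by continuity, and a nonempty open set is not
  negligible.\<close>

lemma continuous_AE_bound:
  fixes f :: "'b::euclidean_space \<Rightarrow> real"
  assumes Q: "open Q" and f: "continuous_on Q f" and C: "AE z in lebesgue_on Q. \<bar>f z\<bar> \<le> C" and z: "z \<in> Q"
  shows "\<bar>f z\<bar> \<le> C"
proof (rule ccontr)
  assume "\<not> \<bar>f z\<bar> \<le> C"
  define U where "U = Q \<inter> (\<lambda>z. \<bar>f z\<bar>) -` {C<..}"
  have "open U" unfolding U_def by (intro continuous_open_preimage continuous_intros f Q)
  moreover have "U \<noteq> {}" using z \<open>\<not> \<bar>f z\<bar> \<le> C\<close> by (auto simp: U_def)
  ultimately have "\<not> negligible U" by (rule open_not_negligible)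
  moreover have "AE z in lebesgue. z \<notin> U"
  proof -
    have "Q \<inter> space lebesgue \<in> sets lebesgue" using Q by simp
    then have "AE z in lebesgue. z \<in> Q \<longrightarrow> \<bar>f z\<bar> \<le> C" using C by (simp add: AE_restrict_space_iff)
    then show ?thesis by (rule AE_mp) (auto intro!: AE_I2 simp: U_def)
  qed
  then have "U \<in> null_sets lebesgue" using \<open>open U\<close> by (subst AE_iff_null_sets) auto
  ultimately show False by (simp add: negligible_iff_null_sets)
qed

text \<open>Mollifying the equation is testing it with a bump centred at \<open>z\<close>.
  Differentiating that bump in its own variable gives minus the kernel derivative at z - z', and
  this sign cancels the one in the weak formulation.\<close>

lemma weak_solution_difference:
  fixes u1 u2 q :: "'a::euclidean_space \<times> real \<Rightarrow> real" and w v :: "'a \<times> real \<Rightarrow> 'a"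
    and \<Omega> :: "'a set" and T :: real
  defines "Q \<equiv> cylinder \<Omega> T"
  assumes open_\<Omega>: "open \<Omega>"
    and sol: "weak_solution \<Omega> T u_ini f qI qP v u1" "weak_solution \<Omega> T u_ini f qI qP v u2"
    and m: "u1 \<in> borel_measurable (lebesgue_on Q)" "u2 \<in> borel_measurable (lebesgue_on Q)"
      "qP \<in> borel_measurable (lebesgue_on Q)" "\<And>b. b \<in> Basis \<Longrightarrow> (\<lambda>z. v z \<bullet> b) \<in> borel_measurable (lebesgue_on Q)"
    and U: "\<And>z. z \<notin> Q \<Longrightarrow> U1 z = 0" "\<And>z. z \<notin> Q \<Longrightarrow> U2 z = 0"
      "AE z in lborel. z \<in> Q \<longrightarrow> u1 z = U1 z" "AE z in lborel. z \<in> Q \<longrightarrow> u2 z = U2 z"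
      "integrable lborel U1" "integrable lborel U2"
    and q: "q \<in> borel_measurable borel" "\<And>z. \<bar>q z\<bar> \<le> Cq" "AE z in lborel. z \<in> Q \<longrightarrow> qP z = q z"
    and w: "\<And>b. b \<in> Basis \<Longrightarrow> (\<lambda>z. w z \<bullet> b) \<in> borel_measurable borel" "\<And>z b. b \<in> Basis \<Longrightarrow> \<bar>w z \<bullet> b\<bar> \<le> V"
      "AE z in lborel. z \<in> Q \<longrightarrow> v z = w z"
    and \<epsilon>: "\<epsilon> > 0" "snd z + \<epsilon> < T"
  shows "(\<integral>z'. (U1 z' - U2 z') * bump_deriv \<epsilon> (0, 1) (z - z') \<partial>lborel)
      + (\<Sum>b\<in>Basis. \<integral>z'. (U1 z' - U2 z') * (w z' \<bullet> b) * bump_deriv \<epsilon> (b, 0) (z - z') \<partial>lborel)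
      + (\<integral>z'. (U1 z' - U2 z') * q z' * bump \<epsilon> (z - z') \<partial>lborel) = 0"
proof -
  let ?\<phi> = "\<lambda>z'. bump \<epsilon> (z' - z)"
  define Dt where "Dt z' = bump_deriv \<epsilon> (0, 1) (z - z')" for z'
  define Db where "Db b z' = bump_deriv \<epsilon> (b, 0) (z - z')" for b z'
  define k where "k z' = bump \<epsilon> (z - z')" for z'
  \<comment> \<open>All that depends on the source and the initial datum; it is the same for both
    solutions and cancels in the difference.\<close>
  define g where "g = (\<integral>z. f z * qI z * ?\<phi> z \<partial>lebesgue_on Q) + (\<integral>x. u_ini x * ?\<phi> (x, 0) \<partial>lebesgue_on \<Omega>)"
  have Q: "Q \<in> sets borel" unfolding Q_def cylinder_def using open_\<Omega> by (intro borel_open open_Times) auto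
  have Dm: "Dt \<in> borel_measurable borel" "Db b \<in> borel_measurable borel" "k \<in> borel_measurable borel" for b
    unfolding Dt_def Db_def k_def by measurable
  have \<phi>t: "time_deriv ?\<phi> z' = - Dt z'" for z'
    unfolding time_deriv_def partial_deriv_bump Dt_def by (rule bump_deriv_commute)
  have \<phi>x: "a \<bullet> space_grad ?\<phi> z' = - (\<Sum>b\<in>Basis. Db b z' * (a \<bullet> b))" for z' a
    unfolding space_grad_def partial_deriv_bump Db_def
    by (subst bump_deriv_commute) (simp add: inner_sum_right sum_negf)
  have \<phi>k: "?\<phi> z' = k z'" for z' unfolding k_def by (rule bump_commute)
  \<comment> \<open>The bump must vanish near t = T, and only there: being admissible does not
    depend on where its support lies relative to the domain or to t = 0.\<close>
  have test: "?\<phi> \<in> Cc_inf (UNIV \<times> {..<T})"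
  proof (rule bump_in_Cc_inf[OF \<epsilon>(1)], rule subsetI)
    fix z' assume "z' \<in> cball z \<epsilon>"
    then have "\<bar>snd z - snd z'\<bar> \<le> \<epsilon>" using dist_snd_le[of z z'] by (simp add: dist_real_def)
    then show "z' \<in> UNIV \<times> {..<T}" using \<epsilon>(2) by (simp add: mem_Times_iff)
  qed
  have eq: "(\<integral>z'. U z' * Dt z' \<partial>lborel) + (\<Sum>b\<in>Basis. \<integral>z'. U z' * (w z' \<bullet> b) * Db b z' \<partial>lborel)
      + (\<integral>z'. U z' * q z' * k z' \<partial>lborel) = g"
    and ints: "integrable lborel (\<lambda>z'. U z' * Dt z')"
      "\<And>b. b \<in> Basis \<Longrightarrow> integrable lborel (\<lambda>z'. U z' * (w z' \<bullet> b) * Db b z')"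
      "integrable lborel (\<lambda>z'. U z' * q z' * k z')"
    if sol: "weak_solution \<Omega> T u_ini f qI qP v u" and um: "u \<in> borel_measurable (lebesgue_on Q)"
      and U: "\<forall>z. z \<notin> Q \<longrightarrow> U z = 0" "AE z in lborel. z \<in> Q \<longrightarrow> u z = U z" "integrable lborel U" for u U
  proof -
    have Um: "U \<in> borel_measurable borel" using U(3) by auto
    show i1: "integrable lborel (\<lambda>z'. U z' * Dt z')"
      unfolding Dt_def by (rule mollify_integrands[OF U(3) \<epsilon>(1)])
    show i2: "integrable lborel (\<lambda>z'. U z' * (w z' \<bullet> b) * Db b z')" if "b \<in> Basis" for b
      unfolding Db_def by (intro mollify_integrands[OF integrable_mult_bounded[OF U(3) w(1)[OF that] w(2)[OF that]] \<epsilon>(1)])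
    show i3: "integrable lborel (\<lambda>z'. U z' * q z' * k z')"
      unfolding k_def by (intro mollify_integrands[OF integrable_mult_bounded[OF U(3) q(1,2)] \<epsilon>(1)])
    have si: "integrable lborel (\<lambda>z'. \<Sum>b\<in>Basis. U z' * (w z' \<bullet> b) * Db b z')"
      by (intro Bochner_Integration.integrable_sum i2)
    have A: "(\<integral>z'. u z' * time_deriv ?\<phi> z' \<partial>lebesgue_on Q) = - (\<integral>z'. U z' * Dt z' \<partial>lborel)"
    proof -
      have "(\<integral>z'. u z' * (- Dt z') \<partial>lebesgue_on Q) = (\<integral>z'. U z' * (- Dt z') \<partial>lborel)"
      proof (rule lebesgue_on_borel_representative(1)[OF Q])
        show "(\<lambda>z'. u z' * (- Dt z')) \<in> borel_measurable (lebesgue_on Q)"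
          by (intro borel_measurable_times um borel_measurable_uminus borel_imp_measurable_lebesgue_on Dm)
        show "(\<lambda>z'. U z' * (- Dt z')) \<in> borel_measurable borel"
          by (intro borel_measurable_times Um borel_measurable_uminus Dm)
        show "AE z' in lborel. z' \<in> Q \<longrightarrow> u z' * (- Dt z') = U z' * (- Dt z')" using U(2) by (rule AE_mp) (auto intro!: AE_I2)
      qed (simp add: U(1))
      then show ?thesis by (simp add: \<phi>t)
    qed
    have B: "(\<integral>z'. - u z' * (v z' \<bullet> space_grad ?\<phi> z') + u z' * qP z' * ?\<phi> z' \<partial>lebesgue_on Q)
       = (\<integral>z'. (\<Sum>b\<in>Basis. U z' * (w z' \<bullet> b) * Db b z') + U z' * q z' * k z' \<partial>lborel)"
    proof (rule lebesgue_on_borel_representative(1)[OF Q])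
      show "(\<lambda>z'. - u z' * (v z' \<bullet> space_grad ?\<phi> z') + u z' * qP z' * ?\<phi> z') \<in> borel_measurable (lebesgue_on Q)"
        unfolding \<phi>x unfolding \<phi>k
        by (intro borel_measurable_add borel_measurable_times borel_measurable_uminus borel_measurable_sum um m(3,4)
            borel_imp_measurable_lebesgue_on Dm)
      show "(\<lambda>z'. (\<Sum>b\<in>Basis. U z' * (w z' \<bullet> b) * Db b z') + U z' * q z' * k z') \<in> borel_measurable borel"
        by (intro borel_measurable_add borel_measurable_times borel_measurable_sum Um w(1) q(1) Dm)
      show "AE z' in lborel. z' \<in> Q \<longrightarrow> - u z' * (v z' \<bullet> space_grad ?\<phi> z') + u z' * qP z' * ?\<phi> z'
          = (\<Sum>b\<in>Basis. U z' * (w z' \<bullet> b) * Db b z') + U z' * q z' * k z'"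
        using U(2) q(3) w(3)
      proof eventually_elim
        case (elim z')
        show ?case
        proof
          assume "z' \<in> Q"
          then have "u z' = U z'" "qP z' = q z'" "v z' = w z'" using elim by auto
          then show "- u z' * (v z' \<bullet> space_grad ?\<phi> z') + u z' * qP z' * ?\<phi> z'
            = (\<Sum>b\<in>Basis. U z' * (w z' \<bullet> b) * Db b z') + U z' * q z' * k z'"
            unfolding \<phi>x unfolding \<phi>k by (simp add: sum_distrib_left sum_negf mult_ac)
        qed
      qed
    qed (simp add: U(1))
    have C: "(\<integral>z'. (\<Sum>b\<in>Basis. U z' * (w z' \<bullet> b) * Db b z') + U z' * q z' * k z' \<partial>lborel)
      = (\<Sum>b\<in>Basis. \<integral>z'. U z' * (w z' \<bullet> b) * Db b z' \<partial>lborel) + (\<integral>z'. U z' * q z' * k z' \<partial>lborel)"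
      unfolding Bochner_Integration.integral_add[OF si i3]
      by (intro arg_cong2[where f="(+)"] refl Bochner_Integration.integral_sum i2)
    have "- (\<integral>z. u z * time_deriv ?\<phi> z \<partial>lebesgue_on Q) - (\<integral>x. u_ini x * ?\<phi> (x, 0) \<partial>lebesgue_on \<Omega>)
        + (\<integral>z. - u z * (v z \<bullet> space_grad ?\<phi> z) + u z * qP z * ?\<phi> z \<partial>lebesgue_on Q)
        = (\<integral>z. f z * qI z * ?\<phi> z \<partial>lebesgue_on Q)"
      using sol test unfolding weak_solution_def Q_def by blast
    then show "(\<integral>z'. U z' * Dt z' \<partial>lborel) + (\<Sum>b\<in>Basis. \<integral>z'. U z' * (w z' \<bullet> b) * Db b z' \<partial>lborel)
      + (\<integral>z'. U z' * q z' * k z' \<partial>lborel) = g"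
      unfolding A B C g_def by linarith
  qed
  have U0: "\<forall>z. z \<notin> Q \<longrightarrow> U1 z = 0" "\<forall>z. z \<notin> Q \<longrightarrow> U2 z = 0" using U(1,2) by auto
  note e1 = eq[OF sol(1) m(1) U0(1) U(3,5)] and e2 = eq[OF sol(2) m(2) U0(2) U(4,6)]
  note i1 = ints[OF sol(1) m(1) U0(1) U(3,5)] and i2 = ints[OF sol(2) m(2) U0(2) U(4,6)]
  have "(\<integral>z'. (U1 z' - U2 z') * Dt z' \<partial>lborel) = (\<integral>z'. U1 z' * Dt z' \<partial>lborel) - (\<integral>z'. U2 z' * Dt z' \<partial>lborel)"
    unfolding left_diff_distrib by (rule Bochner_Integration.integral_diff[OF i1(1) i2(1)])
  moreover have "(\<integral>z'. (U1 z' - U2 z') * (w z' \<bullet> b) * Db b z' \<partial>lborel)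
    = (\<integral>z'. U1 z' * (w z' \<bullet> b) * Db b z' \<partial>lborel) - (\<integral>z'. U2 z' * (w z' \<bullet> b) * Db b z' \<partial>lborel)" if "b \<in> Basis" for b
    unfolding left_diff_distrib by (rule Bochner_Integration.integral_diff[OF i1(2)[OF that] i2(2)[OF that]])
  moreover have "(\<integral>z'. (U1 z' - U2 z') * q z' * k z' \<partial>lborel) = (\<integral>z'. U1 z' * q z' * k z' \<partial>lborel) - (\<integral>z'. U2 z' * q z' * k z' \<partial>lborel)"
    unfolding left_diff_distrib by (rule Bochner_Integration.integral_diff[OF i1(3) i2(3)])
  ultimately have "(\<integral>z'. (U1 z' - U2 z') * Dt z' \<partial>lborel) + (\<Sum>b\<in>Basis. \<integral>z'. (U1 z' - U2 z') * (w z' \<bullet> b) * Db b z' \<partial>lborel)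
      + (\<integral>z'. (U1 z' - U2 z') * q z' * k z' \<partial>lborel) = g - g"
    using e1 e2 by (simp add: sum_subtractf)
  then show ?thesis by (simp add: Dt_def Db_def k_def)
qed

theorem corollary2p3:
  fixes \<Omega> :: "'a::euclidean_space set" and T :: real
    and u_ini :: "'a \<Rightarrow> real" and f qI qP :: "'a \<times> real \<Rightarrow> real"
    and v :: "'a \<times> real \<Rightarrow> 'a"
    and u1 u2 :: "'a \<times> real \<Rightarrow> real"
  assumes "open \<Omega>" and "bounded \<Omega>" and "connected \<Omega>" and "polyhedral \<Omega>"
    and "T > 0"
    and "u_ini \<in> L2 \<Omega>"
    and "f \<in> L2 (cylinder \<Omega> T)"
    and "qI \<in> Linf (cylinder \<Omega> T)" and "AE z in lebesgue_on (cylinder \<Omega> T). qI z \<ge> 0"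
    and "qP \<in> Linf (cylinder \<Omega> T)" and "AE z in lebesgue_on (cylinder \<Omega> T). qP z \<ge> 0"
    and "v \<in> W1inf_field (cylinder \<Omega> T)"
    and "zero_normal_trace \<Omega> T v"
    and "has_weak_space_div (cylinder \<Omega> T) v (\<lambda>z. qI z - qP z)"
    and "weak_solution \<Omega> T u_ini f qI qP v u1"
    and "weak_solution \<Omega> T u_ini f qI qP v u2"
  shows "AE z in lebesgue_on (cylinder \<Omega> T). u1 z = u2 z"
proof -
  define Q where "Q = cylinder \<Omega> T"
  have opQ: "open Q" unfolding Q_def cylinder_def using assms(1) by (intro open_Times) auto
  have Qb: "Q \<in> sets borel" using opQ by simp
  have bdQ: "bounded Q" unfolding Q_def cylinder_def using bounded_box[of 0 T] assms(2) by (intro bounded_Times) simp_all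
  obtain R where R: "R > 0" "\<And>z. z \<in> Q \<Longrightarrow> norm z \<le> R" using bdQ bounded_pos by blast
  have u12: "u1 \<in> L2 Q" "u2 \<in> L2 Q" using assms(15,16) by (auto simp: weak_solution_def Q_def)
  then have um: "u1 \<in> borel_measurable (lebesgue_on Q)" "u2 \<in> borel_measurable (lebesgue_on Q)"
    by (auto simp: L2_def)
  obtain U1 where U1: "U1 \<in> borel_measurable borel" "\<And>z. z \<notin> Q \<Longrightarrow> U1 z = 0" "AE z in lborel. z \<in> Q \<longrightarrow> u1 z = U1 z"
    using borel_representative[OF Qb um(1)] by blast
  obtain U2 where U2: "U2 \<in> borel_measurable borel" "\<And>z. z \<notin> Q \<Longrightarrow> U2 z = 0" "AE z in lborel. z \<in> Q \<longrightarrow> u2 z = U2 z"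
    using borel_representative[OF Qb um(2)] by blast
  have Ui: "integrable lborel U1" "integrable lborel U2"
    using lebesgue_on_borel_representative(2)[OF Qb um(1) U1] lebesgue_on_borel_representative(2)[OF Qb um(2) U2]
      L2_imp_integrable[OF opQ bdQ] u12 by auto
  obtain Cq where qPm: "qP \<in> borel_measurable (lebesgue_on Q)" and Cq: "AE z in lebesgue_on Q. \<bar>qP z\<bar> \<le> Cq"
    using assms(10) unfolding Linf_def Q_def[symmetric] by blast
  obtain q0 where q0: "q0 \<in> borel_measurable borel" "AE z in lborel. z \<in> Q \<longrightarrow> qP z = q0 z"
    using borel_representative[OF Qb qPm] by blast
  \<comment> \<open>Truncation makes the essential bound hold at every point; the absolute value
    guards against a constant of unknown sign.\<close>
  define q where "q z = max (- \<bar>Cq\<bar>) (min \<bar>Cq\<bar> (q0 z))" for z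
  have q: "q \<in> borel_measurable borel" "\<And>z. \<bar>q z\<bar> \<le> \<bar>Cq\<bar>"
    using q0(1) unfolding q_def by (auto intro!: borel_measurable_max borel_measurable_min)
  have qae: "AE z in lborel. z \<in> Q \<longrightarrow> qP z = q z"
    using q0(2) Cq[unfolded AE_lebesgue_on_iff_lborel[OF Qb]]
    by eventually_elim (auto simp: q_def)
  have vW: "\<And>b. b \<in> Basis \<Longrightarrow> (\<lambda>z. v z \<bullet> b) \<in> W1inf Q" using assms(12) by (simp add: W1inf_field_def Q_def)
  then have vm: "\<And>b. b \<in> Basis \<Longrightarrow> (\<lambda>z. v z \<bullet> b) \<in> borel_measurable (lebesgue_on Q)"
    by (auto simp: W1inf_def Linf_def)
  \<comment> \<open>The trace condition supplies the continuous representative, the one for which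
    values along segments make sense.\<close>
  obtain w0 where w0: "continuous_on Q w0" "AE z in lebesgue_on Q. w0 z = v z"
    using assms(13) unfolding zero_normal_trace_def Q_def by blast
  have w0c: "continuous_on Q (\<lambda>z. w0 z \<bullet> b)" for b by (intro continuous_intros w0)
  have w0ae: "AE z in lebesgue_on Q. w0 z \<bullet> b = v z \<bullet> b" for b using w0(2) by eventually_elim simp
  have "\<exists>V. \<forall>z\<in>Q. \<bar>w0 z \<bullet> b\<bar> \<le> V" if b: "b \<in> Basis" for b
  proof -
    obtain V where "AE z in lebesgue_on Q. \<bar>v z \<bullet> b\<bar> \<le> V" using vW[OF b] by (auto simp: W1inf_def Linf_def)
    then have "AE z in lebesgue_on Q. \<bar>w0 z \<bullet> b\<bar> \<le> V" using w0ae[of b] by eventually_elim simp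
    then show ?thesis using continuous_AE_bound[OF opQ w0c] by blast
  qed
  then obtain Vb where Vb: "\<And>b z. b \<in> Basis \<Longrightarrow> z \<in> Q \<Longrightarrow> \<bar>w0 z \<bullet> b\<bar> \<le> Vb b" by metis
  have "\<exists>L. L \<ge> 0 \<and> (\<forall>z z'. closed_segment z z' \<subseteq> Q \<longrightarrow> \<bar>w0 z \<bullet> b - w0 z' \<bullet> b\<bar> \<le> L * dist z z')" if b: "b \<in> Basis" for b
  proof (rule W1inf_lipschitz_on_segments[OF opQ bdQ w0c Vb[OF b] vW[OF b] w0ae])
    fix L assume "L \<ge> 0" "\<And>z z'. closed_segment z z' \<subseteq> Q \<Longrightarrow> \<bar>w0 z \<bullet> b - w0 z' \<bullet> b\<bar> \<le> L * dist z z'"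
    then show ?thesis by (intro exI[of _ L] conjI allI impI)
  qed
  then obtain Lb where Lb: "\<And>b. b \<in> Basis \<Longrightarrow> Lb b \<ge> 0"
    "\<And>b z z'. b \<in> Basis \<Longrightarrow> closed_segment z z' \<subseteq> Q \<Longrightarrow> \<bar>w0 z \<bullet> b - w0 z' \<bullet> b\<bar> \<le> Lb b * dist z z'" by metis
  \<comment> \<open>Sums over the basis give constants that serve all components at once; absolute
    values make \<open>V\<close> a bound also where the velocity is set to 0.\<close>
  define V where "V = (\<Sum>b\<in>Basis. \<bar>Vb b\<bar>)"
  define L where "L = (\<Sum>b\<in>Basis. Lb b)"
  \<comment> \<open>Zero outside keeps boundedness and Borel measurability on the whole space. A
    jump at the boundary does no harm, since the Lipschitz bound concerns segments inside the
    cylinder.\<close>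
  define w where "w z = (if z \<in> Q then w0 z else 0)" for z
  have Vle: "\<bar>Vb b\<bar> \<le> V" if "b \<in> Basis" for b unfolding V_def using that by (intro member_le_sum) auto
  have Lle: "Lb b \<le> L" if "b \<in> Basis" for b unfolding L_def using that Lb(1) by (intro member_le_sum) auto
  have wm: "(\<lambda>z. w z \<bullet> b) \<in> borel_measurable borel" for b
  proof -
    have "(\<lambda>z. indicator Q z *\<^sub>R (w0 z \<bullet> b)) \<in> borel_measurable borel"
      by (rule borel_measurable_continuous_on_indicator[OF Qb w0c])
    moreover have "(\<lambda>z. indicator Q z *\<^sub>R (w0 z \<bullet> b)) = (\<lambda>z. w z \<bullet> b)" by (auto simp: w_def)
    ultimately show ?thesis by simp
  qed
  have wb: "\<bar>w z \<bullet> b\<bar> \<le> V" if b: "b \<in> Basis" for z b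
  proof (cases "z \<in> Q")
    case True
    then show ?thesis using Vb[OF b True] Vle[OF b] by (simp add: w_def)
  next
    case False
    then show ?thesis using Vle[OF b] by (simp add: w_def)
  qed
  have wae: "AE z in lborel. z \<in> Q \<longrightarrow> v z = w z"
    using w0(2)[unfolded AE_lebesgue_on_iff_lborel[OF Qb]] by eventually_elim (simp add: w_def)
  have wl: "\<bar>w z \<bullet> b - w z' \<bullet> b\<bar> \<le> L * dist z z'" if b: "b \<in> Basis" and seg: "closed_segment z z' \<subseteq> Q" for b z z'
  proof -
    have "z \<in> Q" "z' \<in> Q" using seg by auto
    then have "\<bar>w z \<bullet> b - w z' \<bullet> b\<bar> \<le> Lb b * dist z z'" using Lb(2)[OF b seg] by (simp add: w_def)
    also have "\<dots> \<le> L * dist z z'" using Lle[OF b] by (intro mult_right_mono) auto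
    finally show ?thesis .
  qed
  obtain s :: "'a \<Rightarrow> real" and C where s: "\<And>x y. \<bar>s x - s y\<bar> \<le> dist x y"
    "\<And>x. s x > 0 \<Longrightarrow> \<exists>r>0. convex (\<Omega> \<inter> ball x r)"
    "\<And>\<delta>. 0 < \<delta> \<Longrightarrow> \<delta> \<le> 1 \<Longrightarrow> measure lebesgue {z \<in> cylinder \<Omega> T. s (fst z) \<le> \<delta>} \<le> C * \<delta>\<^sup>2"
    by (rule polyhedral_skeleton[OF assms(4,2), where T=T]) (rule that)
  have eqn: "(\<integral>z'. (U1 z' - U2 z') * bump_deriv \<epsilon> (0, 1) (z - z') \<partial>lborel)
      + (\<Sum>b\<in>Basis. \<integral>z'. (U1 z' - U2 z') * (w z' \<bullet> b) * bump_deriv \<epsilon> (b, 0) (z - z') \<partial>lborel)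
      + (\<integral>z'. (U1 z' - U2 z') * q z' * bump \<epsilon> (z - z') \<partial>lborel) = 0" if "\<epsilon> > 0" "snd z + \<epsilon> < T" for z \<epsilon>
    by (rule weak_solution_difference[OF assms(1,15,16), folded Q_def,
          OF um qPm vm U1(2) U2(2) U1(3) U2(3) Ui q qae wm wb wae that])
  interpret transport \<Omega> T V L "\<bar>Cq\<bar>" R C "\<lambda>z. U1 z - U2 z" q w s
  proof unfold_locales
    show "L \<ge> 0" unfolding L_def using Lb(1) by (intro sum_nonneg)
  qed (use assms(1) R U1(2) U2(2) Ui q wm wb wl s eqn in \<open>auto simp: Q_def\<close>)
  \<comment> \<open>The null set depends on \<open>T'\<close>; countably many values increasing to
    \<open>T\<close> are enough to reach every time before \<open>T\<close>.\<close>
  have "AE z in lborel. \<forall>n. snd z < T - 1 / real (Suc n) \<longrightarrow> U1 z - U2 z = 0"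
    by (subst AE_all_countable) (intro allI solution_vanishes, simp)
  then have "AE z in lborel. z \<in> Q \<longrightarrow> u1 z = u2 z"
    using U1(3) U2(3)
  proof eventually_elim
    case (elim z)
    show ?case
    proof
      assume z: "z \<in> Q"
      then have "snd z < T" by (auto simp: Q_def cylinder_def)
      then obtain n where "1 / real (Suc n) < T - snd z"
        using reals_Archimedean[of "T - snd z"] by (auto simp: inverse_eq_divide)
      then have "snd z < T - 1 / real (Suc n)" by linarith
      then show "u1 z = u2 z" using elim z by auto
    qed
  qed
  then show ?thesis unfolding Q_def[symmetric] AE_lebesgue_on_iff_lborel[OF Qb] .
qed

end
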